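(* Assume $\mathrm{char}\,k=0$. For $d=39$, the maximum dimension of the tangent space to $\mathrm{Hilb}^{d}\mathbb{A}^3$ is not attained at any initial monomial ideal of the generic configuration of $d$ points in $\mathbb{A}^3$. That is, for every term order $<$ on $S=k[x,y,z]$, if $J_<=\mathrm{in}_<(I)$ denotes the initial ideal of the ideal $I$ of a generic configuration of $39$ points in $\mathbb{A}^3$, then $$\dim_kT(J_<)<\max\{\dim_kT(I'):[I']\in\mathrm{Hilb}^{39}\mathbb{A}^3\}.$$
   Context: $k$ is a field of characteristic $0$ and $S=k[x,y,z]$. $\mathrm{Hilb}^d\mathbb{A}^3$ is the Hilbert scheme of $d$ points in $\mathbb{A}^3=\mathrm{Spec}\,S$, with $k$-points $[I]$ corresponding to ideals $I\subseteq S$ with $\dim_k(S/I)=d$; the tangent space at $[I]$ is $T(I)=\mathrm{Hom}_S(I,S/I)$. For a fixed term order $<$, the initial ideal $\mathrm{in}_<(I)$ of the vanishing ideal $I\subseteq S$ of a set of $d$ distinct points of $\mathbb{A}^3$ takes a constant value as the $d$-tuple of points varies in a suitable nonempty Zariski open subset of $(\mathbb{A}^3)^d$; this constant value is what is meant by the initial ideal (with respect to $<$) of the generic configuration of $d$ points. *)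

theory Defs
  imports
    "Jordan_Normal_Form.VS_Connect"
    "HOL-Algebra.QuotRing"
    "HOL-Library.Poly_Mapping"
begin

section \<open>Polynomials\<close>

text \<open>The polynomial ring over \<open>'k\<close> in the indeterminates \<open>'v\<close>, as the monoid algebra of the
  additive monoid \<open>'v \<Rightarrow>\<^sub>0 nat\<close> of exponent vectors.\<close>

type_synonym 'v monom = "'v \<Rightarrow>\<^sub>0 nat"
type_synonym ('v, 'k) mpoly = "'v monom \<Rightarrow>\<^sub>0 'k"

definition const_poly :: "'k \<Rightarrow> ('v, 'k::comm_ring_1) mpoly" where
  "const_poly c = Poly_Mapping.single 0 c"

definition eval_poly :: "('v \<Rightarrow> 'k) \<Rightarrow> ('v, 'k::comm_ring_1) mpoly \<Rightarrow> 'k" where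
  "eval_poly a p = (\<Sum>m\<in>Poly_Mapping.keys p.
     Poly_Mapping.lookup p m * (\<Prod>v\<in>Poly_Mapping.keys m. a v ^ Poly_Mapping.lookup m v))"

datatype var3 = Var_x | Var_y | Var_z

text \<open>\<open>'k poly3\<close> is \<open>S = k[x,y,z]\<close>; a function \<open>var3 \<Rightarrow> 'k\<close> is a \<open>k\<close>-point of affine 3-space.\<close>

type_synonym 'k poly3 = "(var3, 'k) mpoly"

abbreviation poly3_ring :: "'k::field poly3 ring" where
  "poly3_ring \<equiv> class_ring"

section \<open>Modules\<close>

definition ideal_module :: "'a ring \<Rightarrow> 'a set \<Rightarrow> ('a, 'a) module" where
  "ideal_module R I =
     \<lparr>carrier = I, mult = mult R, one = one R, zero = zero R, add = add R, smult = mult R\<rparr>"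

definition quotient_module :: "'a ring \<Rightarrow> 'a set \<Rightarrow> ('a, 'a set) module" where
  "quotient_module R I =
     \<lparr>carrier = carrier (R Quot I), mult = mult (R Quot I), one = one (R Quot I),
      zero = zero (R Quot I), add = add (R Quot I),
      smult = (\<lambda>r X. mult (R Quot I) (I +>\<^bsub>R\<^esub> r) X)\<rparr>"

lemma module_ideal_module:
  assumes "cring R" "ideal I R" shows "Module.module R (ideal_module R I)"
proof -
  interpret I: ideal I R by fact
  have ag: "abelian_group (ideal_module R I)"
  proof (rule abelian_groupI, goal_cases)
    case (6 x)
    then show ?case using I.add.l_inv[of x] I.a_inv_closed[of x] I.a_Hcarr[of x]
      unfolding ideal_module_def by auto
  qed (simp_all add: ideal_module_def I.a_ac I.a_Hcarr)
  show ?thesis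
    by (rule Module.moduleI[OF assms(1) ag])
       (simp_all add: ideal_module_def I.I_l_closed I.l_distr I.r_distr I.m_assoc I.a_Hcarr)
qed

lemma module_quotient_module:
  assumes "cring R" "ideal I R" shows "Module.module R (quotient_module R I)"
proof -
  interpret I: ideal I R by fact
  interpret R: cring R by fact
  have "ring (R Quot I)" by (rule I.quotient_is_ring)
  then interpret Q: ring "R Quot I" .
  have c: "I +>\<^bsub>R\<^esub> r \<in> carrier (R Quot I)" if "r \<in> carrier R" for r
    using that by (auto simp: FactRing_def A_RCOSETS_def RCOSETS_def a_r_coset_def)
  have hom: "(+>\<^bsub>R\<^esub>) I \<in> Ring.ring_hom R (R Quot I)" by (rule I.rcos_ring_hom)
  note h = hom[unfolded Ring.ring_hom_def]
  have ag: "abelian_group (quotient_module R I)"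
  proof (rule abelian_groupI, goal_cases)
    case (6 x)
    then show ?case using Q.l_neg[of x] Q.a_inv_closed[of x] unfolding quotient_module_def by auto
  qed (simp_all add: quotient_module_def Q.a_ac)
  show ?thesis
    by (rule Module.moduleI[OF assms(1) ag])
       (use h c in \<open>simp_all add: quotient_module_def Q.l_distr Q.r_distr Q.m_assoc\<close>)
qed
text \<open>The \<open>R\<close>-module of homomorphisms from \<open>M\<close> to \<open>N\<close>, with pointwise operations. Maps are taken
  extensional, so that equality of homomorphisms means equality on the carrier of \<open>M\<close>. The fields
  \<open>mult\<close> and \<open>one\<close> of a module record play no role and are filled with the zero map.\<close>

definition Hom_module ::
  "'r ring \<Rightarrow> ('r, 'm) module \<Rightarrow> ('r, 'n) module \<Rightarrow> ('r, 'm \<Rightarrow> 'n) module" where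
  "Hom_module R M N =
     \<lparr>carrier = LinearCombinations.module_hom R M N \<inter> extensional (carrier M),
      mult = (\<lambda>f g. \<lambda>m\<in>carrier M. \<zero>\<^bsub>N\<^esub>),
      one = (\<lambda>m\<in>carrier M. \<zero>\<^bsub>N\<^esub>),
      zero = (\<lambda>m\<in>carrier M. \<zero>\<^bsub>N\<^esub>),
      add = (\<lambda>f g. \<lambda>m\<in>carrier M. f m \<oplus>\<^bsub>N\<^esub> g m),
      smult = (\<lambda>r f. \<lambda>m\<in>carrier M. r \<odot>\<^bsub>N\<^esub> f m)\<rparr>"

lemma module_Hom_module:
  assumes "Module.module R M" "Module.module R N" shows "Module.module R (Hom_module R M N)"
proof -
  interpret M: Module.module R M by fact
  interpret N: Module.module R N by fact
  note defs = Hom_module_def LinearCombinations.module_hom_def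
  have ag: "abelian_group (Hom_module R M N)"
  proof (rule abelian_groupI, goal_cases)
    case (6 f)
    let ?g = "\<lambda>m\<in>carrier M. \<ominus>\<^bsub>N\<^esub> f m"
    have "?g \<in> carrier (Hom_module R M N)"
      using 6 by (simp add: defs Pi_iff N.minus_add N.smult_r_minus)
    moreover have "?g \<oplus>\<^bsub>Hom_module R M N\<^esub> f = \<zero>\<^bsub>Hom_module R M N\<^esub>"
      using 6 by (simp add: defs Pi_iff N.l_neg restrict_def fun_eq_iff)
    ultimately show ?case by blast
  next
    case (5 x) then show ?case
      by (auto simp add: defs Pi_iff extensional_def fun_eq_iff restrict_def)
  qed (simp_all add: defs Pi_iff N.a_ac N.smult_r_distr extensional_def fun_eq_iff restrict_def)
  show ?thesis
    by (rule Module.moduleI[OF M.is_cring ag])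
     (auto simp add: defs Pi_iff N.smult_r_distr N.smult_l_distr N.smult_assoc1[symmetric] M.m_comm extensional_def fun_eq_iff restrict_def)
qed
definition restrict_scalars :: "('a \<Rightarrow> 'b) \<Rightarrow> ('b, 'm) module \<Rightarrow> ('a, 'm) module" where
  "restrict_scalars h M =
     \<lparr>carrier = carrier M, mult = mult M, one = one M, zero = zero M, add = add M,
      smult = (\<lambda>c. smult M (h c))\<rparr>"

lemma vectorspace_restrict_scalars_const_poly:
  assumes "Module.module (class_ring :: ('v, 'k::field) mpoly ring) M"
  shows "vectorspace class_ring (restrict_scalars (const_poly :: 'k \<Rightarrow> ('v, 'k) mpoly) M)"
proof -
  interpret M: Module.module "class_ring :: ('v, 'k) mpoly ring" M by fact
  have ag: "abelian_group (restrict_scalars (const_poly :: 'k \<Rightarrow> ('v, 'k) mpoly) M)"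
  proof (rule abelian_groupI, goal_cases)
    case (6 x)
    then show ?case using M.add.l_inv[of x] M.a_inv_closed[of x]
      unfolding restrict_scalars_def by auto
  qed (simp_all add: restrict_scalars_def M.a_ac)
  have cp: "const_poly (a + b) = const_poly a + (const_poly b :: ('v, 'k) mpoly)"
    "const_poly (a * b) = const_poly a * (const_poly b :: ('v, 'k) mpoly)"
    "const_poly (1 :: 'k) = (1 :: ('v, 'k) mpoly)" for a b :: 'k
    by (simp_all add: const_poly_def single_add mult_single)
  have "Module.module (class_ring :: 'k ring)
      (restrict_scalars (const_poly :: 'k \<Rightarrow> ('v, 'k) mpoly) M)"
    using M.smult_closed M.smult_l_distr M.smult_r_distr M.smult_assoc1 M.smult_one
    by (intro Module.moduleI[OF class_cring.is_cring ag]) (simp_all add: restrict_scalars_def cp)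
  then show ?thesis
    by (simp add: vectorspace_def class_field.field_axioms)
qed

section \<open>Points and tangent spaces of the Hilbert scheme\<close>

text \<open>The \<open>k\<close>-points of the Hilbert scheme of \<open>d\<close> points in affine 3-space, as ideals of \<open>S\<close>. Finite-dimensionality is required separately
  because \<^const>\<open>vectorspace.dim\<close> is unspecified for infinite-dimensional spaces.\<close>

definition hilb3 :: "nat \<Rightarrow> 'k::field poly3 set set" where
  "hilb3 d = {I. ideal I poly3_ring \<and>
     (let Q = restrict_scalars const_poly (quotient_module poly3_ring I)
      in vectorspace.fin_dim class_ring Q \<and> vectorspace.dim class_ring Q = d)}"

text \<open>\<open>T(I) = Hom\<^sub>S(I, S/I)\<close> as a vector space over \<open>k\<close>.\<close>

definition tangent_space :: "'k::field poly3 set \<Rightarrow> ('k, 'k poly3 \<Rightarrow> 'k poly3 set) module" where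
  "tangent_space I = restrict_scalars const_poly
     (Hom_module poly3_ring (ideal_module poly3_ring I) (quotient_module poly3_ring I))"

lemma vectorspace_tangent_space:
  assumes "ideal I (poly3_ring :: 'k::field poly3 ring)"
  shows "vectorspace class_ring (tangent_space I)"
  unfolding tangent_space_def using class_cring.is_cring assms
  by (intro vectorspace_restrict_scalars_const_poly module_Hom_module
        module_ideal_module module_quotient_module)

definition tangent_dim :: "'k::field poly3 set \<Rightarrow> nat" where
  "tangent_dim I = vectorspace.dim class_ring (tangent_space I)"

section \<open>Initial ideals\<close>

text \<open>A term order, given by its reflexive relation \<open>leq\<close>. It is automatically a well-order, by
  Dickson's lemma.\<close>

definition term_order :: "('v monom \<Rightarrow> 'v monom \<Rightarrow> bool) \<Rightarrow> bool" where
  "term_order leq \<longleftrightarrow>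
     class.linorder leq (\<lambda>s t. leq s t \<and> s \<noteq> t) \<and>
     (\<forall>t. leq 0 t) \<and>
     (\<forall>s t u. leq s t \<longrightarrow> leq (s + u) (t + u))"

definition is_leading_monom ::
  "('v monom \<Rightarrow> 'v monom \<Rightarrow> bool) \<Rightarrow> ('v, 'k::zero) mpoly \<Rightarrow> 'v monom \<Rightarrow> bool" where
  "is_leading_monom leq p m \<longleftrightarrow>
     m \<in> Poly_Mapping.keys p \<and> (\<forall>m'\<in>Poly_Mapping.keys p. leq m' m)"

definition initial_ideal ::
  "(var3 monom \<Rightarrow> var3 monom \<Rightarrow> bool) \<Rightarrow> 'k::field poly3 set \<Rightarrow> 'k poly3 set" where
  "initial_ideal leq I =
     genideal poly3_ring {Poly_Mapping.single m 1 | m p. p \<in> I \<and> is_leading_monom leq p m}"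

section \<open>Generic configurations of points\<close>

definition vanishing_ideal :: "('v \<Rightarrow> 'k) set \<Rightarrow> ('v, 'k::comm_ring_1) mpoly set" where
  "vanishing_ideal Z = {p. \<forall>a\<in>Z. eval_poly a p = 0}"

text \<open>Zariski open subsets of affine space with coordinates indexed by \<open>V\<close>, i.e. of
  \<open>V \<rightarrow>\<^sub>E UNIV\<close>: complements of the common zero set of a set \<open>E\<close> of polynomials in the
  indeterminates \<open>V\<close>.\<close>

definition zariski_open :: "'v set \<Rightarrow> ('v \<Rightarrow> 'k::field) set \<Rightarrow> bool" where
  "zariski_open V U \<longleftrightarrow>
     (\<exists>E :: ('v, 'k) mpoly set.
        (\<forall>p\<in>E. \<forall>m\<in>Poly_Mapping.keys p. Poly_Mapping.keys m \<subseteq> V) \<and>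
        U = {a \<in> V \<rightarrow>\<^sub>E UNIV. \<exists>p\<in>E. eval_poly a p \<noteq> 0})"

text \<open>A \<open>d\<close>-tuple of points of affine 3-space is a point \<open>a\<close> of the \<open>3d\<close>-dimensional affine space
  with coordinates indexed by \<open>{..<d} \<times> UNIV\<close>; its \<open>i\<close>-th entry is \<open>config_point a i\<close>.\<close>

definition config_point :: "(nat \<times> var3 \<Rightarrow> 'k) \<Rightarrow> nat \<Rightarrow> var3 \<Rightarrow> 'k" where
  "config_point a i = (\<lambda>v. a (i, v))"

text \<open>The constant value that the initial ideal of the vanishing ideal takes on a nonempty Zariski
  open set of \<open>d\<close>-tuples of distinct points.\<close>

definition generic_initial_ideal ::
  "(var3 monom \<Rightarrow> var3 monom \<Rightarrow> bool) \<Rightarrow> nat \<Rightarrow> 'k::field poly3 set" where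
  "generic_initial_ideal leq d =
     (THE J. \<exists>U. zariski_open ({..<d} \<times> UNIV) U \<and> U \<noteq> {} \<and>
        (\<forall>a\<in>U. inj_on (config_point a) {..<d} \<and>
               initial_ideal leq (vanishing_ideal (config_point a ` {..<d})) = J))"

end

theory Submission
  imports
    Defs
    "HOL-Computational_Algebra.Primes"
begin

text \<open>
  The monomials outside the generic initial ideal of 39 points are the 39 smallest ones, so the
  theorem compares tangent spaces of monomial ideals \<open>I\<close> with finite staircase \<open>L\<close> of standard
  monomials.

  Upper bound. Lift \<open>\<phi> \<in> Hom(I, S/I)\<close> to a \<open>k\<close>-linear map \<open>S \<rightarrow> S/I\<close>, arbitrarily on the span of
  \<open>L\<close>. The failures of the lift to be linear over \<open>x\<close> and over \<open>y\<close> are two endomorphisms \<open>A\<close>, \<open>B\<close> of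
  \<open>S/I\<close> with \<open>[A, y] = [B, x]\<close>. By duality the space of such pairs has dimension
  \<open>d\<^sup>2 + dim End\<^bsub>k[x,y]\<^esub>(S/I)\<close>, and the lifts without failure have dimension
  \<open>d + dim End\<^bsub>k[x,y]\<^esub>(S/I)\<close>, hence \<open>dim T(I) \<le> d + 2 dim End\<^bsub>k[x,y]\<^esub>(S/I)\<close>. If \<open>L\<close> consists of the 39
  smallest monomials and \<open>z\<close> is the largest variable, the right-hand side is at most 331 with one
  exception, where it is 333; there one further linear relation between \<open>A\<close> and \<open>B\<close>, which comes from
  linearity over \<open>z\<close>, lowers the bound to 332.

  Lower bound. For \<open>L\<close> made of the monomials of degree at most 4 and \<open>x\<^sup>5, x\<^sup>6, x\<^sup>4y, x\<^sup>4z\<close> there are 333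
  independent tangent vectors: the 21 generators times the 15 socle monomials, and 18 more that link
  a generator \<open>g\<close> to \<open>x g\<close>.
\<close>

section \<open>Subspaces of function spaces\<close>

text \<open>The bound \<open>card L + 2 * card (slice_homs L)\<close> sees \<open>L\<close> only
  through its slices in z-direction, so neither generators nor relations of I have to be found for
  the many possible term orders. The duality is the trace pairing: (A, B) -> [A, y] - [B, x] maps a
  space of dimension 2 d^2 to one of dimension d^2, and the functionals that kill its image are the
  endomorphisms commuting with x and y. Taking z as the largest variable keeps the number of slices
  small. If z^3 or z^4 lies outside \<open>L\<close>, a crude count of the slices is enough (273 and
  327). If z^4 lies in \<open>L\<close>, so do all 35 monomials of degree at most 4, and only four
  more have to be placed. Closure under trading a variable for a smaller one does not suffice to
  place them, for the staircase of the lower bound is itself closed in this sense. It is ruled out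
  by cancellation in the term order, which forbids x^6 next to z^4. The margin between the two
  bounds is a single dimension, so in the last remaining case the general estimate, which equals the
  333 of the lower bound, has to be sharpened by one.\<close>

definition linear_functional :: "(('i \<Rightarrow> 'k::field) \<Rightarrow> 'k) \<Rightarrow> bool" where
  "linear_functional h \<longleftrightarrow> (\<forall>f g. h (\<lambda>i. f i + g i) = h f + h g) \<and> (\<forall>a f. h (\<lambda>i. a * f i) = a * h f)"

definition fun_subspace :: "('i \<Rightarrow> 'k::field) set \<Rightarrow> bool" where
  "fun_subspace V \<longleftrightarrow> (\<lambda>_. 0) \<in> V \<and> (\<forall>f\<in>V. \<forall>g\<in>V. (\<lambda>i. f i + g i) \<in> V) \<and>
     (\<forall>a. \<forall>f\<in>V. (\<lambda>i. a * f i) \<in> V)"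

text \<open>For a finite \<open>Q\<close> and a subspace \<open>V\<close>,
  \<open>determines Q V\<close> bounds the dimension of \<open>V\<close> by \<open>card Q\<close>
  from above and a \<open>dual_family\<close> bounds it from below. All dimension counts below are
  cardinalities of such sets of coordinates.\<close>

definition determines :: "'i set \<Rightarrow> ('i \<Rightarrow> 'k::zero) set \<Rightarrow> bool" where
  "determines Q V \<longleftrightarrow> (\<forall>v\<in>V. (\<forall>q\<in>Q. v q = 0) \<longrightarrow> v = (\<lambda>_. 0))"

definition dual_family :: "'i set \<Rightarrow> ('i \<Rightarrow> 'k::field) set \<Rightarrow> ('i \<Rightarrow> 'i \<Rightarrow> 'k) \<Rightarrow> bool" where
  "dual_family Q V v \<longleftrightarrow> (\<forall>q\<in>Q. v q \<in> V \<and> (\<forall>r\<in>Q. v q r = of_bool (r = q)))"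

lemma fun_subspace_add: "fun_subspace V \<Longrightarrow> f \<in> V \<Longrightarrow> g \<in> V \<Longrightarrow> (\<lambda>i. f i + g i) \<in> V"
  by (simp add: fun_subspace_def)

lemma fun_subspace_scale: "fun_subspace V \<Longrightarrow> f \<in> V \<Longrightarrow> (\<lambda>i. a * f i) \<in> V"
  by (simp add: fun_subspace_def)

lemma linear_functional_add: "linear_functional h \<Longrightarrow> h (\<lambda>i. f i + g i) = h f + h g"
  by (simp add: linear_functional_def)

lemma linear_functional_scale: "linear_functional h \<Longrightarrow> h (\<lambda>i. a * f i) = a * h f"
  by (simp add: linear_functional_def)

lemma linear_functional_zero: "linear_functional h \<Longrightarrow> h (\<lambda>_. 0) = 0"
  using linear_functional_scale[of h 0 "\<lambda>_. 0"] by simp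

lemma determinesD: "determines Q V \<Longrightarrow> v \<in> V \<Longrightarrow> (\<And>q. q \<in> Q \<Longrightarrow> v q = 0) \<Longrightarrow> v = (\<lambda>_. 0)"
  by (simp add: determines_def)

text \<open>Gaussian elimination by induction on the equations: a pivot \<open>x0\<close> of row
  \<open>y\<close> is cleared from the other rows, and the unknown at \<open>x0\<close> is recovered
  from row \<open>y\<close> afterwards.\<close>

lemma homogeneous_system_nontrivial:
  fixes G :: "'y \<Rightarrow> 'x \<Rightarrow> 'k::field"
  assumes "finite Y" "finite X" "card Y < card X"
  shows "\<exists>v. (\<exists>x\<in>X. v x \<noteq> 0) \<and> (\<forall>y\<in>Y. (\<Sum>x\<in>X. G y x * v x) = 0)"
  using assms
proof (induction Y arbitrary: X G rule: finite_induct)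
  case empty
  then obtain x where "x \<in> X" by (metis all_not_in_conv card.empty less_irrefl)
  then show ?case by (intro exI[of _ "\<lambda>_. 1"]) auto
next
  case (insert y Y)
  show ?case
  proof (cases "\<forall>x\<in>X. G y x = 0")
    case True
    have "card Y < card X" using insert by simp
    from insert.IH[OF insert.prems(1) this, of G] True show ?thesis by auto
  next
    case False
    then obtain x0 where x0: "x0 \<in> X" "G y x0 \<noteq> 0" by auto
    let ?X = "X - {x0}"
    define G' where "G' = (\<lambda>z x. G z x - G z x0 / G y x0 * G y x)"
    have "card Y < card ?X" using insert x0 by simp
    then obtain v where v: "\<exists>x\<in>?X. v x \<noteq> 0" "\<forall>z\<in>Y. (\<Sum>x\<in>?X. G' z x * v x) = 0"
      using insert.IH[of ?X G'] insert.prems by auto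
    define s where "s = (\<Sum>x\<in>?X. G y x * v x)"
    define w where "w = v(x0 := - s / G y x0)"
    have split: "(\<Sum>x\<in>X. G z x * w x) = - G z x0 * s / G y x0 + (\<Sum>x\<in>?X. G z x * v x)" for z
    proof -
      have "(\<Sum>x\<in>?X. G z x * w x) = (\<Sum>x\<in>?X. G z x * v x)"
        by (intro sum.cong) (auto simp: w_def)
      then show ?thesis
        using sum.remove[OF insert.prems(1) x0(1), of "\<lambda>x. G z x * w x"] by (simp add: w_def)
    qed
    have "(\<Sum>x\<in>X. G z x * w x) = 0" if "z \<in> insert y Y" for z
    proof (cases "z = y")
      case True
      then show ?thesis using split[of y] x0 by (simp add: s_def)
    next
      case False
      have "(\<Sum>x\<in>?X. G' z x * v x) = (\<Sum>x\<in>?X. G z x * v x) - G z x0 / G y x0 * s"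
        unfolding G'_def s_def by (simp add: algebra_simps sum_subtractf sum_distrib_left)
      moreover have "z \<in> Y" using that False by auto
      ultimately show ?thesis using v(2) split[of z] by (simp add: algebra_simps)
    qed
    moreover have "\<exists>x\<in>X. w x \<noteq> 0" using v(1) by (auto simp: w_def)
    ultimately show ?thesis by blast
  qed
qed

lemma linear_functional_sum:
  assumes "linear_functional h" "finite Q"
  shows "h (\<lambda>i. \<Sum>q\<in>Q. a q * v q i) = (\<Sum>q\<in>Q. a q * h (v q))"
  using assms(2)
proof (induction Q rule: finite_induct)
  case empty
  show ?case using linear_functional_zero[OF assms(1)] by simp
next
  case (insert q Q)
  then show ?case
    by (simp add: linear_functional_add[OF assms(1)] linear_functional_scale[OF assms(1)])
qed

lemma linear_functional_coordinate: "linear_functional (\<lambda>f. f i)"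
  by (simp add: linear_functional_def)

lemma fun_subspace_sum:
  assumes "fun_subspace V" "finite Q" "\<And>q. q \<in> Q \<Longrightarrow> v q \<in> V"
  shows "(\<lambda>i. \<Sum>q\<in>Q. a q * v q i) \<in> V"
  using assms(2,3)
proof (induction Q rule: finite_induct)
  case empty
  show ?case using assms(1) by (simp add: fun_subspace_def)
next
  case (insert q Q)
  then show ?case
    using fun_subspace_add[OF assms(1) fun_subspace_scale[OF assms(1)], of "v q" "\<lambda>i. \<Sum>q\<in>Q. a q * v q i" "a q"]
    by simp
qed

lemma dual_family_sum:
  assumes "dual_family Q V v" "finite Q" "r \<in> Q"
  shows "(\<Sum>q\<in>Q. a q * v q r) = a r"
proof -
  have "(\<Sum>q\<in>Q. a q * v q r) = (\<Sum>q\<in>Q. if q = r then a q else 0)"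
    by (intro sum.cong) (use assms in \<open>auto simp: dual_family_def\<close>)
  then show ?thesis using assms by simp
qed

text \<open>A determining subset of least size works: without \<open>q\<close> it no longer
  determines \<open>V\<close>, so some nonzero \<open>u\<close> in \<open>V\<close> vanishes on the
  rest, and \<open>u\<close> rescaled to 1 at \<open>q\<close> is the dual vector.\<close>

lemma dual_family_exists:
  assumes V: "fun_subspace V" and "finite Q0" "determines Q0 V"
  shows "\<exists>Q\<subseteq>Q0. determines Q V \<and> (\<exists>v. dual_family Q V v)"
proof -
  define Q where "Q = (ARG_MIN card Q. Q \<subseteq> Q0 \<and> determines Q V)"
  have Q: "Q \<subseteq> Q0" "determines Q V" and min: "\<And>Q'. Q' \<subseteq> Q0 \<Longrightarrow> determines Q' V \<Longrightarrow> card Q \<le> card Q'"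
    using arg_min_nat_lemma[of "\<lambda>Q. Q \<subseteq> Q0 \<and> determines Q V" Q0 card] assms unfolding Q_def by auto
  have fin: "finite Q" using Q assms finite_subset by blast
  have "\<exists>u\<in>V. \<forall>r\<in>Q. u r = of_bool (r = q)" if q: "q \<in> Q" for q
  proof -
    have "\<not> determines (Q - {q}) V"
      using min[of "Q - {q}"] Q fin q card_Diff1_less[OF fin q] by fastforce
    then obtain u where u: "u \<in> V" "\<forall>r\<in>Q - {q}. u r = 0" "u \<noteq> (\<lambda>_. 0)"
      unfolding determines_def by blast
    then have "u q \<noteq> 0" using Q(2) unfolding determines_def by blast
    then have "\<forall>r\<in>Q. inverse (u q) * u r = of_bool (r = q)" using u by auto
    moreover have "(\<lambda>i. inverse (u q) * u i) \<in> V" using fun_subspace_scale[OF V u(1)] .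
    ultimately show ?thesis by (intro bexI[of _ "\<lambda>i. inverse (u q) * u i"])
  qed
  then have "\<exists>v. dual_family Q V v" unfolding dual_family_def by metis
  then show ?thesis using Q by blast
qed

text \<open>With fewer functionals than dual vectors, some nontrivial combination of the dual
  vectors would be killed by all functionals.\<close>

lemma dual_family_card_le:
  fixes h :: "'f \<Rightarrow> ('i \<Rightarrow> 'k::field) \<Rightarrow> 'k"
  assumes V: "fun_subspace V" and dual: "dual_family Q V v" and fin: "finite Q" "finite F"
    and lin: "\<And>f. f \<in> F \<Longrightarrow> linear_functional (h f)"
    and inj: "\<And>w. w \<in> V \<Longrightarrow> (\<And>f. f \<in> F \<Longrightarrow> h f w = 0) \<Longrightarrow> w = (\<lambda>_. 0)"
  shows "card Q \<le> card F"
proof (rule ccontr)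
  assume "\<not> ?thesis"
  then obtain a where a: "\<exists>q\<in>Q. a q \<noteq> 0" "\<forall>f\<in>F. (\<Sum>q\<in>Q. h f (v q) * a q) = 0"
    using homogeneous_system_nontrivial[of F Q "\<lambda>f q. h f (v q)"] fin by auto
  define w where "w = (\<lambda>i. \<Sum>q\<in>Q. a q * v q i)"
  have "w \<in> V" unfolding w_def using fun_subspace_sum[OF V fin(1)] dual by (auto simp: dual_family_def)
  moreover have "h f w = 0" if "f \<in> F" for f
    using a(2) that linear_functional_sum[OF lin[OF that] fin(1), of a v] by (simp add: w_def mult.commute)
  ultimately have "w = (\<lambda>_. 0)" by (rule inj)
  then have "a q = 0" if "q \<in> Q" for q
    using dual_family_sum[OF dual fin(1) that, of a] by (simp add: w_def fun_eq_iff)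
  with a(1) show False by auto
qed

lemma dual_family_expansion:
  assumes V: "fun_subspace V" and dual: "dual_family Q V v" and Q: "finite Q" "determines Q V"
    and w: "w \<in> V"
  shows "w = (\<lambda>i. \<Sum>q\<in>Q. w q * v q i)"
proof -
  define s where "s = (\<lambda>i. \<Sum>q\<in>Q. w q * v q i)"
  have "s \<in> V" unfolding s_def using fun_subspace_sum[OF V Q(1), of v w] dual by (auto simp: dual_family_def)
  then have "(\<lambda>i. (- 1) * s i) \<in> V" by (rule fun_subspace_scale[OF V])
  from fun_subspace_add[OF V w this] have "(\<lambda>i. w i + (- 1) * s i) = (\<lambda>_. 0)"
  proof (rule determinesD[OF Q(2)])
    fix r assume "r \<in> Q"
    then show "w r + (- 1) * s r = 0" using dual_family_sum[OF dual Q(1), of r w] by (simp add: s_def)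
  qed
  then have "w i = s i" for i by (simp add: fun_eq_iff)
  then have "w = s" by (rule ext)
  then show ?thesis by (simp only: s_def)
qed

text \<open>A subset of \<open>Q\<close> serves for the kernel of \<open>h\<close>. If it were all
  of \<open>Q\<close>, its dual family would lie in the kernel and yet expand every vector of
  \<open>V\<close>, against \<open>h w \<noteq> 0\<close>.\<close>

lemma hyperplane_determines:
  assumes V: "fun_subspace V" and Q: "finite Q" "determines Q V"
    and h: "linear_functional h" and w: "w \<in> V" "h w \<noteq> 0"
  shows "\<exists>Q'. finite Q' \<and> determines Q' {v \<in> V. h v = 0} \<and> card Q' < card Q"
proof -
  let ?H = "{v \<in> V. h v = 0}"
  have H: "fun_subspace ?H" using V h unfolding fun_subspace_def
    by (simp add: linear_functional_add[OF h] linear_functional_scale[OF h] linear_functional_zero[OF h])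
  have "determines Q ?H" using Q(2) unfolding determines_def by blast
  then obtain Q' u where Q': "Q' \<subseteq> Q" "determines Q' ?H" "dual_family Q' ?H u"
    using dual_family_exists[OF H Q(1)] by blast
  have "Q' \<noteq> Q"
  proof
    assume "Q' = Q"
    then have dual: "dual_family Q V u" and 0: "\<And>q. q \<in> Q \<Longrightarrow> h (u q) = 0"
      using Q'(3) by (auto simp: dual_family_def)
    have "h w = h (\<lambda>i. \<Sum>q\<in>Q. w q * u q i)"
      by (rule arg_cong[OF dual_family_expansion[OF V dual Q w(1)]])
    also have "\<dots> = (\<Sum>q\<in>Q. w q * h (u q))"
      by (rule linear_functional_sum[OF h Q(1)])
    finally have "h w = (\<Sum>q\<in>Q. w q * h (u q))" .
    with 0 w(2) show False by simp
  qed
  then have "card Q' < card Q" using Q'(1) Q(1) by (simp add: psubset_card_mono psubset_eq)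
  with Q' Q(1) show ?thesis using finite_subset by blast
qed

text \<open>Rank-nullity for the matrix \<open>G\<close>, with \<open>card K\<close> standing in for
  the dimension of the kernel of the transpose.\<close>

lemma kernel_determined:
  fixes G :: "'y \<Rightarrow> 'x \<Rightarrow> 'k::field"
  assumes fin: "finite X" "finite Y" "finite K"
    and K: "\<And>w. (\<And>x. x \<in> X \<Longrightarrow> (\<Sum>y\<in>Y. G y x * w y) = 0) \<Longrightarrow> (\<And>k. k \<in> K \<Longrightarrow> w k = 0)
      \<Longrightarrow> \<forall>y\<in>Y. w y = 0" and KY: "K \<subseteq> Y"
  defines "V \<equiv> {v. (\<forall>x. x \<notin> X \<longrightarrow> v x = 0) \<and> (\<forall>y\<in>Y. (\<Sum>x\<in>X. G y x * v x) = 0)}"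
  shows "\<exists>Q\<subseteq>X. determines Q V \<and> card Q + card Y \<le> card X + card K"
proof -
  have V: "fun_subspace V"
    unfolding fun_subspace_def V_def
    by (auto simp: distrib_left sum.distrib mult.left_commute sum_distrib_left[symmetric])
  have "determines X V" unfolding determines_def V_def by auto
  then obtain Q v where Q: "Q \<subseteq> X" "determines Q V" and dual: "dual_family Q V v"
    using dual_family_exists[OF V fin(1)] by blast
  have finQ: "finite Q" using Q fin finite_subset by blast
  have "card Y \<le> card (X - Q) + card K"
  proof (rule ccontr)
    assume less: "\<not> ?thesis"
    \<comment> \<open>The extra rows \<open>Inr k\<close> impose \<open>w k = 0\<close>, which makes
      \<open>card (X - Q) + card K\<close> equations in all.\<close>
    define H where "H = (\<lambda>i y. case i of Inl x \<Rightarrow> G y x | Inr k \<Rightarrow> of_bool (y = k))"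
    have "card ((X - Q) <+> K) < card Y" using less fin by (simp add: card_Plus)
    then obtain w where w: "\<exists>y\<in>Y. w y \<noteq> 0" "\<forall>i\<in>(X - Q) <+> K. (\<Sum>y\<in>Y. H i y * w y) = 0"
      using homogeneous_system_nontrivial[of "(X - Q) <+> K" Y H] fin by auto
    have 1: "(\<Sum>y\<in>Y. G y x * w y) = 0" if "x \<in> X - Q" for x
      using w(2)[rule_format, OF InlI[OF that]] by (simp add: H_def)
    have 2: "w k = 0" if "k \<in> K" for k
    proof -
      have "(\<Sum>y\<in>Y. H (Inr k) y * w y) = (\<Sum>y\<in>Y. if y = k then w y else 0)"
        by (intro sum.cong) (auto simp: H_def)
      then show ?thesis using w(2)[rule_format, OF InrI[OF that]] that KY fin by auto
    qed
    \<comment> \<open>The columns in \<open>Q\<close> come for free: in the pairing of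
      \<open>w\<close> with \<open>G\<close> applied to \<open>v q\<close>, which is 0, only column
      \<open>q\<close> survives, because \<open>w\<close> annihilates the columns outside
      \<open>Q\<close> and \<open>v q\<close> is a unit vector on \<open>Q\<close>.\<close>
    have "(\<Sum>y\<in>Y. G y q * w y) = 0" if q: "q \<in> Q" for q
    proof -
      let ?c = "\<lambda>x. \<Sum>y\<in>Y. G y x * w y"
      have "0 = (\<Sum>y\<in>Y. w y * (\<Sum>x\<in>X. G y x * v q x))"
        using dual q unfolding dual_family_def V_def by simp
      also have "\<dots> = (\<Sum>y\<in>Y. \<Sum>x\<in>X. v q x * (G y x * w y))"
        by (simp add: sum_distrib_left mult_ac)
      also have "\<dots> = (\<Sum>x\<in>X. v q x * ?c x)"
        by (subst sum.swap) (simp add: sum_distrib_left)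
      also have "\<dots> = (\<Sum>x\<in>Q. v q x * ?c x)"
        using 1 Q(1) fin by (intro sum.mono_neutral_right) auto
      also have "\<dots> = (\<Sum>x\<in>Q. if x = q then ?c x else 0)"
        using dual q by (intro sum.cong) (auto simp: dual_family_def)
      also have "\<dots> = ?c q" using finQ q by simp
      finally show ?thesis by simp
    qed
    then have "(\<Sum>y\<in>Y. G y x * w y) = 0" if "x \<in> X" for x using 1 that by blast
    with K[of w] 2 w(1) show False by blast
  qed
  moreover have "card (X - Q) = card X - card Q" "card Q \<le> card X"
    using Q fin finQ by (auto simp: card_Diff_subset card_mono)
  ultimately show ?thesis using Q by auto
qed

section \<open>Staircases and their tangent vectors\<close>

type_synonym expo = "nat \<times> nat \<times> nat"

fun up :: "var3 \<Rightarrow> expo \<Rightarrow> expo" where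
  "up Var_x (i, j, k) = (Suc i, j, k)"
| "up Var_y (i, j, k) = (i, Suc j, k)"
| "up Var_z (i, j, k) = (i, j, Suc k)"

fun down :: "var3 \<Rightarrow> expo \<Rightarrow> expo" where
  "down Var_x (i, j, k) = (i - 1, j, k)"
| "down Var_y (i, j, k) = (i, j - 1, k)"
| "down Var_z (i, j, k) = (i, j, k - 1)"

fun coord :: "var3 \<Rightarrow> expo \<Rightarrow> nat" where
  "coord Var_x (i, j, k) = i"
| "coord Var_y (i, j, k) = j"
| "coord Var_z (i, j, k) = k"

lemma up_inject [simp]: "up e u = up e v \<longleftrightarrow> u = v"
  by (cases e; cases u; cases v) auto

lemma up_neq [simp]: "up e u \<noteq> u" "u \<noteq> up e u"
  by (cases e; cases u; auto)+

lemma down_up [simp]: "down e (up e u) = u" by (cases e; cases u) auto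

lemma up_down: "coord e u \<noteq> 0 \<Longrightarrow> up e (down e u) = u" by (cases e; cases u) auto

lemma coord_up [simp]: "coord e (up f u) = (if e = f then Suc (coord e u) else coord e u)"
  by (cases e; cases f; cases u) auto

lemma coord_down [simp]: "coord e (down f u) = (if e = f then coord e u - 1 else coord e u)"
  by (cases e; cases f; cases u) auto

lemma up_commute: "up e (up f u) = up f (up e u)" by (cases e; cases f; cases u) auto

lemma down_commute: "down e (down f u) = down f (down e u)" by (cases e; cases f; cases u) auto

lemma down_up_commute: "e \<noteq> f \<Longrightarrow> down e (up f u) = up f (down e u)" by (cases e; cases f; cases u) auto

definition staircase :: "expo set \<Rightarrow> bool" where
  "staircase L \<longleftrightarrow> finite L \<and> (\<forall>e u. up e u \<in> L \<longrightarrow> u \<in> L)"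

lemma staircase_up: "staircase L \<Longrightarrow> up e u \<in> L \<Longrightarrow> u \<in> L"
  unfolding staircase_def by blast

lemma staircase_finite: "staircase L \<Longrightarrow> finite L"
  unfolding staircase_def by blast

lemma staircase_down: "staircase L \<Longrightarrow> u \<in> L \<Longrightarrow> down e u \<in> L"
  using staircase_up[of L e "down e u"] up_down[of e u]
  by (cases "coord e u = 0") (cases e; cases u; auto)+

text \<open>For a function \<open>\<phi>\<close> on pairs, \<open>\<lambda>b. \<phi> (u, b)\<close> stands for the element of \<open>S/I\<close> with these
  coordinates in the basis \<open>L\<close> of standard monomials. In this reading \<open>shift\<close> is multiplication by a
  variable, and \<open>defect\<close> measures the failure of \<open>\<phi>\<close> to be linear over it.\<close>

definition shift :: "var3 \<Rightarrow> (expo \<times> expo \<Rightarrow> 'k::zero) \<Rightarrow> expo \<times> expo \<Rightarrow> 'k" where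
  "shift e \<phi> = (\<lambda>(u, b). if coord e b = 0 then 0 else \<phi> (u, down e b))"

definition defect :: "expo set \<Rightarrow> var3 \<Rightarrow> (expo \<times> expo \<Rightarrow> 'k::ab_group_add) \<Rightarrow> expo \<times> expo \<Rightarrow> 'k" where
  "defect L e \<phi> = (\<lambda>(u, b). if b \<in> L then \<phi> (up e u, b) - shift e \<phi> (u, b) else 0)"

text \<open>The monomials outside \<open>L\<close> span I, so these functions are the k-linear maps
  S -> S/I whose restriction to I is S-linear. Setting the free values over \<open>L\<close> to 0,
  as in \<open>tangents\<close>, leaves Hom(I, S/I) itself.\<close>

definition lifted_tangents :: "expo set \<Rightarrow> (expo \<times> expo \<Rightarrow> 'k::field) set" where
  "lifted_tangents L = {\<phi>. (\<forall>u b. b \<notin> L \<longrightarrow> \<phi> (u, b) = 0) \<and>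
     (\<forall>e u b. u \<notin> L \<longrightarrow> defect L e \<phi> (u, b) = 0)}"

definition tangents :: "expo set \<Rightarrow> (expo \<times> expo \<Rightarrow> 'k::field) set" where
  "tangents L = {\<phi> \<in> lifted_tangents L. \<forall>u\<in>L. \<forall>b. \<phi> (u, b) = 0}"

lemma lifted_tangents_outside: "\<phi> \<in> lifted_tangents L \<Longrightarrow> b \<notin> L \<Longrightarrow> \<phi> (u, b) = 0"
  by (simp add: lifted_tangents_def del: split_paired_All)

lemma lifted_tangents_defect: "\<phi> \<in> lifted_tangents L \<Longrightarrow> u \<notin> L \<Longrightarrow> defect L e \<phi> (u, b) = 0"
  by (simp add: lifted_tangents_def del: split_paired_All)

lemma defect_add: "defect L e (\<lambda>i. f i + g i) = (\<lambda>i. defect L e f i + defect L e g i)"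
  by (auto simp: defect_def shift_def fun_eq_iff)

lemma defect_scale: "defect L e (\<lambda>i. a * f i) = (\<lambda>i. (a :: 'k::field) * defect L e f i)"
  by (auto simp: defect_def shift_def fun_eq_iff algebra_simps)

lemma defect_zero: "defect L e (\<lambda>_. 0) = (\<lambda>_. 0 :: 'k::field)"
  by (auto simp: defect_def shift_def fun_eq_iff)

lemma fun_subspace_lifted_tangents: "fun_subspace (lifted_tangents L)"
  unfolding fun_subspace_def lifted_tangents_def by (auto simp: defect_add defect_scale defect_zero)

lemma fun_subspace_tangents: "fun_subspace (tangents L)"
  using fun_subspace_lifted_tangents[of L] unfolding fun_subspace_def tangents_def by auto

text \<open>Both sides expand to the same four terms, since multiplications by two variables
  commute. Applied to a lift, this is the relation [A, y] = [B, x].\<close>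

lemma defect_commute:
  assumes "staircase L" "\<And>u b. b \<notin> L \<Longrightarrow> \<phi> (u, b) = 0" "e \<noteq> f"
  shows "defect L e (defect L f \<phi>) = defect L f (defect L e \<phi>)"
proof
  fix i :: "expo \<times> expo"
  obtain u b where i: "i = (u, b)" by (cases i) blast
  show "defect L e (defect L f \<phi>) i = defect L f (defect L e \<phi>) i"
  proof (cases "b \<in> L")
    case True
    then have "down e b \<in> L" "down f b \<in> L" using staircase_down[OF assms(1)] by auto
    with True assms(3) show ?thesis
      by (simp add: i defect_def shift_def up_commute[of e f] down_commute[of e f])
  qed (simp add: i defect_def)
qed

text \<open>The pairs \<open>(k, b)\<close> index a basis of \<open>End\<^bsub>k[x,y]\<^esub>(S/I)\<close>: as a \<open>k[x,y]\<close>-module, \<open>S/I\<close> is the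
  direct sum of its slices, the \<open>k\<close>-th one being generated by \<open>z\<^sup>k\<close>.\<close>

definition slice_homs :: "expo set \<Rightarrow> (nat \<times> expo) set" where
  "slice_homs L = {(k, b1, b2, b3). (b1, b2, b3) \<in> L \<and>
     (\<forall>p q. (p, q, k) \<notin> L \<longrightarrow> (b1 + p, b2 + q, b3) \<notin> L)}"

lemma slice_homsD: "staircase L \<Longrightarrow> (k, b) \<in> slice_homs L \<Longrightarrow> (0, 0, k) \<in> L \<and> b \<in> L"
  by (force simp: slice_homs_def)

lemma finite_slice_homs: "staircase L \<Longrightarrow> finite (slice_homs L)"
proof (rule finite_subset)
  assume L: "staircase L"
  show "slice_homs L \<subseteq> (\<lambda>(_, _, k). k) ` L \<times> L"
    using slice_homsD[OF L] by (force simp del: split_paired_Ex)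
  show "finite ((\<lambda>(_, _, k). k) ` L \<times> L)" using staircase_finite[OF L] by simp
qed

text \<open>The part of \<open>v\<close> at \<open>True\<close> is A, the failure over x, and the
  part at \<open>False\<close> is B, the failure over y. On endomorphisms of S/I, that is, functions
  supported on \<open>L \<times> L\<close>, \<open>defect\<close> is the commutator with a
  variable.\<close>

definition commuting_pairs :: "expo set \<Rightarrow> (bool \<times> expo \<times> expo \<Rightarrow> 'k::field) set" where
  "commuting_pairs L = {v. (\<forall>s u b. u \<notin> L \<or> b \<notin> L \<longrightarrow> v (s, u, b) = 0) \<and>
     (\<forall>i\<in>L \<times> L. defect L Var_y (\<lambda>i. v (True, i)) i = defect L Var_x (\<lambda>i. v (False, i)) i)}"

lemma fun_subspace_commuting_pairs: "fun_subspace (commuting_pairs L)"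
  unfolding fun_subspace_def commuting_pairs_def by (auto simp: defect_add defect_scale defect_zero)

definition defect_pair :: "expo set \<Rightarrow> (expo \<times> expo \<Rightarrow> 'k::field) \<Rightarrow> bool \<times> expo \<times> expo \<Rightarrow> 'k" where
  "defect_pair L \<phi> = (\<lambda>(s, i). defect L (if s then Var_x else Var_y) \<phi> i)"

lemma defect_pair_commuting:
  assumes "staircase L" "\<phi> \<in> lifted_tangents L"
  shows "defect_pair L \<phi> \<in> commuting_pairs L"
proof -
  have "defect L e \<phi> (u, b) = 0" if "u \<notin> L \<or> b \<notin> L" for e u b
    using lifted_tangents_defect[OF assms(2)] that by (cases "u \<in> L") (auto simp: defect_def)
  moreover have "defect L Var_y (defect L Var_x \<phi>) = defect L Var_x (defect L Var_y \<phi>)"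
    using lifted_tangents_outside[OF assms(2)] by (intro defect_commute assms(1)) auto
  ultimately show ?thesis unfolding commuting_pairs_def defect_pair_def by simp
qed

section \<open>The commutator with a variable as a matrix, and its transpose\<close>

definition defect_coeff :: "var3 \<Rightarrow> expo \<times> expo \<Rightarrow> expo \<times> expo \<Rightarrow> 'k::field" where
  "defect_coeff e = (\<lambda>(u, b) (n, c). of_bool (n = up e u \<and> c = b) - of_bool (n = u \<and> up e c = b))"

lemma Inl_in_Plus: "Inl x \<in> A <+> B \<longleftrightarrow> x \<in> A" and Inr_in_Plus: "Inr y \<in> A <+> B \<longleftrightarrow> y \<in> B"
  by auto

lemma sum_delta_pair:
  fixes f :: "'i \<Rightarrow> 'k::field"
  assumes "finite A"
  shows "(\<Sum>i\<in>A. of_bool (i = a) * f i) = (if a \<in> A then f a else 0)"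
proof -
  have "(\<Sum>i\<in>A. of_bool (i = a) * f i) = (\<Sum>i\<in>A. if i = a then f i else 0)" by (intro sum.cong) auto
  then show ?thesis using assms by simp
qed

lemma defect_eq_sum:
  assumes L: "staircase L" and i: "i \<in> L \<times> L" and f: "\<And>j. j \<notin> L \<times> L \<Longrightarrow> f j = (0 :: 'k::field)"
  shows "(\<Sum>j\<in>L \<times> L. defect_coeff e i j * f j) = defect L e f i"
proof -
  obtain u b where ub: "i = (u, b)" "u \<in> L" "b \<in> L" using i by auto
  have fin: "finite (L \<times> L)" using staircase_finite[OF L] by simp
  have "defect_coeff e i j * f j = of_bool (j = (up e u, b)) * f j
     - (if coord e b = 0 then 0 else of_bool (j = (u, down e b)) * f j)" for j
    using up_down[of e b] by (cases j) (auto simp: ub defect_coeff_def algebra_simps)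
  then have "(\<Sum>j\<in>L \<times> L. defect_coeff e i j * f j) = (\<Sum>j\<in>L \<times> L. of_bool (j = (up e u, b)) * f j)
     - (if coord e b = 0 then 0 else (\<Sum>j\<in>L \<times> L. of_bool (j = (u, down e b)) * f j))"
    by (simp add: sum_subtractf)
  also have "\<dots> = defect L e f i"
    using f ub staircase_down[OF L, of b e] unfolding sum_delta_pair[OF fin] by (auto simp: defect_def shift_def)
  finally show ?thesis .
qed

text \<open>With the arguments of \<open>f\<close> exchanged, the right-hand side is minus a
  commutator again; this is why the transposed kernel consists of k[x,y]-linear
  endomorphisms.\<close>

lemma transposed_defect_eq_sum:
  assumes L: "staircase L" and i: "n \<in> L" "c \<in> L"
  shows "(\<Sum>j\<in>L \<times> L. defect_coeff e j (n, c) * f j) =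
    (if coord e n = 0 then 0 else f (down e n, c)) - (if up e c \<in> L then f (n, up e c) else (0 :: 'k::field))"
proof -
  have fin: "finite (L \<times> L)" using staircase_finite[OF L] by simp
  have "defect_coeff e j (n, c) * f j = 
     (if coord e n = 0 then 0 else of_bool (j = (down e n, c)) * f j) - of_bool (j = (n, up e c)) * f j" for j
    using up_down[of e n] by (cases j) (auto simp: defect_coeff_def algebra_simps)
  then have "(\<Sum>j\<in>L \<times> L. defect_coeff e j (n, c) * f j) = 
     (if coord e n = 0 then 0 else (\<Sum>j\<in>L \<times> L. of_bool (j = (down e n, c)) * f j))
      - (\<Sum>j\<in>L \<times> L. of_bool (j = (n, up e c)) * f j)"
    by (simp add: sum_subtractf)
  also have "\<dots> = (if coord e n = 0 then 0 else f (down e n, c)) - (if up e c \<in> L then f (n, up e c) else 0)"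
    using i staircase_down[OF L, of n e] unfolding sum_delta_pair[OF fin] by auto
  finally show ?thesis .
qed

section \<open>Maps into S/I that are linear over k[x,y]\<close>

definition slice_linear :: "expo set \<Rightarrow> (expo \<times> expo \<Rightarrow> 'k::zero) \<Rightarrow> bool" where
  "slice_linear L \<phi> \<longleftrightarrow> (\<forall>e\<in>{Var_x, Var_y}. \<forall>m b.
     (up e b \<in> L \<longrightarrow> \<phi> (up e m, up e b) = \<phi> (m, b)) \<and>
     (b \<in> L \<longrightarrow> coord e b = 0 \<longrightarrow> \<phi> (up e m, b) = 0))"

lemma slice_linear_up: "slice_linear L \<phi> \<Longrightarrow> e \<in> {Var_x, Var_y} \<Longrightarrow> up e b \<in> L \<Longrightarrow> \<phi> (up e m, up e b) = \<phi> (m, b)"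
  unfolding slice_linear_def by blast

lemma slice_linear_bottom:
  "slice_linear L \<phi> \<Longrightarrow> e \<in> {Var_x, Var_y} \<Longrightarrow> b \<in> L \<Longrightarrow> coord e b = 0 \<Longrightarrow> \<phi> (up e m, b) = 0"
  unfolding slice_linear_def by blast

lemma slice_linear_translate:
  assumes "staircase L" "slice_linear L \<phi>" "(b1 + p, b2 + q, b3) \<in> L"
  shows "\<phi> ((m1 + p, m2 + q, k), (b1 + p, b2 + q, b3)) = \<phi> ((m1, m2, k), (b1, b2, b3))"
  using assms(3)
proof (induction p)
  case 0
  then show ?case
  proof (induction q)
    case (Suc q)
    then have "\<phi> (up Var_y (m1, m2 + q, k), up Var_y (b1, b2 + q, b3)) = \<phi> ((m1, m2 + q, k), (b1, b2 + q, b3))"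
      by (intro slice_linear_up[OF assms(2)]) auto
    with Suc staircase_up[OF assms(1), of Var_y "(b1, b2 + q, b3)"] show ?case by simp
  qed simp
next
  case (Suc p)
  then have "\<phi> (up Var_x (m1 + p, m2 + q, k), up Var_x (b1 + p, b2 + q, b3)) =
      \<phi> ((m1 + p, m2 + q, k), (b1 + p, b2 + q, b3))"
    by (intro slice_linear_up[OF assms(2)]) auto
  with Suc staircase_up[OF assms(1), of Var_x "(b1 + p, b2 + q, b3)"] show ?case by simp
qed

lemma slice_linear_step:
  assumes L: "staircase L" and lin: "slice_linear L \<phi>" and e: "e \<in> {Var_x, Var_y}"
    and 0: "\<And>b. b \<in> L \<Longrightarrow> \<phi> (m, b) = 0" and b: "b \<in> L"
  shows "\<phi> (up e m, b) = 0"
proof (cases "coord e b = 0")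
  case True
  then show ?thesis by (rule slice_linear_bottom[OF lin e b])
next
  case False
  then have "\<phi> (up e m, up e (down e b)) = \<phi> (m, down e b)"
    using b by (intro slice_linear_up[OF lin e]) (simp add: up_down)
  with False 0 staircase_down[OF L b] show ?thesis by (simp add: up_down)
qed

lemma slice_linear_vanish:
  assumes L: "staircase L" and lin: "slice_linear L \<phi>" and 0: "\<And>b. b \<in> L \<Longrightarrow> \<phi> ((0, 0, k), b) = 0"
    and b: "b \<in> L"
  shows "\<phi> ((p, q, k), b) = 0"
  using b
proof (induction p arbitrary: b)
  case 0
  then show ?case
  proof (induction q arbitrary: b)
    case 0
    then show ?case by (rule assms(3))
  next
    case (Suc q)
    then show ?case using slice_linear_step[OF L lin, of Var_y "(0, q, k)" b] by simp
  qed
next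
  case (Suc p)
  then show ?case using slice_linear_step[OF L lin, of Var_x "(p, q, k)" b] by simp
qed

text \<open>If (k, b) is not admissible, some x^p y^q with (p, q, k) outside \<open>L\<close>
  carries the coefficient of b in \<phi>(z^n) to a coefficient of \<phi>(x^p y^q z^n), which
  vanishes by assumption. The levels k and n are kept apart because endomorphisms use n = k and
  lifted tangent vectors use n = k + 1.\<close>

lemma slice_linear_not_slice_hom:
  assumes L: "staircase L" and lin: "slice_linear L \<phi>" and b: "b \<in> L" "(k, b) \<notin> slice_homs L"
    and 0: "\<And>p q b. (p, q, k) \<notin> L \<Longrightarrow> b \<in> L \<Longrightarrow> \<phi> ((p, q, n), b) = 0"
  shows "\<phi> ((0, 0, n), b) = 0"
proof -
  obtain b1 b2 b3 where b': "b = (b1, b2, b3)" by (cases b)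
  with b obtain p q where pq: "(p, q, k) \<notin> L" "(b1 + p, b2 + q, b3) \<in> L"
    by (auto simp: slice_homs_def)
  have "\<phi> ((0, 0, n), b) = \<phi> ((0 + p, 0 + q, n), (b1 + p, b2 + q, b3))"
    unfolding b' by (rule slice_linear_translate[OF L lin pq(2), symmetric])
  then show ?thesis using 0[OF pq] by simp
qed

lemma slice_linear_eq_0:
  assumes L: "staircase L" and lin: "slice_linear L \<phi>"
    and out: "\<And>m b. m \<notin> L \<Longrightarrow> \<phi> (m, b) = 0"
    and 0: "\<And>k b. (k, b) \<in> slice_homs L \<Longrightarrow> \<phi> ((0, 0, k), b) = 0" and b: "b \<in> L"
  shows "\<phi> (m, b) = 0"
proof -
  obtain p q k where m: "m = (p, q, k)" by (cases m)
  have "\<phi> ((0, 0, k), b) = 0" if "b \<in> L" for b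
    using slice_linear_not_slice_hom[OF L lin that] out 0 by blast
  then show ?thesis unfolding m by (rule slice_linear_vanish[OF L lin _ b])
qed

lemma slice_linear_if_defect_0:
  assumes "\<And>e m b. e \<in> {Var_x, Var_y} \<Longrightarrow> defect L e \<phi> (m, b) = 0"
  shows "slice_linear L \<phi>"
proof -
  have *: "b \<in> L \<Longrightarrow> \<phi> (up e m, b) = shift e \<phi> (m, b)" if "e \<in> {Var_x, Var_y}" for e m b
    using assms[OF that, of m b] by (simp add: defect_def)
  show ?thesis unfolding slice_linear_def
  proof (intro ballI allI conjI impI)
    fix e m b assume e: "e \<in> {Var_x, Var_y}"
    show "\<phi> (up e m, up e b) = \<phi> (m, b)" if "up e b \<in> L" using *[OF e that, of m] by (simp add: shift_def)
    show "\<phi> (up e m, b) = 0" if "b \<in> L" "coord e b = 0" using *[OF e that(1), of m] that by (simp add: shift_def)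
  qed
qed

text \<open>A lift without failure over x and y is k[x,y]-linear on S, hence given by its values at
  the powers of z. For (p, q, k) outside \<open>L\<close>, linearity over z yields \<phi>(x^p y^q
  z^(k+1)) = z \<phi>(x^p y^q z^k). So once level k vanishes, \<phi>(z^(k+1)) can only have
  coefficients that slice k admits. Hence the count: \<open>card L\<close> for \<phi>(1), and one
  for each element of \<open>slice_homs L\<close>.\<close>

lemma lifted_tangent_eq_0:
  assumes L: "staircase L" and \<phi>: "\<phi> \<in> lifted_tangents L" and pair: "defect_pair L \<phi> = (\<lambda>_. 0)"
    and 0: "\<And>b. b \<in> L \<Longrightarrow> \<phi> ((0, 0, 0), b) = 0"
    and hom: "\<And>k b. (k, b) \<in> slice_homs L \<Longrightarrow> \<phi> ((0, 0, Suc k), b) = 0"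
  shows "\<phi> = (\<lambda>_. 0)"
proof -
  have "defect L e \<phi> i = 0" if "e \<in> {Var_x, Var_y}" for e i
    using that fun_cong[OF pair, of "(True, i)"] fun_cong[OF pair, of "(False, i)"]
    by (auto simp: defect_pair_def)
  then have lin: "slice_linear L \<phi>" by (intro slice_linear_if_defect_0)
  have z: "\<phi> ((0, 0, k), b) = 0" if "b \<in> L" for k b
    using that
  proof (induction k arbitrary: b)
    case 0
    then show ?case by (rule assms(4))
  next
    case (Suc k)
    have "\<phi> ((p, q, Suc k), b) = 0" if "(p, q, k) \<notin> L" "b \<in> L" for p q b
    proof -
      have "\<phi> ((p, q, Suc k), b) = shift Var_z \<phi> ((p, q, k), b)"
        using lifted_tangents_defect[OF \<phi> that(1), of Var_z b] that(2) by (simp add: defect_def)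
      then show ?thesis
        using slice_linear_vanish[OF L lin Suc.IH staircase_down[OF L that(2)]] by (simp add: shift_def)
    qed
    then show ?case
      using slice_linear_not_slice_hom[OF L lin Suc.prems] hom by blast
  qed
  have "\<phi> ((p, q, k), b) = 0" if "b \<in> L" for p q k b
    by (rule slice_linear_vanish[OF L lin z that])
  then have "\<phi> (m, b) = 0" for m b
    using lifted_tangents_outside[OF \<phi>] by (cases m; cases "b \<in> L") auto
  then show ?thesis by (intro ext) (metis surj_pair)
qed

text \<open>The linear map whose kernel is \<open>commuting_pairs L\<close> has the transposed kernel
  \<open>End\<^bsub>k[x,y]\<^esub>(S/I)\<close>.\<close>

lemma commuting_pairs_determined:
  assumes L: "staircase L"
  shows "\<exists>Q. finite Q \<and> determines Q (commuting_pairs L :: (_ \<Rightarrow> 'k::field) set) \<and>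
    card Q \<le> card L ^ 2 + card (slice_homs L)"
proof -
  define X where "X = (UNIV :: bool set) \<times> (L \<times> L)"
  define Y where "Y = L \<times> L"
  \<comment> \<open>The arguments stand in the order of the transposed system:
    \<open>w (b, (0, 0, k))\<close> will be the coefficient of b in the image of z^k.\<close>
  define K :: "(expo \<times> expo) set" where "K = (\<lambda>(k, b). (b, (0, 0, k))) ` slice_homs L"
  define G where "G = (\<lambda>j (s, i). if s then defect_coeff Var_y j i else - defect_coeff Var_x j i :: 'k)"
  have fin: "finite L" "finite X" "finite Y" "finite K"
    using staircase_finite[OF L] finite_slice_homs[OF L] by (auto simp: X_def Y_def K_def)
  have G: "(\<Sum>x\<in>X. G j x * v x) =
      (\<Sum>i\<in>L \<times> L. defect_coeff Var_y j i * v (True, i)) - (\<Sum>i\<in>L \<times> L. defect_coeff Var_x j i * v (False, i))"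
    for j v
  proof -
    have "(\<Sum>x\<in>X. G j x * v x) = (\<Sum>(s, i)\<in>UNIV \<times> (L \<times> L). G j (s, i) * v (s, i))"
      unfolding X_def by (intro sum.cong) auto
    also have "\<dots> = (\<Sum>s\<in>UNIV. \<Sum>i\<in>L \<times> L. G j (s, i) * v (s, i))"
      by (rule sum.cartesian_product[symmetric])
    also have "\<dots> = (\<Sum>i\<in>L \<times> L. G j (False, i) * v (False, i)) + (\<Sum>i\<in>L \<times> L. G j (True, i) * v (True, i))"
      unfolding UNIV_bool by (subst sum.insert) (simp_all del: split_paired_All)
    finally show ?thesis by (simp add: G_def sum_negf)
  qed
  have eq: "commuting_pairs L = {v. (\<forall>x. x \<notin> X \<longrightarrow> v x = 0) \<and> (\<forall>y\<in>Y. (\<Sum>x\<in>X. G y x * v x) = 0)}"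
    (is "_ = ?V")
  proof -
    have out: "(\<forall>s u b. u \<notin> L \<or> b \<notin> L \<longrightarrow> v (s, u, b) = 0) \<longleftrightarrow> (\<forall>x. x \<notin> X \<longrightarrow> v x = 0)" for v :: "_ \<Rightarrow> 'k"
    proof
      assume *: "\<forall>s u b. u \<notin> L \<or> b \<notin> L \<longrightarrow> v (s, u, b) = 0"
      show "\<forall>x. x \<notin> X \<longrightarrow> v x = 0"
      proof (intro allI impI)
        fix x assume "x \<notin> X"
        moreover obtain s u b where "x = (s, u, b)" by (rule prod_cases3)
        ultimately show "v x = 0" using *[rule_format, of u b s] by (simp add: X_def)
      qed
    next
      assume *: "\<forall>x. x \<notin> X \<longrightarrow> v x = 0"
      show "\<forall>s u b. u \<notin> L \<or> b \<notin> L \<longrightarrow> v (s, u, b) = 0"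
        by (intro allI impI *[rule_format]) (simp add: X_def)
    qed
    have iff: "(\<Sum>x\<in>X. G i x * v x) = 0 \<longleftrightarrow> defect L Var_y (\<lambda>i. v (True, i)) i = defect L Var_x (\<lambda>i. v (False, i)) i"
      if v: "\<forall>x. x \<notin> X \<longrightarrow> v x = 0" and i: "i \<in> L \<times> L" for v i
    proof -
      have "v (s, j) = 0" if "j \<notin> L \<times> L" for s j using that by (intro v[rule_format]) (simp add: X_def)
      then have "(\<Sum>j\<in>L \<times> L. defect_coeff e i j * v (s, j)) = defect L e (\<lambda>j. v (s, j)) i" for e s
        by (intro defect_eq_sum[OF L i])
      then show ?thesis unfolding G by (simp only: right_minus_eq)
    qed
    show ?thesis
      unfolding commuting_pairs_def out Y_def
      by (rule Collect_cong, rule conj_cong[OF refl], rule ball_cong[OF refl], rule iff[symmetric])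
  qed
  have "\<forall>y\<in>Y. w y = 0"
    if ker: "\<And>x. x \<in> X \<Longrightarrow> (\<Sum>y\<in>Y. G y x * w y) = 0" and K: "\<And>k. k \<in> K \<Longrightarrow> w k = 0" for w :: "expo \<times> expo \<Rightarrow> 'k"
  proof -
    \<comment> \<open>The trace pairing: with its arguments exchanged, \<open>w\<close> is an
      endomorphism of S/I that commutes with x and y.\<close>
    define \<psi> where "\<psi> = (\<lambda>(c, n). if c \<in> L then w (n, c) else 0)"
    have dual: "(if coord e n = 0 then 0 else w (down e n, c)) = (if up e c \<in> L then w (n, up e c) else 0)"
      if "e \<in> {Var_x, Var_y}" "n \<in> L" "c \<in> L" for e n c
    proof -
      have "(\<Sum>y\<in>L \<times> L. defect_coeff e y (n, c) * w y) = 0"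
        using that(1) ker[of "(True, n, c)"] ker[of "(False, n, c)"] that(2,3)
        by (auto simp: X_def Y_def G_def sum_negf)
      then show ?thesis unfolding transposed_defect_eq_sum[OF L that(2,3)] by simp
    qed
    have "slice_linear L \<psi>"
      unfolding slice_linear_def
    proof (intro ballI allI conjI impI)
      fix e m b assume e: "e \<in> {Var_x, Var_y}"
      show "\<psi> (up e m, up e b) = \<psi> (m, b)" if "up e b \<in> L"
        using dual[OF e that, of m] staircase_up[OF L, of e m] by (auto simp: \<psi>_def)
      show "\<psi> (up e m, b) = 0" if "b \<in> L" "coord e b = 0"
        using dual[OF e that(1), of m] staircase_up[OF L, of e m] that(2) by (auto simp: \<psi>_def)
    qed
    then have \<psi>: "\<psi> (c, n) = 0" if "n \<in> L" for c n
    proof (rule slice_linear_eq_0[OF L _ _ _ that])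
      show "\<psi> (m, b) = 0" if "m \<notin> L" for m b using that by (simp add: \<psi>_def)
      show "\<psi> ((0, 0, k), b) = 0" if "(k, b) \<in> slice_homs L" for k b
        using K[of "(b, (0, 0, k))"] that by (force simp: \<psi>_def K_def)
    qed
    have "w (n, c) = 0" if "n \<in> L" "c \<in> L" for n c
      using \<psi>[OF that(1), of c] that(2) by (simp add: \<psi>_def)
    then show ?thesis by (auto simp: Y_def)
  qed
  moreover have "K \<subseteq> Y" using slice_homsD[OF L] by (auto simp: K_def Y_def)
  ultimately obtain Q where Q: "Q \<subseteq> X" "determines Q (commuting_pairs L :: (_ \<Rightarrow> 'k) set)"
      "card Q + card Y \<le> card X + card K"
    using kernel_determined[OF fin(2-4), of G] unfolding eq[symmetric] by blast
  have "card K \<le> card (slice_homs L)" unfolding K_def by (rule card_image_le[OF finite_slice_homs[OF L]])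
  moreover have "card X = 2 * card L ^ 2" "card Y = card L ^ 2"
    using fin by (auto simp: X_def Y_def card_cartesian_product power2_eq_square)
  ultimately have "card Q \<le> card L ^ 2 + card (slice_homs L)" using Q(3) by linarith
  with Q fin(2) show ?thesis using finite_subset by blast
qed

text \<open>Every choice of values on \<open>L \<times> L\<close> extends a tangent vector to a lifted one, which accounts for
  the term \<open>(card L)\<^sup>2\<close>.\<close>

lemma tangents_dual_family_bound:
  assumes L: "staircase L" and dual: "dual_family Q (tangents L :: (_ \<Rightarrow> 'k::field) set) c" "finite Q"
    and R: "finite R" "determines R V"
      "\<And>\<phi> :: _ \<Rightarrow> 'k. \<phi> \<in> lifted_tangents L \<Longrightarrow> defect_pair L \<phi> \<in> V"
  shows "card Q + card L ^ 2 \<le> card L + card (slice_homs L) + card R"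
proof -
  have finL: "finite L" by (rule staircase_finite[OF L])
  have c: "c q \<in> lifted_tangents L" "\<And>u b. u \<in> L \<Longrightarrow> c q (u, b) = 0" if "q \<in> Q" for q
    using dual that unfolding dual_family_def tangents_def by blast+
  \<comment> \<open>\<open>c q q = 1\<close>, whereas tangent vectors vanish over \<open>L\<close>.
    So \<open>Q\<close> is disjoint from \<open>L \<times> L\<close> and the two families can be
    joined.\<close>
  have disj: "fst q \<notin> L" if "q \<in> Q" for q
    using dual(1) c(2)[OF that, of "fst q" "snd q"] that unfolding dual_family_def by force
  define v where "v = (\<lambda>q. if q \<in> Q then c q else (\<lambda>i. of_bool (i = q)))"
  have delta: "(\<lambda>i. of_bool (i = q)) \<in> (lifted_tangents L :: (_ \<Rightarrow> 'k) set)" if "q \<in> L \<times> L" for q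
    unfolding lifted_tangents_def
  proof (intro CollectI conjI allI impI)
    show "of_bool ((u, b) = q) = (0 :: 'k)" if "b \<notin> L" for u b using that \<open>q \<in> L \<times> L\<close> by auto
    show "defect L e (\<lambda>i. of_bool (i = q)) (u, b) = (0 :: 'k)" if "u \<notin> L" for e u b
      using that \<open>q \<in> L \<times> L\<close> staircase_up[OF L, of e u] by (auto simp: defect_def shift_def)
  qed
  have dual': "dual_family (Q \<union> L \<times> L) (lifted_tangents L) v"
    unfolding dual_family_def
  proof (intro ballI conjI)
    fix q assume q: "q \<in> Q \<union> L \<times> L"
    show "v q \<in> lifted_tangents L" using q c(1) delta by (auto simp: v_def)
    fix r assume r: "r \<in> Q \<union> L \<times> L"
    show "v q r = of_bool (r = q)"
    proof (cases "q \<in> Q \<and> r \<notin> Q")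
      case True
      then show ?thesis using r c(2)[of q "fst r" "snd r"] by (auto simp: v_def)
    next
      case False
      then show ?thesis using dual(1) by (auto simp: v_def dual_family_def)
    qed
  qed
  \<comment> \<open>The functionals that fix a lift by \<open>lifted_tangent_eq_0\<close>: the
    coefficients of \<phi>(1), one coefficient of \<phi>(z^(k+1)) for each slice homomorphism, and
    enough coordinates of the defect pair.\<close>
  define F :: "(expo \<times> expo + nat \<times> expo + bool \<times> expo \<times> expo) set"
    where "F = (({(0, 0, 0)} \<times> L) <+> (slice_homs L <+> R))"
  define h :: "_ \<Rightarrow> (expo \<times> expo \<Rightarrow> 'k) \<Rightarrow> 'k" where
    "h = (\<lambda>f \<phi>. case f of Inl i \<Rightarrow> \<phi> i | Inr (Inl (k, b)) \<Rightarrow> \<phi> ((0, 0, Suc k), b)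
       | Inr (Inr r) \<Rightarrow> defect_pair L \<phi> r)"
  have "card (Q \<union> L \<times> L) \<le> card F"
  proof (rule dual_family_card_le[OF fun_subspace_lifted_tangents dual', where h = h])
    show "finite (Q \<union> L \<times> L)" "finite F"
      using dual(2) finL finite_slice_homs[OF L] R(1) by (auto simp: F_def)
    show "linear_functional (h f)" for f
      unfolding h_def defect_pair_def linear_functional_def
      by (auto simp: defect_add defect_scale split: sum.splits)
    fix \<phi> assume \<phi>: "\<phi> \<in> lifted_tangents L" and 0: "\<And>f. f \<in> F \<Longrightarrow> h f \<phi> = 0"
    have "defect_pair L \<phi> r = 0" if "r \<in> R" for r
      using 0[of "Inr (Inr r)"] that by (simp add: F_def h_def Inl_in_Plus Inr_in_Plus)
    then have "defect_pair L \<phi> = (\<lambda>_. 0)" by (rule determinesD[OF R(2) R(3)[OF \<phi>]])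
    then show "\<phi> = (\<lambda>_. 0)"
    proof (rule lifted_tangent_eq_0[OF L \<phi>])
      show "\<phi> ((0, 0, 0), b) = 0" if "b \<in> L" for b
        using 0[of "Inl ((0, 0, 0), b)"] that by (simp add: F_def h_def Inl_in_Plus Inr_in_Plus)
      show "\<phi> ((0, 0, Suc k), b) = 0" if "(k, b) \<in> slice_homs L" for k b
        using 0[of "Inr (Inl (k, b))"] that by (simp add: F_def h_def Inl_in_Plus Inr_in_Plus)
    qed
  qed
  moreover have "card (Q \<union> L \<times> L) = card Q + card L ^ 2"
    using disj dual(2) finL by (subst card_Un_disjoint) (auto simp: card_cartesian_product power2_eq_square)
  moreover have "card F = card L + card (slice_homs L) + card R"
    using finL finite_slice_homs[OF L] R(1) by (simp add: F_def card_Plus card_cartesian_product)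
  ultimately show ?thesis by simp
qed

text \<open>The d^2 free values of a lift over \<open>L\<close> cancel against the d^2 in the
  dimension of the commuting pairs.\<close>

theorem tangents_rank_bound:
  assumes L: "staircase L" and dual: "dual_family Q (tangents L :: (_ \<Rightarrow> 'k::field) set) c" "finite Q"
  shows "card Q \<le> card L + 2 * card (slice_homs L)"
proof -
  obtain R where R: "finite R" "determines R (commuting_pairs L :: (_ \<Rightarrow> 'k) set)"
      "card R \<le> card L ^ 2 + card (slice_homs L)"
    using commuting_pairs_determined[OF L] by blast
  from tangents_dual_family_bound[OF L dual R(1,2) defect_pair_commuting[OF L]] R(3)
  show ?thesis by simp
qed

text \<open>\<open>h\<close> is a linear relation that holds for all defect pairs but not for all
  commuting pairs. The defect pairs therefore lie in a proper hyperplane, which saves one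
  dimension.\<close>

theorem tangents_rank_bound_strict:
  assumes L: "staircase L" and dual: "dual_family Q (tangents L :: (_ \<Rightarrow> 'k::field) set) c" "finite Q"
    and h: "linear_functional h" "\<And>\<phi> :: _ \<Rightarrow> 'k. \<phi> \<in> lifted_tangents L \<Longrightarrow> h (defect_pair L \<phi>) = 0"
    and v: "v \<in> commuting_pairs L" "h v \<noteq> 0"
  shows "card Q < card L + 2 * card (slice_homs L)"
proof -
  obtain R where R: "finite R" "determines R (commuting_pairs L :: (_ \<Rightarrow> 'k) set)"
      "card R \<le> card L ^ 2 + card (slice_homs L)"
    using commuting_pairs_determined[OF L] by blast
  obtain R' where R': "finite R'" "determines R' {v \<in> commuting_pairs L. h v = 0}" "card R' < card R"
    using hyperplane_determines[OF fun_subspace_commuting_pairs R(1,2) h(1) v] by blast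
  have "defect_pair L \<phi> \<in> {v \<in> commuting_pairs L. h v = 0}" if "\<phi> \<in> lifted_tangents L" for \<phi>
    using defect_pair_commuting[OF L that] h(2)[OF that] by simp
  from tangents_dual_family_bound[OF L dual R'(1,2) this] R(3) R'(3)
  show ?thesis by simp
qed

section \<open>Staircases of 39 smallest monomials\<close>

definition expo_order :: "(expo \<Rightarrow> expo \<Rightarrow> bool) \<Rightarrow> bool" where
  "expo_order leq \<longleftrightarrow> (\<forall>u v w. leq u v \<longrightarrow> leq v w \<longrightarrow> leq u w) \<and> (\<forall>u v. leq u v \<longrightarrow> leq v u \<longrightarrow> u = v) \<and>
     (\<forall>u v. leq u v \<or> leq v u) \<and> (\<forall>u. leq (0, 0, 0) u) \<and>
     (\<forall>a b c a' b' c' i j k. leq (a, b, c) (a', b', c') \<longrightarrow> leq (a + i, b + j, c + k) (a' + i, b' + j, c' + k)) \<and>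
     leq (1, 0, 0) (0, 1, 0) \<and> leq (0, 1, 0) (0, 0, 1)"

lemma expo_orderD:
  assumes "expo_order leq"
  shows expo_order_trans: "leq u v \<Longrightarrow> leq v w \<Longrightarrow> leq u w"
    and expo_order_antisym: "leq u v \<Longrightarrow> leq v u \<Longrightarrow> u = v"
    and expo_order_total: "leq u v \<or> leq v u"
    and expo_order_least: "leq (0, 0, 0) u"
    and expo_order_add: "leq (a, b, c) (a', b', c') \<Longrightarrow> leq (a + i, b + j, c + k) (a' + i, b' + j, c' + k)"
    and expo_order_xy: "leq (1, 0, 0) (0, 1, 0)"
    and expo_order_yz: "leq (0, 1, 0) (0, 0, 1)"
  using assms unfolding expo_order_def by blast+

lemma expo_order_cancel:
  assumes "expo_order leq" "leq (a + i, b + j, c + k) (a' + i, b' + j, c' + k)"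
  shows "leq (a, b, c) (a', b', c')"
proof (rule ccontr)
  assume not: "\<not> ?thesis"
  then have "leq (a', b', c') (a, b, c)" using expo_order_total[OF assms(1)] by blast
  then have "leq (a' + i, b' + j, c' + k) (a + i, b + j, c + k)" by (rule expo_order_add[OF assms(1)])
  then have "(a, b, c) = (a', b', c')" using expo_order_antisym[OF assms] by simp
  with not expo_order_total[OF assms(1), of "(a, b, c)" "(a', b', c')"] show False by simp
qed

text \<open>The complement is a strongly stable monomial ideal, the shape of Borel-fixed ideals in
  characteristic 0, with z as the strongest variable.\<close>

definition borel_fixed :: "expo set \<Rightarrow> bool" where
  "borel_fixed L \<longleftrightarrow> staircase L \<and> (\<forall>a b c. (a, Suc b, c) \<in> L \<longrightarrow> (Suc a, b, c) \<in> L) \<and>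
     (\<forall>a b c. (a, b, Suc c) \<in> L \<longrightarrow> (a, Suc b, c) \<in> L)"

definition lower_set :: "(expo \<Rightarrow> expo \<Rightarrow> bool) \<Rightarrow> expo set \<Rightarrow> bool" where
  "lower_set leq L \<longleftrightarrow> finite L \<and> (\<forall>u v. leq u v \<longrightarrow> v \<in> L \<longrightarrow> u \<in> L)"

lemma lower_setD: "lower_set leq L \<Longrightarrow> leq u v \<Longrightarrow> v \<in> L \<Longrightarrow> u \<in> L"
  unfolding lower_set_def by blast

lemma lower_set_borel_fixed:
  assumes leq: "expo_order leq" and L: "lower_set leq L"
  shows "borel_fixed L"
proof -
  have "leq u (up e u)" for e u
  proof -
    obtain a b c where u: "u = (a, b, c)" by (cases u)
    have "leq (0 + a, 0 + b, 0 + c) (i + a, j + b, k + c)" for i j k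
      by (rule expo_order_add[OF leq expo_order_least[OF leq]])
    from this[of 1 0 0] this[of 0 1 0] this[of 0 0 1] show ?thesis by (cases e) (simp_all add: u)
  qed
  then have 1: "staircase L" using L unfolding staircase_def lower_set_def by blast
  have 2: "leq (Suc a, b, c) (a, Suc b, c)" for a b c
    using expo_order_add[OF leq expo_order_xy[OF leq], of a b c] by simp
  have 3: "leq (a, Suc b, c) (a, b, Suc c)" for a b c
    using expo_order_add[OF leq expo_order_yz[OF leq], of a b c] by simp
  show ?thesis using 1 2 3 lower_setD[OF L] unfolding borel_fixed_def by blast
qed

lemma borel_fixed_staircase: "borel_fixed L \<Longrightarrow> staircase L" by (simp add: borel_fixed_def)

text \<open>Trading z for y, trading y for x and deleting x each lower exactly one of the partial
  sums c, b + c, a + b + c. Performed in this order, they reach every dominated triple.\<close>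

lemma borel_fixed_dominated:
  assumes L: "borel_fixed L" and u: "(a', b', c') \<in> L" and leq: "c \<le> c'" "b + c \<le> b' + c'" "a + b + c \<le> a' + b' + c'"
  shows "(a, b, c) \<in> L"
proof -
  have z: "(i, j, k + n) \<in> L \<Longrightarrow> (i, j + n, k) \<in> L" for i j k n
  proof (induction n arbitrary: j)
    case (Suc n)
    then have "(i, j, Suc (k + n)) \<in> L" by simp
    then have "(i, Suc j, k + n) \<in> L" using L unfolding borel_fixed_def by blast
    from Suc.IH[OF this] show ?case by simp
  qed simp
  have y: "(i, j + n, k) \<in> L \<Longrightarrow> (i + n, j, k) \<in> L" for i j k n
  proof (induction n arbitrary: i)
    case (Suc n)
    then have "(i, Suc (j + n), k) \<in> L" by simp
    then have "(Suc i, j + n, k) \<in> L" using L unfolding borel_fixed_def by blast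
    from Suc.IH[OF this] show ?case by simp
  qed simp
  have x: "(i + n, j, k) \<in> L \<Longrightarrow> (i, j, k) \<in> L" for i j k n
  proof (induction n)
    case (Suc n)
    then show ?case using staircase_up[OF borel_fixed_staircase[OF L], of Var_x "(i + n, j, k)"] by simp
  qed simp
  have "(a', b' + (c' - c), c) \<in> L" using z[of a' b' c "c' - c"] u leq by simp
  then have "(a' + (b' + (c' - c) - b), b, c) \<in> L" using y[of a' b "b' + (c' - c) - b" c] leq by simp
  then show ?thesis using x[of a "a' + (b' + (c' - c) - b) - a" b c] leq by simp
qed

definition triples :: "expo list" where
  "triples = List.product [0..<8] (List.product [0..<8] [0..<8])"

lemma set_triples: "set triples = {(a, b, c). a < 8 \<and> b < 8 \<and> c < 8}"
  by (auto simp: triples_def)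

text \<open>Only slices 0, 1 and 2 are nonzero, and each contributes at most one homomorphism per
  target monomial.\<close>

lemma slice_homs_card_height_3:
  assumes L: "staircase L" and "(0, 0, 3) \<notin> L"
  shows "card (slice_homs L) \<le> 3 * card L"
proof -
  have "k < 3" if "(k, b) \<in> slice_homs L" for k b
  proof (rule ccontr)
    assume "\<not> k < 3"
    then obtain n where n: "k = 3 + n" by (metis le_Suc_ex not_less)
    have "(0, 0, 3 + n) \<notin> L"
    proof (induction n)
      case (Suc n)
      then show ?case using staircase_up[OF L, of Var_z "(0, 0, 3 + n)"] by auto
    qed (use assms in simp)
    with slice_homsD[OF L that] n show False by simp
  qed
  then have "slice_homs L \<subseteq> {..<3} \<times> L" using slice_homsD[OF L] by (auto simp del: split_paired_All)
  then have "card (slice_homs L) \<le> card ({..<3 :: nat} \<times> L)"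
    using staircase_finite[OF L] by (intro card_mono) auto
  then show ?thesis by (simp add: card_cartesian_product)
qed

text \<open>The three lower slices are estimated by 39 each. The slice of z^3 is killed by x^2, so
  z^3 can only go to monomials b with x^2 b outside \<open>L\<close>, and there are at most 27 of
  these: 117 + 27 = 144.\<close>

lemma slice_homs_card_height_4:
  assumes L: "borel_fixed L" "card L = 39" and z4: "(0, 0, 4) \<notin> L"
  shows "card (slice_homs L) \<le> 144"
proof -
  have fin: "finite L" using staircase_finite[OF borel_fixed_staircase[OF L(1)]] .
  \<comment> \<open>Otherwise \<open>L\<close> would contain everything dominated by x^2 z^3, which
    is 40 monomials.\<close>
  have x2z3: "(2, 0, 3) \<notin> L"
  proof
    assume *: "(2, 0, 3) \<in> L"
    have "set (filter (\<lambda>(a, b, c). c \<le> 3 \<and> b + c \<le> 3 \<and> a + b + c \<le> 5) triples) \<subseteq> L"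
      using borel_fixed_dominated[OF L(1) *] by auto
    then have "card (set (filter (\<lambda>(a, b, c). c \<le> 3 \<and> b + c \<le> 3 \<and> a + b + c \<le> 5) triples)) \<le> card L"
      by (rule card_mono[OF fin])
    moreover have "card (set (filter (\<lambda>(a, b, c). c \<le> 3 \<and> b + c \<le> 3 \<and> a + b + c \<le> 5) triples)) = 40"
      by code_simp
    ultimately show False using L(2) by simp
  qed
  define S where "S i = {(b, c). (i, b, c) \<in> L}" for i
  have S: "finite (S i)" for i
    by (rule finite_subset[of _ "snd ` L"]) (auto simp: S_def fin intro: rev_image_eqI)
  \<comment> \<open>\<open>S i\<close> collects the monomials with x-exponent i. Trading one y for x
    embeds those divisible by y into the next column; the others are counted by
    \<open>h\<close>.\<close>
  have step: "card (S i) \<le> h + card (S (Suc i))" if h: "\<And>c. (i, 0, c) \<in> L \<Longrightarrow> c < h" for i h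
  proof -
    have "S i \<subseteq> Pair 0 ` {..<h} \<union> (\<lambda>(b, c). (Suc b, c)) ` S (Suc i)"
    proof
      fix p assume p: "p \<in> S i"
      obtain b c where bc: "p = (b, c)" by (cases p)
      show "p \<in> Pair 0 ` {..<h} \<union> (\<lambda>(b, c). (Suc b, c)) ` S (Suc i)"
      proof (cases b)
        case 0
        then show ?thesis using p h bc by (auto simp: S_def)
      next
        case (Suc b')
        then have "(b', c) \<in> S (Suc i)"
          using p bc borel_fixed_dominated[OF L(1), of i b c c b' "Suc i"] by (simp add: S_def)
        then show ?thesis using bc Suc by force
      qed
    qed
    then have "card (S i) \<le> card (Pair (0 :: nat) ` {..<h} \<union> (\<lambda>(b, c). (Suc b, c)) ` S (Suc i))"
      using S by (intro card_mono) auto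
    also have "\<dots> \<le> card (Pair (0 :: nat) ` {..<h}) + card ((\<lambda>(b, c). (Suc b, c)) ` S (Suc i))" by (rule card_Un_le)
    also have "\<dots> \<le> h + card (S (Suc i))"
      using card_image_le[of "{..<h}" "Pair (0 :: nat)"] card_image_le[OF S, of "\<lambda>(b, c). (Suc b, c)" "Suc i"] by simp
    finally show ?thesis .
  qed
  have z: "c < 4" if "(i, 0, c) \<in> L" for i c
    using borel_fixed_dominated[OF L(1) that, of 4 0 0] z4 by force
  have z': "c < 3" if "(2, 0, c) \<in> L" for c
    using borel_fixed_dominated[OF L(1) that, of 3 0 2] x2z3 by force
  have n: "card (S 0) \<le> 4 + card (S 1)" "card (S 1) \<le> 4 + card (S 2)" "card (S 2) \<le> 3 + card (S 3)"
    using step[of 0 4] step[of 1 4] step[of 2 3] z z' by (auto simp: numeral_2_eq_2 numeral_3_eq_3)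
  define A where "A i = Pair i ` S i" for i :: nat
  have A: "card (A i) = card (S i)" "finite (A i)" for i using S by (auto simp: A_def card_image inj_on_def)
  define B where "B = {b \<in> L. \<not> fst b < 2}"
  have "L = A 0 \<union> A 1 \<union> B" by (force simp: A_def S_def B_def less_2_cases_iff)
  then have "card L \<le> card (A 0) + card (A 1) + card B"
    by (metis (no_types, lifting) add_le_mono card_Un_le le_trans order_refl)
  moreover have "A 2 \<union> A 3 \<subseteq> B" by (auto simp: A_def S_def B_def)
  then have "card (A 2 \<union> A 3) \<le> card B" by (intro card_mono) (auto simp: B_def fin)
  moreover have "card (A 2 \<union> A 3) = card (A 2) + card (A 3)"
    using A(2) by (intro card_Un_disjoint) (auto simp: A_def)
  \<comment> \<open>The columns 0 and 1 together have at most 12 + 2 card (S 2) elements, and 2 card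
    (S 2) is at most 3 + card (S 2) + card (S 3), hence at most 3 + card B. So 39 is at most 15 + 2
    card B.\<close>
  ultimately have B12: "12 \<le> card B" using n L(2) A(1)[of 0] A(1)[of 1] A(1)[of 2] A(1)[of 3] by linarith
  define C where "C = {b \<in> L. (fst b + 2, snd b) \<notin> L}"
  \<comment> \<open>Division by x^2 maps the monomials of \<open>L\<close> divisible by x^2 onto
    those b for which x^2 b stays in \<open>L\<close>.\<close>
  have "card (L - C) = card B"
  proof (rule bij_betw_same_card[of "\<lambda>b. (fst b + 2, snd b)"], rule bij_betw_byWitness[where f' = "\<lambda>b. (fst b - 2, snd b)"])
    show "(\<lambda>b. (fst b - 2, snd b)) ` B \<subseteq> L - C"
    proof (rule image_subsetI)
      fix u assume u: "u \<in> B"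
      obtain a b c where "u = (a, b, c)" by (cases u)
      then show "(fst u - 2, snd u) \<in> L - C"
        using u borel_fixed_dominated[OF L(1), of a b c c b "a - 2"] le_add_diff_inverse2[of 2 a] by (auto simp: B_def C_def not_less)
    qed
  qed (auto simp: B_def C_def)
  moreover have "card (L - C) = card L - card C" "card C \<le> card L"
    using fin by (auto simp: C_def intro!: card_Diff_subset card_mono)
  ultimately have C27: "card C \<le> 27" using B12 L(2) by simp
  have "slice_homs L \<subseteq> {..<3} \<times> L \<union> {3} \<times> C"
  proof
    fix x assume x: "x \<in> slice_homs L"
    obtain k b1 b2 b3 where xb: "x = (k, b1, b2, b3)" by (cases x)
    have "(0, 0, k) \<in> L" "(b1, b2, b3) \<in> L" using slice_homsD[OF borel_fixed_staircase[OF L(1)]] x xb by blast+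
    moreover have "(b1, b2, b3) \<in> C" if "k = 3"
      using x that x2z3 unfolding xb slice_homs_def C_def by force
    ultimately show "x \<in> {..<3} \<times> L \<union> {3} \<times> C" using z[of 0 k] by (force simp: xb)
  qed
  then have "card (slice_homs L) \<le> card ({..<3 :: nat} \<times> L \<union> {3} \<times> C)"
    using fin by (intro card_mono) (auto simp: C_def)
  also have "\<dots> \<le> card ({..<3 :: nat} \<times> L) + card ({3 :: nat} \<times> C)" by (rule card_Un_le)
  also have "\<dots> \<le> 144" using C27 L(2) by (simp add: card_cartesian_product)
  finally show ?thesis .
qed

definition simplex4 :: "expo set" where
  "simplex4 = {(a, b, c). a + b + c \<le> 4}"

lemma card_simplex4: "card simplex4 = 35" and finite_simplex4: "finite simplex4"
proof -
  have eq: "simplex4 = set (filter (\<lambda>(a, b, c). a + b + c \<le> 4) triples)"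
    by (auto simp: simplex4_def set_triples)
  show "card simplex4 = 35" unfolding eq by code_simp
  show "finite simplex4" unfolding eq by simp
qed

text \<open>All 35 monomials of degree at most 4 are dominated by z^4, so four places remain. Once
  x^6 is excluded they are filled in degree 5, where domination leaves only two choices. Excluding
  x^6 is the step that uses cancellation in the order and not just domination.\<close>

lemma lower_set_height_5:
  assumes leq: "expo_order leq" and L: "lower_set leq L" "card L = 39" and z4: "(0, 0, 4) \<in> L"
  shows "L = simplex4 \<union> {(5,0,0), (4,1,0), (3,2,0), (4,0,1)} \<or> L = simplex4 \<union> {(5,0,0), (4,1,0), (3,2,0), (2,3,0)}"
proof -
  have st: "borel_fixed L" by (rule lower_set_borel_fixed[OF leq L(1)])
  have fin: "finite L" using L by (simp add: lower_set_def)
  note dom = borel_fixed_dominated[OF st]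
  have sub: "simplex4 \<subseteq> L" using dom[OF z4] by (auto simp: simplex4_def)
  define E where "E = L - simplex4"
  have E: "card E = 4" using card_Diff_subset[OF finite_simplex4 sub] L(2) card_simplex4 by (simp add: E_def)
  have finE: "finite E" using fin by (simp add: E_def)
  have deg: "a + b + c \<ge> 5" if "(a, b, c) \<in> E" for a b c using that by (auto simp: E_def simplex4_def)
  have EL: "u \<in> L" if "u \<in> E" for u using that by (simp add: E_def)
  have small: "\<not> E \<subseteq> F" if "card F < 4" "finite F" for F
    using card_mono[OF that(2), of E] that(1) E by linarith
  have ge: "leq u v" if "u \<in> L" "v \<notin> L" for u v
    using lower_setD[OF L(1), of v u] expo_order_total[OF leq, of u v] that by blast
  have yz: "leq (0, n, 0) (0, 0, n)" for n
  proof (induction n)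
    case 0
    then show ?case by (rule expo_order_least[OF leq])
  next
    case (Suc n)
    have "leq (0, Suc n, 0) (0, 1, n)" using expo_order_add[OF leq Suc, of 0 1 0] by simp
    moreover have "leq (0, 1, n) (0, 0, Suc n)" using expo_order_add[OF leq expo_order_yz[OF leq], of 0 0 n] by simp
    ultimately show ?case by (rule expo_order_trans[OF leq])
  qed
  have x5: "(5,0,0) \<in> L"
  proof (rule ccontr)
    assume *: "(5,0,0) \<notin> L"
    have "E \<subseteq> {}"
    proof
      fix u assume u: "u \<in> E"
      obtain a b c where "u = (a, b, c)" by (cases u)
      then show "u \<in> {}" using dom[OF EL, of a b c 0 0 5] deg[of a b c] u * by simp
    qed
    then show False using small[of "{}"] by simp
  qed
  have x6: "(6,0,0) \<notin> L"
  proof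
    assume x6: "(6,0,0) \<in> L"
    \<comment> \<open>If x^3 y^2 were missing, it would lie above x^6 and above z^4. The former
      gives x^3 \<le> y^2; the latter gives y^4 \<le> z^4 \<le> x^3 y^2 and thus y^2 \<le>
      x^3.\<close>
    have x3y2: "(3,2,0) \<in> L"
    proof (rule ccontr)
      assume *: "(3,2,0) \<notin> L"
      have "leq (3, 0, 0) (0, 2, 0)"
        using expo_order_cancel[OF leq, of 3 3 0 0 0 0 0 2 0] ge[OF x6 *] by simp
      moreover have "leq (0, 2, 0) (3, 0, 0)"
        using expo_order_cancel[OF leq, of 0 0 2 2 0 0 3 0 0] expo_order_trans[OF leq yz[of 4] ge[OF z4 *]]
        by (simp add: numeral_eq_Suc)
      ultimately show False using expo_order_antisym[OF leq, of "(3, 0, 0)" "(0, 2, 0)"] by simp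
    qed
    then have x4y: "(4,1,0) \<in> L" by (rule dom) auto
    have sub': "{(5,0,0), (6,0,0), (3,2,0), (4,1,0)} \<subseteq> E"
      using x5 x6 x3y2 x4y by (auto simp: E_def simplex4_def)
    have eq: "{(5,0,0), (6,0,0), (3,2,0), (4,1,0)} = E"
      by (rule card_subset_eq[OF finE sub']) (simp add: E)
    \<comment> \<open>With all four places taken, x^2 y^3 and x^4 z are missing. Then x^6 \<le> x^2
      y^3 gives x^4 \<le> y^3 \<le> z^3, while z^4 \<le> x^4 z gives z^3 \<le> x^4.\<close>
    have "(2,3,0) \<notin> E" "(4,0,1) \<notin> E" unfolding eq[symmetric] by simp_all
    then have *: "(2,3,0) \<notin> L" "(4,0,1) \<notin> L" by (simp_all add: E_def simplex4_def)
    have "leq (4, 0, 0) (0, 3, 0)"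
      using expo_order_cancel[OF leq, of 4 2 0 0 0 0 0 3 0] ge[OF x6 *(1)] by (simp add: numeral_eq_Suc)
    then have "leq (4, 0, 0) (0, 0, 3)" using yz by (rule expo_order_trans[OF leq])
    moreover have "leq (0, 0, 3) (4, 0, 0)"
      using expo_order_cancel[OF leq, of 0 0 0 0 3 1 4 0 0] ge[OF z4 *(2)] by (simp add: numeral_eq_Suc)
    ultimately show False using expo_order_antisym[OF leq, of "(4, 0, 0)" "(0, 0, 3)"] by simp
  qed
  have deg5: "a + b + c = 5" if "(a, b, c) \<in> E" for a b c
    using dom[OF EL[OF that], of 0 0 6] x6 deg[OF that] by (cases "6 \<le> a + b + c") auto
  have x4y: "(4,1,0) \<in> L"
  proof (rule ccontr)
    assume *: "(4,1,0) \<notin> L"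
    have "E \<subseteq> {(5,0,0)}"
    proof
      fix u assume u: "u \<in> E"
      obtain a b c where abc: "u = (a, b, c)" by (cases u)
      then have "\<not> 1 \<le> b + c" using dom[OF EL, of a b c 0 1 4] deg[of a b c] u * by auto
      then show "u \<in> {(5,0,0)}" using deg5[of a b c] u abc by auto
    qed
    then show False using small[of "{(5,0,0)}"] by simp
  qed
  have x3y2: "(3,2,0) \<in> L"
  proof (rule ccontr)
    assume *: "(3,2,0) \<notin> L"
    have "E \<subseteq> {(5,0,0),(4,1,0),(4,0,1)}"
    proof
      fix u assume u: "u \<in> E"
      obtain a b c where abc: "u = (a, b, c)" by (cases u)
      then have "\<not> 2 \<le> b + c" using dom[OF EL, of a b c 0 2 3] deg[of a b c] u * by auto
      then have "(b = 0 \<and> c = 0) \<or> (b = 1 \<and> c = 0) \<or> (b = 0 \<and> c = 1)" by arith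
      then show "u \<in> {(5,0,0),(4,1,0),(4,0,1)}" using deg5[of a b c] u abc by auto
    qed
    then show False using small[of "{(5,0,0),(4,1,0),(4,0,1)}"] by simp
  qed
  define F :: "expo set" where "F = {(5,0,0),(4,1,0),(3,2,0)}"
  have FE: "F \<subseteq> E" using x5 x4y x3y2 by (auto simp: E_def F_def simplex4_def)
  have "card (E - F) = 1" using card_Diff_subset[OF _ FE] E by (simp add: F_def)
  then obtain w where w: "E - F = {w}" by (auto simp: card_1_singleton_iff)
  obtain a b c where abc: "w = (a, b, c)" by (cases w)
  have wE: "(a, b, c) \<in> E" "(a, b, c) \<notin> F" using w abc by auto
  have "w = (4,0,1) \<or> w = (2,3,0)"
  proof (cases "c = 0")
    case False
    then have "(4,0,1) \<in> L" using dom[OF EL[OF wE(1)], of 1 0 4] deg[OF wE(1)] by auto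
    then have "(4,0,1) \<in> E - F" by (auto simp: E_def F_def simplex4_def)
    then show ?thesis using w by auto
  next
    case True
    then have "b \<ge> 3" using wE(2) deg5[OF wE(1)] by (auto simp: F_def)
    then have "(2,3,0) \<in> L" using dom[OF EL[OF wE(1)], of 0 3 2] deg[OF wE(1)] by auto
    then have "(2,3,0) \<in> E - F" by (auto simp: E_def F_def simplex4_def)
    then show ?thesis using w by auto
  qed
  moreover have "L = simplex4 \<union> (F \<union> {w})" using sub w FE by (auto simp: E_def)
  ultimately show ?thesis by (auto simp: F_def)
qed

section \<open>The two staircases of 39 monomials containing z^4\<close>

definition sporadic_1 :: "expo set" where
  "sporadic_1 = simplex4 \<union> {(5,0,0), (4,1,0), (3,2,0), (4,0,1)}"

definition sporadic_2 :: "expo set" where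
  "sporadic_2 = simplex4 \<union> {(5,0,0), (4,1,0), (3,2,0), (2,3,0)}"

text \<open>The test tries only finitely many pairs \<open>(p, q)\<close> and therefore bounds \<open>slice_homs\<close> from above.\<close>

definition slice_homs_test :: "(expo \<Rightarrow> bool) \<Rightarrow> nat \<Rightarrow> expo \<Rightarrow> bool" where
  "slice_homs_test P k = (\<lambda>(a, b, c). P (a, b, c) \<and>
     list_all (\<lambda>(p, q). P (p, q, k) \<or> \<not> P (a + p, b + q, c)) (List.product [0..<7] [0..<6]))"

lemma card_slice_homs_le:
  assumes L: "staircase L" and P: "\<And>u. u \<in> L \<longleftrightarrow> P u" and z5: "(0, 0, 5) \<notin> L"
    and sub: "L \<subseteq> set triples"
  shows "card (slice_homs L) \<le> sum_list (map (\<lambda>k. length (filter (slice_homs_test P k) triples)) [0..<5])"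
proof -
  have "k < 5" if "(k, b) \<in> slice_homs L" for k b
  proof (rule ccontr)
    assume "\<not> k < 5"
    then have n: "k = 5 + (k - 5)" by simp
    have "(0, 0, 5 + n) \<notin> L" for n
    proof (induction n)
      case (Suc n)
      then show ?case using staircase_up[OF L, of Var_z "(0, 0, 5 + n)"] by auto
    qed (use z5 in simp)
    with slice_homsD[OF L that] n show False by metis
  qed
  moreover have "slice_homs_test P k b" if "(k, b) \<in> slice_homs L" for k b
    using that by (auto simp: slice_homs_def slice_homs_test_def list_all_iff P)
  ultimately have "slice_homs L \<subseteq> (\<Union>k\<in>{..<5}. Pair k ` set (filter (slice_homs_test P k) triples))"
    using slice_homsD[OF L] sub by fastforce
  then have "card (slice_homs L) \<le> card (\<Union>k\<in>{..<5}. Pair k ` set (filter (slice_homs_test P k) triples))"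
    by (intro card_mono) auto
  also have "\<dots> \<le> (\<Sum>k<5. card (Pair k ` set (filter (slice_homs_test P k) triples)))"
    by (rule card_UN_le) simp
  also have "\<dots> \<le> (\<Sum>k<5. length (filter (slice_homs_test P k) triples))"
    by (intro sum_mono order_trans[OF card_image_le card_length]) simp
  also have "\<dots> = sum_list (map (\<lambda>k. length (filter (slice_homs_test P k) triples)) [0..<5])"
    by (simp add: interv_sum_list_conv_sum_set_nat atLeast0LessThan)
  finally show ?thesis .
qed

lemma staircase_sporadic: "staircase sporadic_1" "staircase sporadic_2"
proof -
  have "u \<in> sporadic_1" if "up e u \<in> sporadic_1" for e u
    using that by (cases e; cases u) (auto simp: sporadic_1_def simplex4_def)
  moreover have "u \<in> sporadic_2" if "up e u \<in> sporadic_2" for e u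
    using that by (cases e; cases u) (auto simp: sporadic_2_def simplex4_def)
  ultimately show "staircase sporadic_1" "staircase sporadic_2"
    using finite_simplex4 by (simp_all add: staircase_def sporadic_1_def sporadic_2_def del: split_paired_All)
qed

definition in_sporadic_1 :: "expo \<Rightarrow> bool" where
  "in_sporadic_1 = (\<lambda>(a, b, c). a + b + c \<le> 4 \<or> (a, b, c) = (5,0,0) \<or> (a, b, c) = (4,1,0) \<or> (a, b, c) = (3,2,0) \<or> (a, b, c) = (4,0,1))"

definition in_sporadic_2 :: "expo \<Rightarrow> bool" where
  "in_sporadic_2 = (\<lambda>(a, b, c). a + b + c \<le> 4 \<or> (a, b, c) = (5,0,0) \<or> (a, b, c) = (4,1,0) \<or> (a, b, c) = (3,2,0) \<or> (a, b, c) = (2,3,0))"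

lemma slice_homs_sporadic_1: "card (slice_homs sporadic_1) \<le> 146"
proof -
  have "card (slice_homs sporadic_1) \<le> sum_list (map (\<lambda>k. length (filter (slice_homs_test in_sporadic_1 k) triples)) [0..<5])"
    by (rule card_slice_homs_le[OF staircase_sporadic(1)])
       (auto simp: sporadic_1_def simplex4_def in_sporadic_1_def set_triples)
  also have "\<dots> \<le> 146" by code_simp
  finally show ?thesis .
qed

lemma slice_homs_sporadic_2: "card (slice_homs sporadic_2) \<le> 147"
proof -
  have "card (slice_homs sporadic_2) \<le> sum_list (map (\<lambda>k. length (filter (slice_homs_test in_sporadic_2 k) triples)) [0..<5])"
    by (rule card_slice_homs_le[OF staircase_sporadic(2)])
       (auto simp: sporadic_2_def simplex4_def in_sporadic_2_def set_triples)
  also have "\<dots> \<le> 147" by code_simp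
  finally show ?thesis .
qed

lemma tangents_sporadic_2:
  assumes dual: "dual_family Q (tangents sporadic_2 :: (_ \<Rightarrow> 'k::field) set) c" "finite Q"
  shows "card Q < card sporadic_2 + 2 * card (slice_homs sporadic_2)"
proof (rule tangents_rank_bound_strict[OF staircase_sporadic(2) dual])
  let ?h = "\<lambda>v :: bool \<times> expo \<times> expo \<Rightarrow> 'k. v (True, (1,0,2), (0,3,0)) + v (True, (2,0,2), (1,3,0))"
  \<comment> \<open>The map x z^2 -> y^3, x y z^2 -> y^4 commutes with y, since x y^2 z^2 and y^5
    are both outside the staircase. Together with B = 0 it is a commuting pair, and it violates the
    relation \<open>?h\<close>.\<close>
  let ?A = "{(True, (1,0,2), (0,3,0)), (True, (1,1,2), (0,4,0))} :: (bool \<times> expo \<times> expo) set"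
  let ?v = "\<lambda>x. of_bool (x \<in> ?A) :: 'k"
  note [simp] = sporadic_2_def simplex4_def
  txt \<open>On defects, \<open>?h\<close> telescopes to the coefficient of \<open>xy\<^sup>3\<close> in \<open>\<phi>(x\<^sup>3z\<^sup>2)\<close>, which is that of
    \<open>x\<^sup>2y\<^sup>3\<close> in \<open>\<phi>(x\<^sup>4z\<^sup>2) = z \<phi>(x\<^sup>4z)\<close>, hence zero.\<close>
  show "linear_functional ?h" by (simp add: linear_functional_def algebra_simps)
  show "?v \<in> commuting_pairs sporadic_2"
    unfolding commuting_pairs_def
  proof (intro CollectI conjI allI impI ballI)
    show "?v (s, u, b) = 0" if "u \<notin> sporadic_2 \<or> b \<notin> sporadic_2" for s u b
      using that by auto
    fix i assume i: "i \<in> sporadic_2 \<times> sporadic_2"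
    obtain m1 m2 m3 b1 b2 b3 where "i = ((m1, m2, m3), (b1, b2, b3))" by (metis surj_pair)
    with i show "defect sporadic_2 Var_y (\<lambda>i. ?v (True, i)) i = defect sporadic_2 Var_x (\<lambda>i. ?v (False, i)) i"
      by (cases b2) (auto simp: defect_def shift_def)
  qed
  show "?h ?v \<noteq> 0" by simp
  fix \<phi> :: "expo \<times> expo \<Rightarrow> 'k" assume \<phi>: "\<phi> \<in> lifted_tangents sporadic_2"
  have "defect sporadic_2 Var_x \<phi> ((3,0,2), (2,3,0)) = 0" "defect sporadic_2 Var_z \<phi> ((4,0,1), (2,3,0)) = 0"
    by (rule lifted_tangents_defect[OF \<phi>], simp)+
  then show "?h (defect_pair sporadic_2 \<phi>) = 0" by (simp add: defect_pair_def defect_def shift_def numeral_eq_Suc)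
qed

theorem tangents_lower_set_le:
  assumes leq: "expo_order leq" and L: "lower_set leq L" "card L = 39"
    and dual: "dual_family Q (tangents L :: (_ \<Rightarrow> 'k::field) set) c" "finite Q"
  shows "card Q \<le> 332"
proof -
  have st: "borel_fixed L" by (rule lower_set_borel_fixed[OF leq L(1)])
  note bound = tangents_rank_bound[OF borel_fixed_staircase[OF st] dual]
  \<comment> \<open>The four cases give the bounds 273, 327, 331 and 332.\<close>
  consider "(0, 0, 3) \<notin> L" | "(0, 0, 4) \<notin> L" | "L = sporadic_1" | "L = sporadic_2"
    using lower_set_height_5[OF leq L] unfolding sporadic_1_def sporadic_2_def by blast
  then show ?thesis
  proof cases
    case 1
    then show ?thesis using slice_homs_card_height_3[OF borel_fixed_staircase[OF st]] bound L(2) by simp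
  next
    case 2
    then show ?thesis using slice_homs_card_height_4[OF st L(2)] bound L(2) by simp
  next
    case 3
    then show ?thesis using slice_homs_sporadic_1 bound L(2) by simp
  next
    case 4
    then show ?thesis using slice_homs_sporadic_2 tangents_sporadic_2[of Q c] dual L(2) by simp
  qed
qed

section \<open>Coordinates on vector spaces\<close>

text \<open>An injective linear map into a function space. It moves dimension questions about a
  module record to the image, where the results on \<open>fun_subspace\<close> apply.\<close>

definition coordinates :: "('k::field, 'v) module \<Rightarrow> ('v \<Rightarrow> 'i \<Rightarrow> 'k) \<Rightarrow> bool" where
  "coordinates V f \<longleftrightarrow>
     (\<forall>u\<in>carrier V. \<forall>v\<in>carrier V. f (u \<oplus>\<^bsub>V\<^esub> v) = (\<lambda>i. f u i + f v i)) \<and>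
     (\<forall>c. \<forall>v\<in>carrier V. f (c \<odot>\<^bsub>V\<^esub> v) = (\<lambda>i. c * f v i)) \<and>
     (\<forall>v\<in>carrier V. f v = (\<lambda>_. 0) \<longrightarrow> v = \<zero>\<^bsub>V\<^esub>)"

lemma coordinates_add: "coordinates V f \<Longrightarrow> u \<in> carrier V \<Longrightarrow> v \<in> carrier V \<Longrightarrow> f (u \<oplus>\<^bsub>V\<^esub> v) = (\<lambda>i. f u i + f v i)"
  by (simp add: coordinates_def)

lemma coordinates_smult: "coordinates V f \<Longrightarrow> v \<in> carrier V \<Longrightarrow> f (c \<odot>\<^bsub>V\<^esub> v) = (\<lambda>i. c * f v i)"
  by (simp add: coordinates_def)

lemma coordinates_eq_0: "coordinates V f \<Longrightarrow> v \<in> carrier V \<Longrightarrow> f v = (\<lambda>_. 0) \<Longrightarrow> v = \<zero>\<^bsub>V\<^esub>"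
  by (simp add: coordinates_def)

lemma coordinates_zero:
  assumes "vectorspace (class_ring :: 'k::field ring) V" "coordinates V f"
  shows "f \<zero>\<^bsub>V\<^esub> = (\<lambda>_. 0)"
proof -
  interpret vectorspace "class_ring :: 'k ring" V by fact
  have "f \<zero>\<^bsub>V\<^esub> = (\<lambda>i. f \<zero>\<^bsub>V\<^esub> i + f \<zero>\<^bsub>V\<^esub> i)"
    using coordinates_add[OF assms(2), of "\<zero>\<^bsub>V\<^esub>" "\<zero>\<^bsub>V\<^esub>"] by simp
  then have "f \<zero>\<^bsub>V\<^esub> i = f \<zero>\<^bsub>V\<^esub> i + f \<zero>\<^bsub>V\<^esub> i" for i by (rule fun_cong)
  then show ?thesis by (intro ext) (metis add_cancel_right_right)
qed

lemma coordinates_inject: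
  assumes V: "vectorspace (class_ring :: 'k::field ring) V" and f: "coordinates V f"
    and uv: "u \<in> carrier V" "v \<in> carrier V" "f u = f v"
  shows "u = v"
proof -
  interpret vectorspace "class_ring :: 'k ring" V by fact
  have *: "(- 1) \<odot>\<^bsub>V\<^esub> v = \<ominus>\<^bsub>V\<^esub> v" using smult_minus_1[of v] uv by (simp add: class_ring_simps)
  have "f (u \<oplus>\<^bsub>V\<^esub> (- 1) \<odot>\<^bsub>V\<^esub> v) = (\<lambda>_. 0)"
    using uv coordinates_add[OF f, of u "(- 1) \<odot>\<^bsub>V\<^esub> v"] coordinates_smult[OF f, of v "- 1"] by simp
  then have "u \<oplus>\<^bsub>V\<^esub> \<ominus>\<^bsub>V\<^esub> v = \<zero>\<^bsub>V\<^esub>" using coordinates_eq_0[OF f, of "u \<oplus>\<^bsub>V\<^esub> (- 1) \<odot>\<^bsub>V\<^esub> v"] uv * by simp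
  then show ?thesis using minus_equality[of u "\<ominus>\<^bsub>V\<^esub> v"] uv by simp
qed

lemma coordinates_image_subspace:
  assumes V: "vectorspace (class_ring :: 'k::field ring) V" and f: "coordinates V f"
  shows "fun_subspace (f ` carrier V)"
proof -
  interpret vectorspace "class_ring :: 'k ring" V by fact
  show ?thesis
    unfolding fun_subspace_def
  proof (intro conjI ballI allI)
    show "(\<lambda>_. 0) \<in> f ` carrier V" using coordinates_zero[OF V f] by (intro image_eqI[of _ _ "\<zero>\<^bsub>V\<^esub>"]) auto
    fix g assume "g \<in> f ` carrier V"
    then obtain u where u: "u \<in> carrier V" "g = f u" by blast
    show "(\<lambda>i. a * g i) \<in> f ` carrier V" for a
      using coordinates_smult[OF f u(1), of a] u by (intro image_eqI[of _ _ "a \<odot>\<^bsub>V\<^esub> u"]) auto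
    fix h assume "h \<in> f ` carrier V"
    then obtain v where v: "v \<in> carrier V" "h = f v" by blast
    show "(\<lambda>i. g i + h i) \<in> f ` carrier V"
      using coordinates_add[OF f u(1) v(1)] u v by (intro image_eqI[of _ _ "u \<oplus>\<^bsub>V\<^esub> v"]) auto
  qed
qed

text \<open>Preimages \<open>b q\<close> of the dual vectors form a basis: the coordinate at
  \<open>q\<close> reads off the coefficient of \<open>b q\<close> in a linear combination, and
  \<open>determines\<close> shows that nothing else is left.\<close>

theorem dim_eq_card_dual_family:
  assumes V: "vectorspace (class_ring :: 'k::field ring) V" and f: "coordinates V f"
    and Q: "finite Q" "determines Q (f ` carrier V)" and dual: "dual_family Q (f ` carrier V) w"
  shows "vectorspace.fin_dim class_ring V \<and> vectorspace.dim class_ring V = card Q"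
proof -
  interpret vectorspace "class_ring :: 'k ring" V by fact
  have "\<exists>v\<in>carrier V. f v = w q" if "q \<in> Q" for q
  proof -
    have "w q \<in> f ` carrier V" using dual that by (simp add: dual_family_def)
    then show ?thesis by auto
  qed
  then obtain b where b: "\<And>q. q \<in> Q \<Longrightarrow> b q \<in> carrier V" "\<And>q. q \<in> Q \<Longrightarrow> f (b q) = w q" by metis
  have delta: "f (b q) r = of_bool (r = q)" if "q \<in> Q" "r \<in> Q" for q r
    using dual b(2) that by (simp add: dual_family_def)
  have inj: "inj_on b Q"
  proof (rule inj_onI)
    fix q r assume qr: "q \<in> Q" "r \<in> Q" "b q = b r"
    then show "q = r" using delta[of q q] delta[of r q] by (cases "q = r") auto
  qed
  have lin: "f (lincomb a (b ` P)) = (\<lambda>i. \<Sum>q\<in>P. a (b q) * f (b q) i) \<and> lincomb a (b ` P) \<in> carrier V" if "P \<subseteq> Q" for a P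
  proof -
    have "finite P" using that Q(1) finite_subset by blast
    then show ?thesis using that
    proof (induction P rule: finite_induct)
      case empty
      then show ?case using coordinates_zero[OF V f] by (simp add: lincomb_def)
    next
      case (insert q P)
      have carr: "(\<lambda>v. a v \<odot>\<^bsub>V\<^esub> v) \<in> b ` P \<rightarrow> carrier V" using insert.prems b(1) by auto
      have notin: "b q \<notin> b ` P" using insert inj by (auto simp: inj_on_def)
      have "lincomb a (b ` insert q P) = a (b q) \<odot>\<^bsub>V\<^esub> b q \<oplus>\<^bsub>V\<^esub> lincomb a (b ` P)"
        unfolding lincomb_def using insert.hyps insert.prems b(1) carr notin by (simp add: finsum_insert)
      moreover have "a (b q) \<odot>\<^bsub>V\<^esub> b q \<in> carrier V" using insert.prems b(1) by simp
      ultimately show ?case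
        using insert coordinates_add[OF f] coordinates_smult[OF f] b(1) by simp
    qed
  qed
  have co: "f (lincomb a (b ` Q)) q = a (b q)" if "q \<in> Q" for a q
  proof -
    have "f (lincomb a (b ` Q)) q = (\<Sum>r\<in>Q. if q = r then a (b r) else 0)"
      using lin[OF order_refl, of a] delta that by (auto intro: sum.cong)
    then show ?thesis using that Q(1) by simp
  qed
  have "basis (b ` Q)"
  proof (subst basis_criterion)
    show "finite (b ` Q)" "b ` Q \<subseteq> carrier V" using Q(1) b(1) by auto
    show "\<forall>v. v \<in> carrier V \<longrightarrow> (\<exists>!a. a \<in> b ` Q \<rightarrow>\<^sub>E carrier class_ring \<and> lincomb a (b ` Q) = v)"
    proof (intro allI impI)
      fix v assume v: "v \<in> carrier V"
      define a where "a = (\<lambda>x\<in>b ` Q. f v (the_inv_into Q b x))"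
      have a: "a (b q) = f v q" if "q \<in> Q" for q using that inj by (simp add: a_def the_inv_into_f_f)
      have carr: "lincomb a (b ` Q) \<in> carrier V" using lin[OF order_refl] by blast
      have "f (lincomb a (b ` Q)) = f v"
      proof -
        have "(\<lambda>i. f (lincomb a (b ` Q)) i + - 1 * f v i) \<in> f ` carrier V"
          by (intro fun_subspace_add fun_subspace_scale coordinates_image_subspace[OF V f] imageI carr v)
        then have "(\<lambda>i. f (lincomb a (b ` Q)) i + - 1 * f v i) = (\<lambda>_. 0)"
          by (rule determinesD[OF Q(2)]) (simp add: co a)
        then show ?thesis by (simp add: fun_eq_iff)
      qed
      then have "lincomb a (b ` Q) = v" by (rule coordinates_inject[OF V f carr v])
      moreover have "a \<in> b ` Q \<rightarrow>\<^sub>E carrier class_ring" by (simp add: a_def)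
      moreover have "a' = a" if a': "a' \<in> b ` Q \<rightarrow>\<^sub>E carrier class_ring" "lincomb a' (b ` Q) = v" for a'
      proof (rule PiE_ext[OF a'(1) \<open>a \<in> _\<close>])
        fix x assume "x \<in> b ` Q"
        then obtain q where q: "q \<in> Q" "x = b q" by blast
        then show "a' x = a x" using co[of q a'] a' a by simp
      qed
      ultimately show "\<exists>!a. a \<in> b ` Q \<rightarrow>\<^sub>E carrier class_ring \<and> lincomb a (b ` Q) = v" by blast
    qed
  qed
  moreover have "card (b ` Q) = card Q" by (rule card_image[OF inj])
  ultimately show ?thesis
    using dim_basis[of "b ` Q"] Q(1) unfolding fin_dim_def basis_def by auto
qed

corollary dim_le_card:
  assumes V: "vectorspace (class_ring :: 'k::field ring) V" and f: "coordinates V f"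
    and Q: "finite Q" "\<And>v. v \<in> carrier V \<Longrightarrow> (\<And>q. q \<in> Q \<Longrightarrow> f v q = 0) \<Longrightarrow> f v = (\<lambda>_. 0)"
  shows "vectorspace.dim class_ring V \<le> card Q"
proof -
  have "determines Q (f ` carrier V)" using Q(2) by (auto simp: determines_def)
  then obtain P w where P: "P \<subseteq> Q" "determines P (f ` carrier V)" "dual_family P (f ` carrier V) w"
    using dual_family_exists[OF coordinates_image_subspace[OF V f] Q(1)] by blast
  then show ?thesis
    using dim_eq_card_dual_family[OF V f _ P(2,3)] finite_subset[OF P(1) Q(1)] card_mono[OF Q(1) P(1)] by simp
qed

lemma basis_coordinates:
  assumes V: "vectorspace (class_ring :: 'k::field ring) V" and fd: "vectorspace.fin_dim class_ring V"
  shows "\<exists>B f. finite B \<and> card B = vectorspace.dim class_ring V \<and> B \<subseteq> carrier V \<and> coordinates V f \<and>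
    (\<forall>v i. v \<in> carrier V \<longrightarrow> i \<notin> B \<longrightarrow> f v i = 0) \<and> (\<forall>b\<in>B. \<forall>i\<in>B. f b i = of_bool (i = b))"
proof -
  interpret vectorspace "class_ring :: 'k ring" V by fact
  obtain B where B: "finite B" "basis B" using finite_basis_exists[OF fd] by blast
  have BV: "B \<subseteq> carrier V" using B(2) by (simp add: basis_def)
  define f where "f = (\<lambda>v i. if i \<in> B then (THE a. a \<in> B \<rightarrow>\<^sub>E carrier class_ring \<and> lincomb a B = v) i else 0)"
  have ex1: "\<exists>!a. a \<in> B \<rightarrow>\<^sub>E carrier class_ring \<and> lincomb a B = v" if "v \<in> carrier V" for v
    using basis_criterion[OF B(1) BV] B(2) that by blast
  have cong: "lincomb a B = lincomb a' B" if "\<And>b. b \<in> B \<Longrightarrow> a b = a' b" for a a'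
    unfolding lincomb_def using that BV by (intro finsum_cong') auto
  have f: "lincomb (f v) B = v" if "v \<in> carrier V" for v
    using theI'[OF ex1[OF that]] cong[of "f v"] by (simp add: f_def)
  have unique: "f v i = a i" if "lincomb a B = v" "i \<in> B" "v \<in> carrier V" for a v i
  proof -
    have "restrict a B \<in> B \<rightarrow>\<^sub>E carrier class_ring" "lincomb (restrict a B) B = v"
      using cong[of "restrict a B" a] that by auto
    with ex1[OF that(3)] have "(THE a. a \<in> B \<rightarrow>\<^sub>E carrier class_ring \<and> lincomb a B = v) = restrict a B"
      by (intro the1_equality) auto
    then show ?thesis using that by (simp add: f_def)
  qed
  have out: "f v i = 0" if "i \<notin> B" for v i using that by (simp add: f_def)
  have smult_closed': "(\<lambda>v. a v \<odot>\<^bsub>V\<^esub> v) \<in> B \<rightarrow> carrier V" for a using BV by auto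
  have "coordinates V f"
    unfolding coordinates_def
  proof (intro conjI ballI allI impI)
    fix u v assume uv: "u \<in> carrier V" "v \<in> carrier V"
    have "lincomb (\<lambda>i. f u i + f v i) B = (\<Oplus>\<^bsub>V\<^esub>w\<in>B. f u w \<odot>\<^bsub>V\<^esub> w \<oplus>\<^bsub>V\<^esub> f v w \<odot>\<^bsub>V\<^esub> w)"
      unfolding lincomb_def using BV smult_l_distr by (intro finsum_cong') (auto simp: subset_iff)
    also have "\<dots> = lincomb (f u) B \<oplus>\<^bsub>V\<^esub> lincomb (f v) B"
      unfolding lincomb_def by (rule finsum_addf[OF smult_closed' smult_closed'])
    finally have eq: "lincomb (\<lambda>i. f u i + f v i) B = u \<oplus>\<^bsub>V\<^esub> v" using f uv by simp
    show "f (u \<oplus>\<^bsub>V\<^esub> v) = (\<lambda>i. f u i + f v i)"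
    proof
      fix i show "f (u \<oplus>\<^bsub>V\<^esub> v) i = f u i + f v i"
        using unique[OF eq, of i] out uv by (cases "i \<in> B") auto
    qed
  next
    fix c v assume v: "v \<in> carrier V"
    have "lincomb (\<lambda>i. c * f v i) B = (\<Oplus>\<^bsub>V\<^esub>w\<in>B. c \<odot>\<^bsub>V\<^esub> (f v w \<odot>\<^bsub>V\<^esub> w))"
      unfolding lincomb_def using BV smult_assoc1 by (intro finsum_cong') (auto simp: subset_iff)
    also have "\<dots> = c \<odot>\<^bsub>V\<^esub> lincomb (f v) B"
      unfolding lincomb_def by (rule finsum_smult[symmetric, OF _ smult_closed']) simp
    finally have eq: "lincomb (\<lambda>i. c * f v i) B = c \<odot>\<^bsub>V\<^esub> v" using f v by simp
    show "f (c \<odot>\<^bsub>V\<^esub> v) = (\<lambda>i. c * f v i)"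
    proof
      fix i show "f (c \<odot>\<^bsub>V\<^esub> v) i = c * f v i"
        using unique[OF eq, of i] out v by (cases "i \<in> B") auto
    qed
  next
    fix v assume v: "v \<in> carrier V" "f v = (\<lambda>_. 0)"
    then have "v = lincomb (\<lambda>_. 0) B" using f[OF v(1)] by simp
    also have "\<dots> = (\<Oplus>\<^bsub>V\<^esub>w\<in>B. \<zero>\<^bsub>V\<^esub>)"
      unfolding lincomb_def using BV smult_l_null by (intro finsum_cong') (auto simp: subset_iff)
    finally show "v = \<zero>\<^bsub>V\<^esub>" by simp
  qed
  moreover have "f b i = of_bool (i = b)" if "b \<in> B" "i \<in> B" for b i
  proof (rule unique[OF _ that(2)])
    have "lincomb (\<lambda>i. of_bool (i = b)) B = (\<Oplus>\<^bsub>V\<^esub>w\<in>B. if b = w then w else \<zero>\<^bsub>V\<^esub>)"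
      unfolding lincomb_def using BV smult_l_null smult_one by (intro finsum_cong') (auto simp: subset_iff)
    also have "\<dots> = b" using that BV B(1) by (subst finsum_singleton) auto
    finally show "lincomb (\<lambda>i. of_bool (i = b)) B = b" .
    show "b \<in> carrier V" using that BV by auto
  qed
  ultimately show ?thesis
    using B(1) BV out dim_basis[OF B] by (intro exI[of _ B] exI[of _ f]) simp
qed

section \<open>Tangent vectors in coordinates\<close>

abbreviation coset :: "'k::field poly3 set \<Rightarrow> 'k poly3 \<Rightarrow> 'k poly3 set" where
  "coset I p \<equiv> I +>\<^bsub>poly3_ring\<^esub> p"

abbreviation quotient_space :: "'k::field poly3 set \<Rightarrow> ('k, 'k poly3 set) module" where
  "quotient_space I \<equiv> restrict_scalars const_poly (quotient_module poly3_ring I)"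

lemma const_poly_mult_monom: "const_poly c * Poly_Mapping.single m d = Poly_Mapping.single m (c * d)"
  by (simp add: const_poly_def mult_single)

lemma lookup_const_poly_mult: "Poly_Mapping.lookup (const_poly c * p) m = c * Poly_Mapping.lookup p m"
  by (simp add: const_poly_def mult_map_scale_conv_mult[symmetric] Poly_Mapping.map.rep_eq when_def)

lemma poly_eq_sum: "p = (\<Sum>m\<in>Poly_Mapping.keys p. Poly_Mapping.single m (Poly_Mapping.lookup p m))"
proof (rule poly_mapping_eqI)
  fix k
  have "(\<Sum>m\<in>Poly_Mapping.keys p. Poly_Mapping.lookup (Poly_Mapping.single m (Poly_Mapping.lookup p m)) k) =
      (\<Sum>m\<in>Poly_Mapping.keys p. if m = k then Poly_Mapping.lookup p m else 0)"
    by (intro sum.cong) (auto simp: lookup_single when_def)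
  then show "Poly_Mapping.lookup p k =
      Poly_Mapping.lookup (\<Sum>m\<in>Poly_Mapping.keys p. Poly_Mapping.single m (Poly_Mapping.lookup p m)) k"
    by (simp add: lookup_sum in_keys_iff)
qed

lemma monom_mult_eq_sum:
  "Poly_Mapping.single u 1 * p = (\<Sum>m\<in>Poly_Mapping.keys p. Poly_Mapping.single (u + m) (Poly_Mapping.lookup p m :: 'a::comm_ring_1))"
  by (subst poly_eq_sum[of p]) (simp add: sum_distrib_left mult_single)

lemma lookup_monom_mult:
  fixes p :: "'a::cancel_comm_monoid_add \<Rightarrow>\<^sub>0 'b::comm_ring_1"
  shows "Poly_Mapping.lookup (Poly_Mapping.single u 1 * p) (u + m) = Poly_Mapping.lookup p m"
    and "(\<And>m. n \<noteq> u + m) \<Longrightarrow> Poly_Mapping.lookup (Poly_Mapping.single u 1 * p) n = 0"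
proof -
  have "(\<Sum>k\<in>Poly_Mapping.keys p. Poly_Mapping.lookup (Poly_Mapping.single (u + k) (Poly_Mapping.lookup p k)) (u + m)) =
      (\<Sum>k\<in>Poly_Mapping.keys p. if k = m then Poly_Mapping.lookup p k else 0)"
    by (intro sum.cong) (auto simp: lookup_single when_def)
  then show "Poly_Mapping.lookup (Poly_Mapping.single u 1 * p) (u + m) = Poly_Mapping.lookup p m"
    unfolding monom_mult_eq_sum by (simp add: lookup_sum in_keys_iff)
  show "Poly_Mapping.lookup (Poly_Mapping.single u 1 * p) n = 0" if "\<And>m. n \<noteq> u + m"
    unfolding monom_mult_eq_sum using that[symmetric] by (simp add: lookup_sum lookup_single when_def)
qed

definition monom_of :: "(var3 \<Rightarrow> var3) \<Rightarrow> expo \<Rightarrow> var3 monom" where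
  "monom_of \<sigma> = (\<lambda>(a, b, c). Poly_Mapping.single (\<sigma> Var_x) a + Poly_Mapping.single (\<sigma> Var_y) b + Poly_Mapping.single (\<sigma> Var_z) c)"

definition expo_of :: "(var3 \<Rightarrow> var3) \<Rightarrow> var3 monom \<Rightarrow> expo" where
  "expo_of \<sigma> m = (Poly_Mapping.lookup m (\<sigma> Var_x), Poly_Mapping.lookup m (\<sigma> Var_y), Poly_Mapping.lookup m (\<sigma> Var_z))"

lemma UNIV_var3: "(UNIV :: var3 set) = {Var_x, Var_y, Var_z}"
  using var3.exhaust by auto

lemma expo_of_monom_of: "bij \<sigma> \<Longrightarrow> expo_of \<sigma> (monom_of \<sigma> u) = u"
  by (cases u) (auto simp: expo_of_def monom_of_def lookup_add lookup_single when_def bij_def inj_eq)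

lemma monom_of_expo_of:
  assumes "bij \<sigma>"
  shows "monom_of \<sigma> (expo_of \<sigma> m) = m"
proof (rule poly_mapping_eqI)
  fix v
  obtain w where "v = \<sigma> w" using assms by (metis bij_pointE)
  then show "Poly_Mapping.lookup (monom_of \<sigma> (expo_of \<sigma> m)) v = Poly_Mapping.lookup m v"
    using assms by (cases w) (auto simp: expo_of_def monom_of_def lookup_add lookup_single when_def bij_def inj_eq)
qed

lemma monom_of_up: "monom_of \<sigma> (up e u) = Poly_Mapping.single (\<sigma> e) 1 + monom_of \<sigma> u"
  by (rule poly_mapping_eqI, cases e; cases u)
     (auto simp: monom_of_def lookup_add lookup_single when_def)

lemma monom_of_0: "monom_of \<sigma> (0, 0, 0) = 0"
  by (simp add: monom_of_def)

lemma expo_induct: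
  assumes "P (0, 0, 0)" "\<And>e u. P u \<Longrightarrow> P (up e u)"
  shows "P u"
proof -
  have 1: "P (a, 0, 0)" for a by (induction a) (use assms(1) assms(2)[of _ Var_x] in auto)
  have 2: "P (a, b, 0)" for a b by (induction b) (use 1 assms(2)[of _ Var_y] in auto)
  have "P (a, b, c)" for a b c by (induction c) (use 2 assms(2)[of _ Var_z] in auto)
  then show ?thesis by (cases u) simp
qed

text \<open>An induction principle for S: a condition that is k-linear has to be checked only at 1
  and under multiplication by a variable.\<close>

lemma poly_span:
  assumes add: "\<And>p q. p \<in> T \<Longrightarrow> q \<in> T \<Longrightarrow> p + q \<in> T" and const: "\<And>c p. p \<in> T \<Longrightarrow> const_poly c * p \<in> T"
    and one: "(1 :: 'k::field poly3) \<in> T"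
    and x: "\<And>v p. p \<in> T \<Longrightarrow> Poly_Mapping.single (Poly_Mapping.single v 1) 1 * p \<in> T"
  shows "p \<in> T"
proof -
  have zero: "0 \<in> T" using const[OF one, of 0] by (simp add: const_poly_def)
  have "Poly_Mapping.single (monom_of id u) 1 \<in> T" for u
  proof (induction u rule: expo_induct)
    case 1
    then show ?case using one by (simp add: monom_of_0)
  next
    case (2 e u)
    then show ?case using x[OF 2, of e] by (simp add: monom_of_up mult_single)
  qed
  then have "Poly_Mapping.single m 1 \<in> T" for m
    using monom_of_expo_of[OF bij_id] by metis
  from const[OF this] have single: "Poly_Mapping.single m c \<in> T" for m c
    by (simp add: const_poly_mult_monom)
  have "(\<Sum>m\<in>A. Poly_Mapping.single m (Poly_Mapping.lookup p m)) \<in> T" if "finite A" for A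
    using that by (induction A rule: finite_induct) (auto intro: zero add single)
  then show ?thesis using poly_eq_sum[of p] by (metis finite_keys)
qed

context
  fixes I :: "'k::field poly3 set"
  assumes I: "ideal I poly3_ring"
begin

lemma ideal_zero: "0 \<in> I" and ideal_add: "p \<in> I \<Longrightarrow> q \<in> I \<Longrightarrow> p + q \<in> I"
proof -
  have "additive_subgroup I poly3_ring" using I by (simp add: ideal_def)
  from additive_subgroup.zero_closed[OF this] additive_subgroup.a_closed[OF this, of p q]
  show "0 \<in> I" "p \<in> I \<Longrightarrow> q \<in> I \<Longrightarrow> p + q \<in> I" by simp_all
qed

lemma ideal_mult: "p \<in> I \<Longrightarrow> r * p \<in> I"
  using ideal.I_l_closed[OF I, of p r] by simp

lemma coset_eq_iff: "coset I p = coset I q \<longleftrightarrow> p - q \<in> I"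
  using ring.quotient_eq_iff_same_a_r_cos[OF cring.axioms(1)[OF class_cring.is_cring] I, of p q]
  by (simp add: class_ring_simps)

lemma coset_in_quotient: "coset I p \<in> carrier (quotient_module poly3_ring I)"
  by (auto simp: quotient_module_def FactRing_def A_RCOSETS_def RCOSETS_def a_r_coset_def)

lemma quotient_cases:
  assumes "X \<in> carrier (quotient_module poly3_ring I)"
  obtains p where "X = coset I p"
  using assms by (auto simp: quotient_module_def FactRing_def A_RCOSETS_def RCOSETS_def a_r_coset_def)

lemma coset_add: "coset I p \<oplus>\<^bsub>quotient_module poly3_ring I\<^esub> coset I q = coset I (p + q)"
  using ring_hom_add[OF ideal.rcos_ring_hom[OF I], of p q] by (simp add: quotient_module_def)

lemma coset_smult: "r \<odot>\<^bsub>quotient_module poly3_ring I\<^esub> coset I p = coset I (r * p)"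
  using ring_hom_mult[OF ideal.rcos_ring_hom[OF I], of r p] by (simp add: quotient_module_def)

lemma quotient_zero: "\<zero>\<^bsub>quotient_module poly3_ring I\<^esub> = coset I 0"
  using ring.a_rcos_zero[OF cring.axioms(1)[OF class_cring.is_cring] I ideal_zero] by (simp add: quotient_module_def FactRing_def)

lemma vectorspace_quotient_space: "vectorspace class_ring (quotient_space I)"
  by (intro vectorspace_restrict_scalars_const_poly module_quotient_module class_cring.is_cring I)

lemma quotient_space_simps:
  "carrier (quotient_space I) = carrier (quotient_module poly3_ring I)"
  "X \<oplus>\<^bsub>quotient_space I\<^esub> Y = X \<oplus>\<^bsub>quotient_module poly3_ring I\<^esub> Y"
  "c \<odot>\<^bsub>quotient_space I\<^esub> X = const_poly c \<odot>\<^bsub>quotient_module poly3_ring I\<^esub> X"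
  "\<zero>\<^bsub>quotient_space I\<^esub> = \<zero>\<^bsub>quotient_module poly3_ring I\<^esub>"
  by (simp_all add: restrict_scalars_def)

lemma tangent_vector_iff:
  "\<phi> \<in> carrier (tangent_space I) \<longleftrightarrow> \<phi> \<in> extensional I \<and> (\<forall>p\<in>I. \<phi> p \<in> carrier (quotient_module poly3_ring I)) \<and>
     (\<forall>p\<in>I. \<forall>q\<in>I. \<phi> (p + q) = \<phi> p \<oplus>\<^bsub>quotient_module poly3_ring I\<^esub> \<phi> q) \<and>
     (\<forall>r. \<forall>p\<in>I. \<phi> (r * p) = r \<odot>\<^bsub>quotient_module poly3_ring I\<^esub> \<phi> p)"
  unfolding tangent_space_def restrict_scalars_def Hom_module_def LinearCombinations.module_hom_def ideal_module_def
  by (auto simp: Pi_iff)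

lemma tangent_space_simps:
  "p \<in> I \<Longrightarrow> (\<phi> \<oplus>\<^bsub>tangent_space I\<^esub> \<psi>) p = \<phi> p \<oplus>\<^bsub>quotient_module poly3_ring I\<^esub> \<psi> p"
  "p \<in> I \<Longrightarrow> (c \<odot>\<^bsub>tangent_space I\<^esub> \<phi>) p = const_poly c \<odot>\<^bsub>quotient_module poly3_ring I\<^esub> \<phi> p"
  "\<zero>\<^bsub>tangent_space I\<^esub> = (\<lambda>p\<in>I. \<zero>\<^bsub>quotient_module poly3_ring I\<^esub>)"
  by (simp_all add: tangent_space_def restrict_scalars_def Hom_module_def ideal_module_def)

definition tangent_coords ::
  "('k poly3 set \<Rightarrow> 'i \<Rightarrow> 'k) \<Rightarrow> ('u \<Rightarrow> 'k poly3) \<Rightarrow> 'u set \<Rightarrow> ('k poly3 \<Rightarrow> 'k poly3 set) \<Rightarrow> 'u \<times> 'i \<Rightarrow> 'k" where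
  "tangent_coords f g U \<phi> = (\<lambda>(u, i). if u \<in> U then f (\<phi> (g u)) i else 0)"

text \<open>The assumption \<open>gen\<close> says that the \<open>g u\<close> generate I as an
  ideal. It is applied to the set of all p in I with \<phi>(p) = 0, so a homomorphism is determined
  by its values on generators.\<close>

lemma coordinates_tangent_space:
  assumes f: "coordinates (quotient_space I) f" and g: "g ` U \<subseteq> I"
    and gen: "\<And>J. J \<subseteq> I \<Longrightarrow> g ` U \<subseteq> J \<Longrightarrow> 0 \<in> J \<Longrightarrow> (\<And>p q. p \<in> J \<Longrightarrow> q \<in> J \<Longrightarrow> p + q \<in> J) \<Longrightarrow>
      (\<And>r p. p \<in> J \<Longrightarrow> r * p \<in> J) \<Longrightarrow> I \<subseteq> J"
  shows "coordinates (tangent_space I) (tangent_coords f g U)"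
  unfolding coordinates_def
proof (intro conjI ballI allI impI)
  fix \<phi> assume \<phi>: "\<phi> \<in> carrier (tangent_space I)"
  then have Q: "\<phi> p \<in> carrier (quotient_space I)" if "p \<in> I" for p
    using that by (simp add: tangent_vector_iff quotient_space_simps)
  have gI: "g u \<in> I" if "u \<in> U" for u using g that by auto
  show "tangent_coords f g U (c \<odot>\<^bsub>tangent_space I\<^esub> \<phi>) = (\<lambda>i. c * tangent_coords f g U \<phi> i)" for c
    using coordinates_smult[OF f Q, of _ c] gI
    by (auto simp: tangent_coords_def fun_eq_iff tangent_space_simps quotient_space_simps)
  show "tangent_coords f g U (\<phi> \<oplus>\<^bsub>tangent_space I\<^esub> \<psi>) = (\<lambda>i. tangent_coords f g U \<phi> i + tangent_coords f g U \<psi> i)"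
    if "\<psi> \<in> carrier (tangent_space I)" for \<psi>
  proof -
    have "\<psi> p \<in> carrier (quotient_space I)" if "p \<in> I" for p
      using that \<open>\<psi> \<in> _\<close> by (simp add: tangent_vector_iff quotient_space_simps)
    then show ?thesis using coordinates_add[OF f Q] gI
      by (auto simp: tangent_coords_def fun_eq_iff tangent_space_simps quotient_space_simps)
  qed
  assume 0: "tangent_coords f g U \<phi> = (\<lambda>_. 0)"
  define J where "J = {p \<in> I. \<phi> p = coset I 0}"
  have "I \<subseteq> J"
  proof (rule gen)
    have "f (\<phi> (g u)) = (\<lambda>_. 0)" if "u \<in> U" for u
    proof
      show "f (\<phi> (g u)) i = 0" for i using fun_cong[OF 0, of "(u, i)"] that by (simp add: tangent_coords_def)
    qed
    then have "\<phi> (g u) = coset I 0" if "u \<in> U" for u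
      using coordinates_eq_0[OF f Q[OF gI[OF that]]] that by (simp add: quotient_space_simps quotient_zero)
    then show "g ` U \<subseteq> J" using gI by (auto simp: J_def)
    have "\<phi> (0 * 0) = 0 \<odot>\<^bsub>quotient_module poly3_ring I\<^esub> \<phi> 0"
      using \<phi> ideal_zero unfolding tangent_vector_iff by blast
    moreover obtain p where "\<phi> 0 = coset I p" using Q[OF ideal_zero] quotient_cases by (auto simp: quotient_space_simps)
    ultimately show "0 \<in> J" using ideal_zero by (simp add: J_def coset_smult)
    show "p + q \<in> J" if "p \<in> J" "q \<in> J" for p q
      using \<phi> that ideal_add by (simp add: J_def tangent_vector_iff coset_add)
    show "r * p \<in> J" if "p \<in> J" for r p
      using \<phi> that ideal_mult by (simp add: J_def tangent_vector_iff coset_smult)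
  qed (auto simp: J_def)
  then show "\<phi> = \<zero>\<^bsub>tangent_space I\<^esub>"
    using \<phi> by (auto simp: J_def tangent_space_simps quotient_zero tangent_vector_iff extensional_def fun_eq_iff)
qed

end

section \<open>A bound on tangent spaces\<close>

lemma fun_pair_eq_0: "(\<And>u b. f (u, b) = 0) \<Longrightarrow> f = (\<lambda>_. 0)"
proof
  fix x assume "\<And>u b. f (u, b) = 0"
  then show "f x = 0" by (cases x) simp
qed

lemma tangents_inside: "c \<in> tangents L \<Longrightarrow> u \<in> L \<Longrightarrow> c (u, b) = 0"
  unfolding tangents_def by blast

text \<open>Makes the maximum over all points of the Hilbert scheme one of a finite set, so a
  uniform bound is needed also for ideals that are not monomial. With a normal form
  \<open>nf\<close> for a basis of S/I represented by the \<open>q b\<close>, the ideal is generated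
  by u - nf(u) for u = 1 and u = v q_b with v a variable. These are at most 1 + 3d generators, each
  with d coordinates for its value.\<close>

theorem tangent_dim_le:
  assumes "I \<in> (hilb3 d :: 'k::field poly3 set set)"
  shows "tangent_dim I \<le> (1 + 3 * d) * d"
proof -
  have I: "ideal I poly3_ring" and fd: "vectorspace.fin_dim class_ring (quotient_space I)"
    and d: "vectorspace.dim class_ring (quotient_space I) = d"
    using assms by (auto simp: hilb3_def Let_def)
  note V = vectorspace_quotient_space[OF I]
  obtain B f where B: "finite B" "card B = d" "B \<subseteq> carrier (quotient_space I)" and f: "coordinates (quotient_space I) f"
    and out: "\<And>v i. v \<in> carrier (quotient_space I) \<Longrightarrow> i \<notin> B \<Longrightarrow> f v i = 0"
    and delta: "\<And>b i. b \<in> B \<Longrightarrow> i \<in> B \<Longrightarrow> f b i = of_bool (i = b)"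
    using basis_coordinates[OF V fd] unfolding d by metis
  note simps = quotient_space_simps[OF I] 
  have co: "coset I p \<in> carrier (quotient_space I)" for p using coset_in_quotient[OF I] by (simp add: simps)
  have "\<exists>p. b = coset I p" if "b \<in> B" for b using B(3) that quotient_cases[OF I, of b] by (auto simp: simps)
  then obtain q where q: "\<And>b. b \<in> B \<Longrightarrow> b = coset I (q b)" by metis
  define \<kappa> where "\<kappa> p = f (coset I p)" for p
  have \<kappa>_add: "\<kappa> (p + r) b = \<kappa> p b + \<kappa> r b" for p r b
    using coordinates_add[OF f co co, of p r] by (simp add: \<kappa>_def simps coset_add[OF I])
  have \<kappa>_const: "\<kappa> (const_poly c * p) b = c * \<kappa> p b" for p c b
    using coordinates_smult[OF f co, of c p] by (simp add: \<kappa>_def simps coset_smult[OF I])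
  have \<kappa>_I: "\<kappa> p = (\<lambda>_. 0) \<longleftrightarrow> p \<in> I" for p
  proof -
    have "coset I p = coset I 0 \<longleftrightarrow> p \<in> I" using coset_eq_iff[OF I, of p 0] by simp
    moreover have "f (coset I 0) = (\<lambda>_. 0)" using coordinates_zero[OF V f] by (simp add: simps quotient_zero[OF I])
    ultimately show ?thesis using coordinates_eq_0[OF f co[of p]] by (auto simp: \<kappa>_def simps quotient_zero[OF I])
  qed
  define nf where "nf p = (\<Sum>b\<in>B. const_poly (\<kappa> p b) * q b)" for p
  have const_add: "const_poly (a + b) = const_poly a + (const_poly b :: 'k poly3)"
      "const_poly (a * b) = const_poly a * (const_poly b :: 'k poly3)" for a b
    by (simp_all add: const_poly_def single_add mult_single)
  have nf_add: "nf (p + r) = nf p + nf r" for p r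
    by (simp add: nf_def \<kappa>_add const_add distrib_right sum.distrib)
  have nf_const: "nf (const_poly c * p) = const_poly c * nf p" for p c
    by (simp add: nf_def \<kappa>_const const_add sum_distrib_left mult.assoc)
  have nf_I: "nf p = 0" if "p \<in> I" for p
    using that \<kappa>_I[of p] by (simp add: nf_def const_poly_def)
  have \<kappa>_sum: "\<kappa> (\<Sum>b\<in>A. const_poly (a b) * q b) i = (\<Sum>b\<in>A. a b * \<kappa> (q b) i)" if "finite A" for a A i
    using that
  proof (induction A rule: finite_induct)
    case empty
    then show ?case using \<kappa>_I[of 0] ideal_zero[OF I] by simp
  qed (simp add: \<kappa>_add \<kappa>_const)
  have "\<kappa> (nf p) i = \<kappa> p i" for p i
  proof (cases "i \<in> B")
    case True
    have "\<kappa> (q b) i = of_bool (i = b)" if "b \<in> B" for b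
      using delta[OF that True] q[OF that] by (simp add: \<kappa>_def)
    then have "\<kappa> (nf p) i = (\<Sum>b\<in>B. if i = b then \<kappa> p b else 0)"
      unfolding nf_def \<kappa>_sum[OF B(1)] by (intro sum.cong) auto
    then show ?thesis using True B(1) by simp
  next
    case False
    then show ?thesis using out[OF co] by (simp add: \<kappa>_def)
  qed
  then have \<kappa>_nf: "\<kappa> (nf p) = \<kappa> p" for p by (rule ext)
  have nf: "p - nf p \<in> I" for p
  proof -
    have "\<kappa> (p + const_poly (- 1) * nf p) = (\<lambda>_. 0)"
      by (rule ext) (simp only: \<kappa>_add \<kappa>_const \<kappa>_nf, simp)
    moreover have "p + const_poly (- 1) * nf p = p - nf p"
      using const_add(1)[of 1 "- 1"] by (simp add: const_poly_def single_uminus)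
    ultimately show ?thesis using \<kappa>_I by simp
  qed
  define X where "X v = (Poly_Mapping.single (Poly_Mapping.single v 1) 1 :: 'k poly3)" for v :: var3
  define U where "U = insert 1 ((\<lambda>(v, b). X v * q b) ` (UNIV \<times> B))"
  define g where "g p = p - nf p" for p
  have fin: "finite U" and card: "card U \<le> 1 + 3 * d"
  proof -
    have "finite (UNIV :: var3 set)" "card (UNIV :: var3 set) = 3" by (simp_all add: UNIV_var3)
    then show "finite U" "card U \<le> 1 + 3 * d"
      using B card_image_le[of "UNIV \<times> B" "\<lambda>(v, b). X v * q b"] unfolding U_def
      by (auto simp: card_cartesian_product card_insert_if)
  qed
  have coords: "coordinates (tangent_space I) (tangent_coords f g U)"
  proof (rule coordinates_tangent_space[OF I f])
    show "g ` U \<subseteq> I" using nf by (auto simp: g_def)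
    fix J assume J: "J \<subseteq> I" "g ` U \<subseteq> J" "0 \<in> J" "\<And>p q. p \<in> J \<Longrightarrow> q \<in> J \<Longrightarrow> p + q \<in> J"
      "\<And>r p. p \<in> J \<Longrightarrow> r * p \<in> J"
    \<comment> \<open>The aim is that \<open>T\<close> is all of S. For closure under a variable, p
      is split into p - nf(p), which lies in \<open>J\<close>, and nf(p), a combination of the
      \<open>q b\<close> whose multiples by the variable are covered by \<open>U\<close>.\<close>
    define T where "T = {p. p - nf p \<in> J}"
    have T_add: "p + r \<in> T" if "p \<in> T" "r \<in> T" for p r
      using J(4)[of "p - nf p" "r - nf r"] that by (simp add: T_def nf_add algebra_simps)
    have T_const: "const_poly c * p \<in> T" if "p \<in> T" for c p
      using J(5)[of "p - nf p" "const_poly c"] that by (simp only: T_def mem_Collect_eq nf_const right_diff_distrib)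
    have T_J: "p \<in> T" if "p \<in> J" for p using that J(1) nf_I[of p] by (auto simp: T_def)
    have T_U: "p \<in> T" if "p \<in> U" for p using that J(2) by (auto simp: T_def g_def)
    have "p \<in> T" for p
    proof (rule poly_span)
      show "1 \<in> T" by (rule T_U) (simp add: U_def)
      fix v p assume p: "p \<in> T"
      have "(\<Sum>b\<in>A. const_poly (\<kappa> p b) * (X v * q b)) \<in> T" if "finite A" "A \<subseteq> B" for A
        using that
      proof (induction A rule: finite_induct)
        case empty
        then show ?case using T_J J(3) by simp
      next
        case (insert b A)
        then have "X v * q b \<in> T" by (intro T_U) (auto simp: U_def)
        then show ?case using insert by (simp add: T_add T_const)
      qed
      from this[OF B(1)] have "X v * nf p \<in> T"
        by (simp add: nf_def sum_distrib_left mult.left_commute)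
      moreover have "X v * (p - nf p) \<in> T" using p by (intro T_J J(5)) (simp add: T_def)
      ultimately have "X v * (p - nf p) + X v * nf p \<in> T" by (rule T_add[rotated])
      then show "Poly_Mapping.single (Poly_Mapping.single v 1) 1 * p \<in> T"
        by (simp add: X_def algebra_simps)
    qed (auto intro: T_add T_const)
    then have "p - nf p \<in> J" for p by (simp add: T_def)
    then show "I \<subseteq> J" using nf_I by (metis diff_zero subsetI)
  qed
  have "vectorspace.dim class_ring (tangent_space I) \<le> card (U \<times> B)"
  proof (rule dim_le_card[OF vectorspace_tangent_space[OF I] coords])
    show "finite (U \<times> B)" using fin B(1) by simp
    fix \<phi> assume \<phi>: "\<phi> \<in> carrier (tangent_space I)" and 0: "\<And>x. x \<in> U \<times> B \<Longrightarrow> tangent_coords f g U \<phi> x = 0"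
    have "tangent_coords f g U \<phi> (u, b) = 0" for u b
    proof (cases "u \<in> U \<and> b \<in> B")
      case False
      have "\<phi> (g u) \<in> carrier (quotient_space I)"
        using \<phi> nf by (simp add: tangent_vector_iff[OF I] simps g_def)
      then show ?thesis using False out by (auto simp: tangent_coords_def[OF I])
    qed (use 0 in auto)
    then show "tangent_coords f g U \<phi> = (\<lambda>_. 0)" by (rule fun_pair_eq_0)
  qed
  also have "\<dots> \<le> (1 + 3 * d) * d" using mult_le_mono1[OF card, of d] B(2) by (simp add: card_cartesian_product)
  finally show ?thesis by (simp add: tangent_dim_def)
qed

section \<open>Monomial ideals\<close>

definition lin_ext :: "('m \<Rightarrow> 'k) \<Rightarrow> ('m \<Rightarrow>\<^sub>0 'k::comm_ring_1) \<Rightarrow> 'k" where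
  "lin_ext h p = (\<Sum>m\<in>Poly_Mapping.keys p. Poly_Mapping.lookup p m * h m)"

lemma lin_ext_superset:
  assumes "finite A" "Poly_Mapping.keys p \<subseteq> A"
  shows "lin_ext h p = (\<Sum>m\<in>A. Poly_Mapping.lookup p m * h m)"
  unfolding lin_ext_def using assms by (intro sum.mono_neutral_left) (auto simp: in_keys_iff)

lemma lin_ext_add: "lin_ext h (p + q) = lin_ext h p + lin_ext h q"
proof -
  let ?A = "Poly_Mapping.keys p \<union> Poly_Mapping.keys q"
  have "Poly_Mapping.keys (p + q) \<subseteq> ?A" by (rule keys_add)
  then show ?thesis
    using lin_ext_superset[of ?A p h] lin_ext_superset[of ?A q h] lin_ext_superset[of ?A "p + q" h]
    by (simp add: lookup_add distrib_right sum.distrib)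
qed

lemma lin_ext_single: "lin_ext h (Poly_Mapping.single m c) = c * h m"
  by (cases "c = 0") (simp_all add: lin_ext_def)

lemma lin_ext_zero: "lin_ext h 0 = 0"
  by (simp add: lin_ext_def)

lemma lin_ext_sum: "lin_ext h (sum p A) = (\<Sum>i\<in>A. lin_ext h (p i))"
  by (induction A rule: infinite_finite_induct) (simp_all add: lin_ext_zero lin_ext_add)

lemma lin_ext_monom_mult: "lin_ext h (Poly_Mapping.single u 1 * p) = lin_ext (\<lambda>m. h (u + m)) p"
  unfolding monom_mult_eq_sum lin_ext_sum lin_ext_single by (simp add: lin_ext_def)

lemma lin_ext_const_mult: "lin_ext h (const_poly c * p) = c * lin_ext h p"
proof -
  have "lin_ext h (const_poly c * p) = (\<Sum>m\<in>Poly_Mapping.keys p. Poly_Mapping.lookup (const_poly c * p) m * h m)"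
    by (rule lin_ext_superset) (auto simp: in_keys_iff lookup_const_poly_mult)
  then show ?thesis by (simp add: lin_ext_def lookup_const_poly_mult sum_distrib_left mult.assoc)
qed

text \<open>\<open>L\<close> is written in sorted exponents, and \<sigma> tells which actual
  variables take the parts of x, y, z. One combinatorial analysis thus serves every ordering of the
  variables.\<close>

definition monomial_ideal :: "(var3 \<Rightarrow> var3) \<Rightarrow> expo set \<Rightarrow> 'k::field poly3 set" where
  "monomial_ideal \<sigma> L = {p. \<forall>m\<in>Poly_Mapping.keys p. expo_of \<sigma> m \<notin> L}"

lemma expo_of_add_notin:
  assumes L: "staircase L" and m: "expo_of \<sigma> m \<notin> L"
  shows "expo_of \<sigma> (n + m) \<notin> L"
proof -
  have 1: "(a + i, b, c) \<in> L \<Longrightarrow> (a, b, c) \<in> L" for a b c i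
  proof (induction i)
    case (Suc i) then show ?case using staircase_up[OF L, of Var_x "(a + i, b, c)"] by simp
  qed simp
  have 2: "(a, b + i, c) \<in> L \<Longrightarrow> (a, b, c) \<in> L" for a b c i
  proof (induction i)
    case (Suc i) then show ?case using staircase_up[OF L, of Var_y "(a, b + i, c)"] by simp
  qed simp
  have 3: "(a, b, c + i) \<in> L \<Longrightarrow> (a, b, c) \<in> L" for a b c i
  proof (induction i)
    case (Suc i) then show ?case using staircase_up[OF L, of Var_z "(a, b, c + i)"] by simp
  qed simp
  show ?thesis using m 1 2 3 unfolding expo_of_def lookup_add by (metis add.commute)
qed

lemma ideal_monomial_ideal:
  assumes L: "staircase L"
  shows "ideal (monomial_ideal \<sigma> L :: 'k::field poly3 set) poly3_ring"
proof (rule idealI)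
  show "ring (poly3_ring :: 'k poly3 ring)" by (rule cring.axioms(1)[OF class_cring.is_cring])
  show "subgroup (monomial_ideal \<sigma> L) (add_monoid (poly3_ring :: 'k poly3 ring))"
  proof (rule group.subgroupI)
    show "group (add_monoid (poly3_ring :: 'k poly3 ring))"
      by (intro abelian_group.a_group ring.is_abelian_group cring.axioms(1) class_cring.is_cring)
    show "monomial_ideal \<sigma> L \<noteq> ({} :: 'k poly3 set)" by (auto simp: monomial_ideal_def intro: exI[of _ 0])
    fix p :: "'k poly3" assume p: "p \<in> monomial_ideal \<sigma> L"
    have "a_inv poly3_ring p = - p" by (simp only: class_ring_simps)
    moreover have "Poly_Mapping.keys (- p) = Poly_Mapping.keys p" by (auto simp: in_keys_iff)
    ultimately show "inv\<^bsub>add_monoid poly3_ring\<^esub> p \<in> monomial_ideal \<sigma> L"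
      unfolding a_inv_def using p by (simp only: monomial_ideal_def mem_Collect_eq)
    fix q :: "'k poly3" assume "q \<in> monomial_ideal \<sigma> L"
    then show "p \<otimes>\<^bsub>add_monoid poly3_ring\<^esub> q \<in> monomial_ideal \<sigma> L"
      using p keys_add[of p q] by (auto simp: monomial_ideal_def)
  qed simp
  fix p r :: "'k poly3" assume p: "p \<in> monomial_ideal \<sigma> L"
  have "r * p \<in> monomial_ideal \<sigma> L"
    unfolding monomial_ideal_def
  proof (intro CollectI ballI)
    fix m assume "m \<in> Poly_Mapping.keys (r * p)"
    then obtain a b where "m = a + b" "b \<in> Poly_Mapping.keys p" using keys_mult[of r p] by auto
    then show "expo_of \<sigma> m \<notin> L" using p expo_of_add_notin[OF L] by (simp add: monomial_ideal_def)
  qed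
  then show "r \<otimes>\<^bsub>poly3_ring\<^esub> p \<in> monomial_ideal \<sigma> L" "p \<otimes>\<^bsub>poly3_ring\<^esub> r \<in> monomial_ideal \<sigma> L"
    by (simp_all add: mult.commute)
qed

text \<open>The choice of a representative is harmless, as polynomials of one coset have equal
  coefficients at the monomials of \<open>L\<close>.\<close>

definition standard_coords :: "(var3 \<Rightarrow> var3) \<Rightarrow> expo set \<Rightarrow> 'k::field poly3 set \<Rightarrow> expo \<Rightarrow> 'k" where
  "standard_coords \<sigma> L X = (\<lambda>b. if b \<in> L then Poly_Mapping.lookup (SOME p. X = coset (monomial_ideal \<sigma> L) p) (monom_of \<sigma> b) else 0)"

context
  fixes \<sigma> :: "var3 \<Rightarrow> var3" and L :: "expo set"
  assumes \<sigma>: "bij \<sigma>" and L: "staircase L"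
begin

lemma monomial_ideal_iff:
  "p \<in> monomial_ideal \<sigma> L \<longleftrightarrow> (\<forall>b\<in>L. Poly_Mapping.lookup p (monom_of \<sigma> b) = 0)"
proof
  assume p: "p \<in> monomial_ideal \<sigma> L"
  show "\<forall>b\<in>L. Poly_Mapping.lookup p (monom_of \<sigma> b) = 0"
  proof
    fix b assume "b \<in> L"
    then have "monom_of \<sigma> b \<notin> Poly_Mapping.keys p" using p expo_of_monom_of[OF \<sigma>, of b] by (auto simp: monomial_ideal_def)
    then show "Poly_Mapping.lookup p (monom_of \<sigma> b) = 0" by (simp add: in_keys_iff)
  qed
next
  assume 0: "\<forall>b\<in>L. Poly_Mapping.lookup p (monom_of \<sigma> b) = 0"
  have "expo_of \<sigma> m \<notin> L" if "m \<in> Poly_Mapping.keys p" for m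
    using 0 that monom_of_expo_of[OF \<sigma>, of m] by (auto simp: in_keys_iff)
  then show "p \<in> monomial_ideal \<sigma> L" by (simp add: monomial_ideal_def)
qed

lemma standard_coords_coset:
  "standard_coords \<sigma> L (coset (monomial_ideal \<sigma> L :: 'k::field poly3 set) p) b = (if b \<in> L then Poly_Mapping.lookup p (monom_of \<sigma> b) else 0)"
proof -
  let ?I = "monomial_ideal \<sigma> L :: 'k poly3 set"
  let ?q = "SOME q. coset ?I p = coset ?I q"
  have "coset ?I p = coset ?I ?q" by (rule someI[of "\<lambda>q. coset ?I p = coset ?I q" p]) simp
  then have "p - ?q \<in> ?I" using coset_eq_iff[OF ideal_monomial_ideal[OF L, of \<sigma>, where ?'k = 'k], of p ?q] by simp
  then show ?thesis by (simp add: standard_coords_def monomial_ideal_iff lookup_minus)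
qed

lemma coordinates_standard_coords:
  "coordinates (quotient_space (monomial_ideal \<sigma> L)) (standard_coords \<sigma> L :: 'k::field poly3 set \<Rightarrow> _)"
proof -
  let ?I = "monomial_ideal \<sigma> L :: 'k poly3 set"
  note I = ideal_monomial_ideal[OF L, of \<sigma>, where ?'k = 'k]
  note simps = quotient_space_simps[OF I] coset_add[OF I] coset_smult[OF I] quotient_zero[OF I]
  show ?thesis
    unfolding coordinates_def
  proof (intro conjI ballI allI impI)
    fix u assume "u \<in> carrier (quotient_space ?I)"
    then obtain p where u: "u = coset ?I p" using quotient_cases[OF I, of u] by (auto simp: simps)
    show "standard_coords \<sigma> L (c \<odot>\<^bsub>quotient_space ?I\<^esub> u) = (\<lambda>i. c * standard_coords \<sigma> L u i)" for c
      by (auto simp: u simps standard_coords_coset lookup_const_poly_mult)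
    show "standard_coords \<sigma> L (u \<oplus>\<^bsub>quotient_space ?I\<^esub> v) = (\<lambda>i. standard_coords \<sigma> L u i + standard_coords \<sigma> L v i)"
      if "v \<in> carrier (quotient_space ?I)" for v
    proof -
      have "v \<in> carrier (quotient_module poly3_ring ?I)" using that by (simp add: simps(1))
      then obtain q where v: "v = coset ?I q" by (rule quotient_cases[OF I])
      show ?thesis by (auto simp: u v simps standard_coords_coset lookup_add)
    qed
    assume 0: "standard_coords \<sigma> L u = (\<lambda>_. 0)"
    have "Poly_Mapping.lookup p (monom_of \<sigma> b) = 0" if "b \<in> L" for b
      using fun_cong[OF 0, of b] that by (simp add: u standard_coords_coset)
    then have "coset ?I p = coset ?I 0" using coset_eq_iff[OF I, of p 0] by (simp add: monomial_ideal_iff)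
    then show "u = \<zero>\<^bsub>quotient_space ?I\<^esub>" by (simp add: u simps)
  qed
qed

lemma monomial_ideal_hilb3: "(monomial_ideal \<sigma> L :: 'k::field poly3 set) \<in> hilb3 (card L)"
proof -
  let ?I = "monomial_ideal \<sigma> L :: 'k poly3 set"
  note I = ideal_monomial_ideal[OF L, of \<sigma>, where ?'k = 'k]
  let ?f = "standard_coords \<sigma> L :: 'k poly3 set \<Rightarrow> _"
  let ?w = "\<lambda>b. ?f (coset ?I (Poly_Mapping.single (monom_of \<sigma> b) 1))"
  have inj: "monom_of \<sigma> a = monom_of \<sigma> b \<longleftrightarrow> a = b" for a b
    using expo_of_monom_of[OF \<sigma>] by metis
  have dual: "dual_family L (?f ` carrier (quotient_space ?I)) ?w"
    unfolding dual_family_def using coset_in_quotient[OF I]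
    by (auto simp: quotient_space_simps[OF I] standard_coords_coset lookup_single when_def inj)
  have "determines L (?f ` carrier (quotient_space ?I))"
    unfolding determines_def by (auto simp: standard_coords_def)
  from dim_eq_card_dual_family[OF vectorspace_quotient_space[OF I] coordinates_standard_coords staircase_finite[OF L] this dual]
  show ?thesis using I by (simp add: hilb3_def Let_def)
qed

text \<open>Outside \<open>L\<close> the values propagate by linearity over the variables, so the
  monomials bordering \<open>L\<close> suffice. The monomial 1 is added as the start of the
  induction, which matters when \<open>L\<close> is empty.\<close>

lemma tangents_determined:
  "\<exists>Q. finite Q \<and> determines Q (tangents L :: (_ \<Rightarrow> 'k::field) set)"
proof -
  define U where "U = insert (0, 0, 0) (\<Union>e. up e ` L)"
  have "finite U" using staircase_finite[OF L] by (auto simp: U_def UNIV_var3)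
  moreover have "determines (U \<times> L) (tangents L :: (_ \<Rightarrow> 'k) set)"
    unfolding determines_def
  proof (intro ballI impI)
    fix c :: "_ \<Rightarrow> 'k" assume c: "c \<in> tangents L" and 0: "\<forall>q\<in>U \<times> L. c q = 0"
    then have lift: "c \<in> lifted_tangents L" by (simp add: tangents_def)
    have "\<forall>b\<in>L. c (u, b) = 0" for u
    proof (induction u rule: expo_induct)
      case 1
      then show ?case using 0 by (auto simp: U_def)
    next
      case (2 e u)
      show ?case
      proof (cases "u \<in> L")
        case True
        then show ?thesis using 0 by (auto simp: U_def)
      next
        case False
        show ?thesis
        proof
          fix b assume b: "b \<in> L"
          then have "c (up e u, b) = shift e c (u, b)"
            using lifted_tangents_defect[OF lift False, of e b] by (simp add: defect_def)
          then show "c (up e u, b) = 0" using 2 staircase_down[OF L b, of e] by (simp add: shift_def)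
        qed
      qed
    qed
    then have "c (u, b) = 0" for u b
      using lifted_tangents_outside[OF lift] by (cases "b \<in> L") blast+
    then show "c = (\<lambda>_. 0)" by (rule fun_pair_eq_0)
  qed
  ultimately show ?thesis using staircase_finite[OF L] by (intro exI[of _ "U \<times> L"]) simp
qed

abbreviation "generator_monom u \<equiv> Poly_Mapping.single (monom_of \<sigma> u) (1 :: 'k::field)"

abbreviation "monomial_tangent_coords \<equiv>
  tangent_coords (standard_coords \<sigma> L :: 'k::field poly3 set \<Rightarrow> _) generator_monom (- L)"

lemma coordinates_monomial_tangent:
  "coordinates (tangent_space (monomial_ideal \<sigma> L :: 'k::field poly3 set)) monomial_tangent_coords"
proof (rule coordinates_tangent_space[OF ideal_monomial_ideal[OF L] coordinates_standard_coords])
  show "generator_monom ` (- L) \<subseteq> (monomial_ideal \<sigma> L :: 'k poly3 set)"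
    by (auto simp: monomial_ideal_def expo_of_monom_of[OF \<sigma>])
  fix J :: "'k poly3 set"
  assume J: "generator_monom ` (- L) \<subseteq> J" "0 \<in> J" "\<And>p q. p \<in> J \<Longrightarrow> q \<in> J \<Longrightarrow> p + q \<in> J" "\<And>r p. p \<in> J \<Longrightarrow> r * p \<in> J"
  show "monomial_ideal \<sigma> L \<subseteq> J"
  proof
    fix p :: "'k poly3" assume p: "p \<in> monomial_ideal \<sigma> L"
    have single: "Poly_Mapping.single m (Poly_Mapping.lookup p m) \<in> J" if "m \<in> Poly_Mapping.keys p" for m
    proof -
      have "generator_monom (expo_of \<sigma> m) \<in> J" using that p J(1) by (auto simp: monomial_ideal_def)
      then have "const_poly (Poly_Mapping.lookup p m) * generator_monom (expo_of \<sigma> m) \<in> J" by (rule J(4))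
      then show ?thesis by (simp add: const_poly_mult_monom monom_of_expo_of[OF \<sigma>])
    qed
    have sum: "(\<Sum>m\<in>A. f m) \<in> J" if "finite A" "\<And>m. m \<in> A \<Longrightarrow> f m \<in> J" for A and f :: "_ \<Rightarrow> 'k poly3"
      using that by (induction A rule: finite_induct) (auto intro: J(2,3))
    have "(\<Sum>m\<in>Poly_Mapping.keys p. Poly_Mapping.single m (Poly_Mapping.lookup p m)) \<in> J"
      using single by (rule sum[OF finite_keys])
    then show "p \<in> J" by (simp only: poly_eq_sum[symmetric])
  qed
qed

lemma lookup_variable_mult:
  fixes p :: "'k::field poly3"
  shows "Poly_Mapping.lookup (Poly_Mapping.single (Poly_Mapping.single (\<sigma> e) 1) 1 * p) (monom_of \<sigma> b) =
    (if coord e b = 0 then 0 else Poly_Mapping.lookup p (monom_of \<sigma> (down e b)))"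
proof (cases "coord e b = 0")
  case False
  then have "monom_of \<sigma> b = Poly_Mapping.single (\<sigma> e) 1 + monom_of \<sigma> (down e b)"
    using monom_of_up[of \<sigma> e "down e b"] up_down[of e b] by simp
  then show ?thesis using False by (simp add: lookup_monom_mult)
next
  case True
  have "monom_of \<sigma> b \<noteq> Poly_Mapping.single (\<sigma> e) 1 + m" for m
  proof
    assume "monom_of \<sigma> b = Poly_Mapping.single (\<sigma> e) 1 + m"
    then have "monom_of \<sigma> b = monom_of \<sigma> (up e (expo_of \<sigma> m))" by (simp add: monom_of_up monom_of_expo_of[OF \<sigma>])
    then have "b = up e (expo_of \<sigma> m)" using expo_of_monom_of[OF \<sigma>] by metis
    then show False using True by simp
  qed
  then show ?thesis using True by (simp add: lookup_monom_mult(2))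
qed

text \<open>With all monomials outside \<open>L\<close> taken as generators, the only relations
  needed say that a variable times a generator is a generator. They are exactly the equations
  \<open>defect = 0\<close>.\<close>

lemma monomial_tangent_coords_image:
  "monomial_tangent_coords ` carrier (tangent_space (monomial_ideal \<sigma> L :: 'k::field poly3 set)) = tangents L"
proof -
  let ?I = "monomial_ideal \<sigma> L :: 'k poly3 set"
  let ?X = "\<lambda>e. Poly_Mapping.single (Poly_Mapping.single (\<sigma> e) 1) (1 :: 'k)"
  note I = ideal_monomial_ideal[OF L, of \<sigma>, where ?'k = 'k]
  note tangent_coords_def [OF I, simp]
  have gen: "generator_monom u \<in> ?I" if "u \<notin> L" for u
    using that by (simp add: monomial_ideal_def expo_of_monom_of[OF \<sigma>])
  have upL: "up e u \<notin> L" if "u \<notin> L" for e u using staircase_up[OF L] that by blast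
  show ?thesis
  proof (intro equalityI subsetI)
    fix c assume "c \<in> monomial_tangent_coords ` carrier (tangent_space ?I)"
    then obtain \<phi> where \<phi>: "\<phi> \<in> carrier (tangent_space ?I)" and c: "c = monomial_tangent_coords \<phi>" by blast
    have "defect L e c (u, b) = 0" if u: "u \<notin> L" for e u b
    proof (cases "b \<in> L")
      case True
      obtain p where p: "\<phi> (generator_monom u) = coset ?I p"
        using \<phi> gen[OF u] quotient_cases[OF I] unfolding tangent_vector_iff[OF I] by metis
      have "\<phi> (?X e * generator_monom u) = coset ?I (?X e * p)"
        using \<phi> gen[OF u] p unfolding tangent_vector_iff[OF I] by (simp add: coset_smult[OF I])
      then have "\<phi> (generator_monom (up e u)) = coset ?I (?X e * p)"
        by (simp add: monom_of_up mult_single)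
      then show ?thesis
        using u upL[OF u] True p staircase_down[OF L True, of e]
        by (simp add: c defect_def shift_def standard_coords_coset lookup_variable_mult del: One_nat_def)
    qed (simp add: defect_def)
    then show "c \<in> tangents L"
      unfolding tangents_def lifted_tangents_def by (auto simp: c standard_coords_def simp del: split_paired_All)
  next
    fix c :: "_ \<Rightarrow> 'k" assume c: "c \<in> tangents L"
    then have lift: "c \<in> lifted_tangents L" by (simp add: tangents_def)
    \<comment> \<open>\<open>P p\<close> is a polynomial that represents the value at p of the
      k-linear extension of \<open>c\<close>.\<close>
    define P where "P p = (\<Sum>b\<in>L. Poly_Mapping.single (monom_of \<sigma> b) (lin_ext (\<lambda>m. c (expo_of \<sigma> m, b)) p))" for p
    have inj: "monom_of \<sigma> a = monom_of \<sigma> b \<longleftrightarrow> a = b" for a b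
      using expo_of_monom_of[OF \<sigma>] by metis
    have lookup_P: "Poly_Mapping.lookup (P p) (monom_of \<sigma> b) = lin_ext (\<lambda>m. c (expo_of \<sigma> m, b)) p" if "b \<in> L" for p b
    proof -
      have "Poly_Mapping.lookup (P p) (monom_of \<sigma> b) = (\<Sum>a\<in>L. if a = b then lin_ext (\<lambda>m. c (expo_of \<sigma> m, a)) p else 0)"
        unfolding P_def lookup_sum by (intro sum.cong) (auto simp: lookup_single when_def inj)
      then show ?thesis using that staircase_finite[OF L] by simp
    qed
    have P_eq: "coset ?I (P p) = coset ?I q \<longleftrightarrow> (\<forall>b\<in>L. lin_ext (\<lambda>m. c (expo_of \<sigma> m, b)) p = Poly_Mapping.lookup q (monom_of \<sigma> b))" for p q
      unfolding coset_eq_iff[OF I] monomial_ideal_iff by (simp add: lookup_minus lookup_P)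
    define \<phi> where "\<phi> = (\<lambda>p\<in>?I. coset ?I (P p))"
    \<comment> \<open>S-linearity modulo I, proved for all multipliers by \<open>poly_span\<close>.
      The equations satisfied by \<open>c\<close> enter when the multiplier gains a
      variable.\<close>
    have "p \<in> {r. \<forall>q\<in>?I. coset ?I (P (r * q)) = coset ?I (r * P q)}" for p
    proof (rule poly_span)
      fix r s assume rs: "r \<in> {r. \<forall>q\<in>?I. coset ?I (P (r * q)) = coset ?I (r * P q)}"
      show "const_poly d * r \<in> {r. \<forall>q\<in>?I. coset ?I (P (r * q)) = coset ?I (r * P q)}" for d
        using rs by (auto simp: P_eq mult.assoc lin_ext_const_mult lookup_const_poly_mult)
      show "r + s \<in> {r. \<forall>q\<in>?I. coset ?I (P (r * q)) = coset ?I (r * P q)}"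
        if "s \<in> {r. \<forall>q\<in>?I. coset ?I (P (r * q)) = coset ?I (r * P q)}"
        using rs that by (auto simp: P_eq distrib_right lin_ext_add lookup_add)
      fix v
      obtain e where e: "v = \<sigma> e" using \<sigma> by (metis bij_pointE)
      show "Poly_Mapping.single (Poly_Mapping.single v 1) 1 * r \<in> {r. \<forall>q\<in>?I. coset ?I (P (r * q)) = coset ?I (r * P q)}"
      proof (intro CollectI ballI, subst P_eq, rule ballI)
        fix q b assume q: "q \<in> ?I" and b: "b \<in> L"
        have rq: "r * q \<in> ?I" by (rule ideal_mult[OF I q])
        have "lin_ext (\<lambda>m. c (expo_of \<sigma> m, b)) (?X e * (r * q)) = lin_ext (\<lambda>m. c (expo_of \<sigma> (Poly_Mapping.single (\<sigma> e) 1 + m), b)) (r * q)"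
          by (rule lin_ext_monom_mult)
        also have "\<dots> = lin_ext (\<lambda>m. shift e c (expo_of \<sigma> m, b)) (r * q)"
          unfolding lin_ext_def
        proof (intro sum.cong refl arg_cong2[where f = times])
          fix m assume "m \<in> Poly_Mapping.keys (r * q)"
          then have m: "expo_of \<sigma> m \<notin> L" using rq by (auto simp: monomial_ideal_def)
          have "Poly_Mapping.single (\<sigma> e) 1 + m = monom_of \<sigma> (up e (expo_of \<sigma> m))"
            by (simp add: monom_of_up monom_of_expo_of[OF \<sigma>])
          then have "expo_of \<sigma> (Poly_Mapping.single (\<sigma> e) 1 + m) = up e (expo_of \<sigma> m)"
            by (simp only: expo_of_monom_of[OF \<sigma>])
          then show "c (expo_of \<sigma> (Poly_Mapping.single (\<sigma> e) 1 + m), b) = shift e c (expo_of \<sigma> m, b)"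
            using lifted_tangents_defect[OF lift m, of e b] b by (simp add: defect_def)
        qed
        also have "\<dots> = (if coord e b = 0 then 0 else lin_ext (\<lambda>m. c (expo_of \<sigma> m, down e b)) (r * q))"
          by (simp add: shift_def lin_ext_def)
        also have "\<dots> = Poly_Mapping.lookup (?X e * (r * P q)) (monom_of \<sigma> b)"
        proof -
          have "coset ?I (P (r * q)) = coset ?I (r * P q)" using rs q by blast
          then show ?thesis using staircase_down[OF L b, of e] unfolding P_eq lookup_variable_mult by simp
        qed
        finally show "lin_ext (\<lambda>m. c (expo_of \<sigma> m, b)) (Poly_Mapping.single (Poly_Mapping.single v 1) 1 * r * q) =
            Poly_Mapping.lookup (Poly_Mapping.single (Poly_Mapping.single v 1) 1 * r * P q) (monom_of \<sigma> b)"
          by (simp only: e mult.assoc)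
      qed
    qed simp
    then have mult: "coset ?I (P (r * q)) = coset ?I (r * P q)" if "q \<in> ?I" for r q using that by blast
    have add: "coset ?I (P (p + q)) = coset ?I (P p + P q)" for p q
      by (subst P_eq) (simp add: lookup_add lookup_P lin_ext_add)
    have "\<phi> \<in> carrier (tangent_space ?I)"
      unfolding tangent_vector_iff[OF I]
      using ideal_add[OF I] ideal_mult[OF I] coset_in_quotient[OF I]
      by (simp add: \<phi>_def coset_add[OF I] coset_smult[OF I] add mult)
    moreover have "c = monomial_tangent_coords \<phi>"
    proof
      fix x :: "expo \<times> expo"
      obtain u b where x: "x = (u, b)" by (cases x) blast
      show "c x = monomial_tangent_coords \<phi> x"
      proof (cases "u \<in> L \<or> b \<notin> L")
        case True
        then show ?thesis using tangents_inside[OF c, of u b] lifted_tangents_outside[OF lift, of b u]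
          by (auto simp: x standard_coords_def)
      next
        case False
        then show ?thesis
          by (simp add: x \<phi>_def gen standard_coords_coset lookup_P lin_ext_single expo_of_monom_of[OF \<sigma>])
      qed
    qed
    ultimately show "c \<in> monomial_tangent_coords ` carrier (tangent_space ?I)" by blast
  qed
qed

theorem tangent_dim_monomial_ideal:
  "\<exists>Q c. finite Q \<and> determines Q (tangents L :: (_ \<Rightarrow> 'k::field) set) \<and> dual_family Q (tangents L :: (_ \<Rightarrow> 'k) set) c \<and>
     tangent_dim (monomial_ideal \<sigma> L :: 'k poly3 set) = card Q"
proof -
  obtain Q0 where "finite Q0" "determines Q0 (tangents L :: (_ \<Rightarrow> 'k) set)" using tangents_determined by blast
  then obtain Q c where Q: "finite Q" "determines Q (tangents L :: (_ \<Rightarrow> 'k) set)" "dual_family Q (tangents L :: (_ \<Rightarrow> 'k) set) c"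
    using dual_family_exists[OF fun_subspace_tangents] finite_subset by metis
  have "tangent_dim (monomial_ideal \<sigma> L :: 'k poly3 set) = card Q"
    using dim_eq_card_dual_family[OF vectorspace_tangent_space[OF ideal_monomial_ideal[OF L]] coordinates_monomial_tangent Q(1), where w = c]
      Q(2,3) unfolding monomial_tangent_coords_image tangent_dim_def by blast
  with Q show ?thesis by blast
qed

end

section \<open>A monomial ideal with a large tangent space\<close>

text \<open>Closed under the exchanges of \<open>borel_fixed\<close>, but containing both z^4 and
  x^6, a combination that \<open>lower_set_height_5\<close> rules out for sets of smallest
  monomials.\<close>

definition witness :: "expo set" where
  "witness = simplex4 \<union> {(5,0,0), (6,0,0), (4,1,0), (4,0,1)}"

lemma in_witness: "(a, b, c) \<in> witness \<longleftrightarrow> a + b + c \<le> 4 \<or> (a, b, c) \<in> {(5,0,0), (6,0,0), (4,1,0), (4,0,1)}"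
  by (auto simp: witness_def simplex4_def)

lemma staircase_witness: "staircase witness"
proof -
  have "u \<in> witness" if "up e u \<in> witness" for e u
    using that by (cases e; cases u) (auto simp: in_witness)
  then show ?thesis using finite_simplex4 by (simp add: staircase_def witness_def del: split_paired_All)
qed

lemma card_witness: "card witness = 39"
proof -
  have "u \<notin> simplex4" if "u \<in> {(5,0,0), (6,0,0), (4,1,0), (4,0,1)}" for u
    using that by (auto simp: simplex4_def)
  then show ?thesis by (simp add: witness_def finite_simplex4 card_simplex4)
qed

text \<open>A set of arrows from monomials of I to standard monomials; the second condition is the
  equation \<open>defect = 0\<close> for the indicator function of the set.\<close>

definition support_closed :: "expo set \<Rightarrow> (expo \<times> expo) set \<Rightarrow> bool" where
  "support_closed L S \<longleftrightarrow> S \<subseteq> (- L) \<times> L \<and>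
     (\<forall>u e b. u \<notin> L \<longrightarrow> b \<in> L \<longrightarrow> ((up e u, b) \<in> S \<longleftrightarrow> coord e b \<noteq> 0 \<and> (u, down e b) \<in> S))"

lemma tangents_of_support:
  assumes "support_closed L S"
  shows "(\<lambda>i. of_bool (i \<in> S)) \<in> (tangents L :: (_ \<Rightarrow> 'k::field) set)"
  unfolding tangents_def lifted_tangents_def
proof (intro CollectI conjI allI ballI impI)
  fix u b
  show "of_bool ((u, b) \<in> S) = (0 :: 'k)" if "b \<notin> L" using assms that by (auto simp: support_closed_def)
  show "of_bool ((u, b) \<in> S) = (0 :: 'k)" if "u \<in> L" using assms that by (auto simp: support_closed_def)
  show "defect L e (\<lambda>i. of_bool (i \<in> S)) (u, b) = (0 :: 'k)" if u: "u \<notin> L" for e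
  proof (cases "b \<in> L")
    case True
    then have "(up e u, b) \<in> S \<longleftrightarrow> coord e b \<noteq> 0 \<and> (u, down e b) \<in> S"
      using assms u unfolding support_closed_def by blast
    then show ?thesis by (simp add: defect_def shift_def)
  qed (simp add: defect_def)
qed

definition minimal_generator :: "expo set \<Rightarrow> expo \<Rightarrow> bool" where
  "minimal_generator L g \<longleftrightarrow> g \<notin> L \<and> (\<forall>e. coord e g \<noteq> 0 \<longrightarrow> down e g \<in> L)"

definition socle :: "expo set \<Rightarrow> expo \<Rightarrow> bool" where
  "socle L b \<longleftrightarrow> b \<in> L \<and> (\<forall>e. up e b \<notin> L)"

lemma minimal_generator_up: "minimal_generator L g \<Longrightarrow> u \<notin> L \<Longrightarrow> up e u \<noteq> g"
  unfolding minimal_generator_def by (auto dest!: spec[of _ e])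

text \<open>No variable times a monomial of I gives a minimal generator, and every variable kills a
  socle monomial, so a single arrow forces no other one.\<close>

lemma support_closed_singleton:
  assumes g: "minimal_generator L g" and b: "socle L b"
  shows "support_closed L {(g, b)}"
  unfolding support_closed_def
proof (intro conjI allI impI)
  show "{(g, b)} \<subseteq> (- L) \<times> L" using g b by (simp add: minimal_generator_def socle_def)
  fix u e c assume u: "u \<notin> L" and c: "c \<in> L"
  have "down e c \<noteq> b" if "coord e c \<noteq> 0" using up_down[OF that] b c unfolding socle_def by metis
  then show "(up e u, c) \<in> {(g, b)} \<longleftrightarrow> coord e c \<noteq> 0 \<and> (u, down e c) \<in> {(g, b)}"
    using minimal_generator_up[OF g u] by auto
qed

text \<open>The arrow g -> b forces x g -> x b, where propagation ends in the socle; y b and z b are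
  already zero in S/I. By the condition on \<open>g\<close>, the monomial x g is a variable times a
  monomial of I only as x times g, so the second arrow forces nothing backwards either.\<close>

lemma support_closed_pair:
  assumes L: "staircase L" and g: "minimal_generator L g" "\<And>e. e \<noteq> Var_x \<Longrightarrow> coord e g \<noteq> 0 \<Longrightarrow> up Var_x (down e g) \<in> L"
    and b: "socle L (up Var_x b)" "\<And>e. e \<noteq> Var_x \<Longrightarrow> up e b \<notin> L"
  shows "support_closed L {(g, b), (up Var_x g, up Var_x b)}"
  unfolding support_closed_def
proof (intro conjI allI impI)
  have bL: "b \<in> L" "up Var_x b \<in> L" using b(1) staircase_up[OF L] unfolding socle_def by blast+
  have "g \<notin> L" using g(1) by (simp add: minimal_generator_def)
  moreover have "up Var_x g \<notin> L" using calculation staircase_up[OF L, of Var_x g] by blast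
  ultimately show "{(g, b), (up Var_x g, up Var_x b)} \<subseteq> (- L) \<times> L" using bL by simp
  fix u e c assume u: "u \<notin> L" and c: "c \<in> L"
  show "(up e u, c) \<in> {(g, b), (up Var_x g, up Var_x b)} \<longleftrightarrow>
      coord e c \<noteq> 0 \<and> (u, down e c) \<in> {(g, b), (up Var_x g, up Var_x b)}"
  proof (cases "e = Var_x")
    case True
    have "down e c \<noteq> up Var_x b" if "coord e c \<noteq> 0" using up_down[OF that] b(1) c unfolding socle_def by metis
    moreover have "c = up Var_x b \<longleftrightarrow> coord e c \<noteq> 0 \<and> down e c = b" using up_down[of e c] True by auto
    ultimately show ?thesis using minimal_generator_up[OF g(1) u] True by auto
  next
    case False
    have "up e u \<noteq> up Var_x g"
    proof
      assume eq: "up e u = up Var_x g"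
      then have "coord e (up Var_x g) \<noteq> 0" "u = down e (up Var_x g)" using down_up[of e u] coord_up[of e e u] by (metis nat.simps(3))+
      then have "u = up Var_x (down e g)" "coord e g \<noteq> 0" using False by (auto simp: down_up_commute)
      then show False using g(2)[OF False] u by simp
    qed
    moreover have "down e c \<noteq> b" "down e c \<noteq> up Var_x b" if "coord e c \<noteq> 0"
      using up_down[OF that] b c False unfolding socle_def by metis+
    ultimately show ?thesis using minimal_generator_up[OF g(1) u] by auto
  qed
qed

definition witness_generators :: "expo list" where
  "witness_generators = [(0,0,5), (0,1,4), (0,2,3), (0,3,2), (0,4,1), (0,5,0), (1,0,4), (1,1,3), (1,2,2), (1,3,1), (1,4,0), (2,0,3), (2,1,2), (2,2,1), (2,3,0), (3,0,2), (3,1,1), (3,2,0), (5,0,1), (5,1,0), (7,0,0)]"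

definition witness_socle :: "expo list" where
  "witness_socle = [(0,0,4), (0,1,3), (0,2,2), (0,3,1), (0,4,0), (1,0,3), (1,1,2), (1,2,1), (1,3,0), (2,0,2), (2,1,1), (2,2,0), (4,0,1), (4,1,0), (6,0,0)]"

definition special_generators :: "expo list" where
  "special_generators = [(3,0,2), (3,1,1), (3,2,0), (5,0,1), (5,1,0), (7,0,0)]"

text \<open>Each is one factor x short of a socle monomial: x^6, x^4 z and x^4 y.\<close>

definition special_standard :: "expo list" where
  "special_standard = [(5,0,0), (3,0,1), (3,1,0)]"

lemma all_var3: "(\<forall>e. P e) \<longleftrightarrow> P Var_x \<and> P Var_y \<and> P Var_z"
  by (metis var3.exhaust)

lemma witness_generators: "g \<in> set witness_generators \<Longrightarrow> minimal_generator witness g"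
  by (auto simp: witness_generators_def minimal_generator_def all_var3 in_witness)

lemma witness_socle: "b \<in> set witness_socle \<Longrightarrow> socle witness b"
  by (auto simp: witness_socle_def socle_def all_var3 in_witness)

lemma special_support_closed:
  assumes "g \<in> set special_generators" "b \<in> set special_standard"
  shows "support_closed witness {(g, b), (up Var_x g, up Var_x b)}"
proof (rule support_closed_pair[OF staircase_witness])
  have "\<forall>e. e \<noteq> Var_x \<longrightarrow> coord e g \<noteq> 0 \<longrightarrow> up Var_x (down e g) \<in> witness"
    using assms(1) unfolding all_var3 by (auto simp: special_generators_def in_witness)
  then show "up Var_x (down e g) \<in> witness" if "e \<noteq> Var_x" "coord e g \<noteq> 0" for e using that by blast
  have "\<forall>e. e \<noteq> Var_x \<longrightarrow> up e b \<notin> witness"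
    using assms(2) unfolding all_var3 by (auto simp: special_standard_def in_witness)
  then show "up e b \<notin> witness" if "e \<noteq> Var_x" for e using that by blast
  show "minimal_generator witness g"
    using assms(1) by (intro witness_generators) (auto simp: special_generators_def witness_generators_def)
  show "socle witness (up Var_x b)"
    using assms(2) by (intro witness_socle) (auto simp: special_standard_def witness_socle_def)
qed

text \<open>The companion coordinate (x g, x b) of a linked vector is not in \<open>P\<close>,
  because x g is not a minimal generator. So every vector meets \<open>P\<close> only in its own
  index, and \<open>P\<close> has 21 * 15 + 6 * 3 = 333 elements.\<close>

theorem tangents_witness:
  assumes Q: "finite Q" "determines Q (tangents witness :: (_ \<Rightarrow> 'k::field) set)"
  shows "333 \<le> card Q"
proof -
  define P where "P = set witness_generators \<times> set witness_socle \<union> set special_generators \<times> set special_standard"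
  define S where "S = (\<lambda>(g, b). if b \<in> set special_standard then {(g, b), (up Var_x g, up Var_x b)} else {(g, b)})"
  have disj: "set witness_socle \<inter> set special_standard = {}" by (auto simp: witness_socle_def special_standard_def)
  have gen: "minimal_generator witness g" if "(g, b) \<in> P" for g b
  proof -
    have "set special_generators \<subseteq> set witness_generators" by (simp add: special_generators_def witness_generators_def)
    then have "g \<in> set witness_generators" using that by (auto simp: P_def simp del: split_paired_All)
    then show ?thesis by (rule witness_generators)
  qed
  have S: "support_closed witness (S (g, b))" if "(g, b) \<in> P" for g b
  proof (cases "b \<in> set special_standard")
    case True
    then have "g \<in> set special_generators" using that disj by (auto simp: P_def)
    then show ?thesis using special_support_closed True by (simp add: S_def)
  next
    case False
    then have "b \<in> set witness_socle" using that by (auto simp: P_def)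
    then show ?thesis using support_closed_singleton[OF gen[OF that] witness_socle] False by (simp add: S_def)
  qed
  have "dual_family P (tangents witness) (\<lambda>q i. of_bool (i \<in> S q) :: 'k)"
    unfolding dual_family_def
  proof (intro ballI conjI)
    fix q assume q: "q \<in> P"
    obtain g b where gb: "q = (g, b)" by (cases q) blast
    show "(\<lambda>i. of_bool (i \<in> S q)) \<in> (tangents witness :: (_ \<Rightarrow> 'k) set)"
      using q S unfolding gb by (intro tangents_of_support) blast
    fix r assume r: "r \<in> P"
    obtain g' b' where gb': "r = (g', b')" by (cases r) blast
    have "up Var_x g \<noteq> g'"
      using gen[of g' b'] gen[of g b] q r gb gb' by (intro minimal_generator_up) (auto simp: minimal_generator_def)
    then show "(of_bool (r \<in> S q) :: 'k) = of_bool (r = q)" by (auto simp: gb gb' S_def)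
  qed
  moreover have "finite P" by (simp add: P_def)
  ultimately have "card P \<le> card Q"
    using Q by (intro dual_family_card_le[OF fun_subspace_tangents, where h = "\<lambda>i f. f i"])
      (auto simp: linear_functional_coordinate intro: determinesD)
  moreover have "card P = 333"
  proof -
    have "card P = card (set witness_generators) * card (set witness_socle) + card (set special_generators) * card (set special_standard)"
      unfolding P_def using disj by (subst card_Un_disjoint) (auto simp: card_cartesian_product)
    moreover have "card (set witness_generators) = 21" "card (set witness_socle) = 15"
        "card (set special_generators) = 6" "card (set special_standard) = 3"
      by (simp_all add: witness_generators_def witness_socle_def special_generators_def special_standard_def)
    ultimately show ?thesis by simp
  qed
  ultimately show ?thesis by simp
qed

theorem max_tangent_dim_hilb3_39:
  "333 \<le> Max {tangent_dim I | I :: 'k::field poly3 set. I \<in> hilb3 39}"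
proof -
  let ?I = "monomial_ideal id witness :: 'k poly3 set"
  obtain Q where "finite Q" "determines Q (tangents witness :: (_ \<Rightarrow> 'k) set)" "tangent_dim ?I = card Q"
    using tangent_dim_monomial_ideal[OF bij_id staircase_witness] by metis
  then have "333 \<le> tangent_dim ?I" using tangents_witness by simp
  also have "\<dots> \<le> Max {tangent_dim I | I :: 'k poly3 set. I \<in> hilb3 39}"
  proof (rule Max_ge)
    have "{tangent_dim I | I :: 'k poly3 set. I \<in> hilb3 39} \<subseteq> {..(1 + 3 * 39) * 39}"
      using tangent_dim_le by blast
    then show "finite {tangent_dim I | I :: 'k poly3 set. I \<in> hilb3 39}" by (rule finite_subset) simp
    have "?I \<in> hilb3 39" using monomial_ideal_hilb3[OF bij_id staircase_witness] by (simp add: card_witness)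
    then show "tangent_dim ?I \<in> {tangent_dim I | I :: 'k poly3 set. I \<in> hilb3 39}" by blast
  qed
  finally show ?thesis .
qed

section \<open>Evaluation at points\<close>

definition eval_monom :: "('v \<Rightarrow> 'k::comm_ring_1) \<Rightarrow> 'v monom \<Rightarrow> 'k" where
  "eval_monom a m = (\<Prod>v\<in>Poly_Mapping.keys m. a v ^ Poly_Mapping.lookup m v)"

lemma eval_poly_lin_ext: "eval_poly a = lin_ext (eval_monom a)"
  by (intro ext) (simp add: eval_poly_def lin_ext_def eval_monom_def)

lemma eval_monom_superset:
  assumes "finite A" "Poly_Mapping.keys m \<subseteq> A"
  shows "eval_monom a m = (\<Prod>v\<in>A. a v ^ Poly_Mapping.lookup m v)"
  unfolding eval_monom_def using assms by (intro prod.mono_neutral_left) (auto simp: in_keys_iff)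

lemma eval_monom_add: "eval_monom a (m + n) = eval_monom a m * eval_monom a n"
proof -
  let ?A = "Poly_Mapping.keys m \<union> Poly_Mapping.keys n"
  have "Poly_Mapping.keys (m + n) \<subseteq> ?A" by (rule keys_add)
  then show ?thesis
    using eval_monom_superset[of ?A m a] eval_monom_superset[of ?A n a] eval_monom_superset[of ?A "m + n" a]
    by (simp add: lookup_add power_add prod.distrib)
qed

lemma eval_monom_0: "eval_monom a 0 = 1"
  by (simp add: eval_monom_def)

lemma eval_poly_mult: "eval_poly a (p * q) = eval_poly a p * eval_poly a q"
proof -
  have "p * q = (\<Sum>m\<in>Poly_Mapping.keys p. Poly_Mapping.single m (Poly_Mapping.lookup p m) * q)"
    by (subst poly_eq_sum[of p]) (simp add: sum_distrib_right)
  also have "\<dots> = (\<Sum>m\<in>Poly_Mapping.keys p. const_poly (Poly_Mapping.lookup p m) * (Poly_Mapping.single m 1 * q))"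
    by (simp add: const_poly_mult_monom mult.assoc[symmetric])
  finally have "eval_poly a (p * q) = (\<Sum>m\<in>Poly_Mapping.keys p. Poly_Mapping.lookup p m * lin_ext (\<lambda>n. eval_monom a (m + n)) q)"
    unfolding eval_poly_lin_ext by (simp add: lin_ext_sum lin_ext_const_mult lin_ext_monom_mult)
  also have "\<dots> = (\<Sum>m\<in>Poly_Mapping.keys p. Poly_Mapping.lookup p m * (eval_monom a m * eval_poly a q))"
    unfolding eval_poly_lin_ext lin_ext_def by (simp add: eval_monom_add sum_distrib_left mult_ac)
  also have "\<dots> = eval_poly a p * eval_poly a q"
    unfolding eval_poly_lin_ext[of a] lin_ext_def[of _ p] by (simp only: sum_distrib_right mult.assoc)
  finally show ?thesis .
qed

lemma comm_ring_hom_eval_poly: "comm_ring_hom (eval_poly a)"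
proof unfold_locales
  show "eval_poly a (p + q) = eval_poly a p + eval_poly a q" for p q
    by (simp add: eval_poly_lin_ext lin_ext_add)
  show "eval_poly a (p * q) = eval_poly a p * eval_poly a q" for p q by (rule eval_poly_mult)
  show "eval_poly a 0 = 0" by (simp add: eval_poly_lin_ext lin_ext_zero)
  show "eval_poly a 1 = 1"
    using lin_ext_single[of "eval_monom a" 0 1] by (simp add: eval_poly_lin_ext eval_monom_0)
qed

text \<open>Irreducibility of affine space by restriction to the line through a point of
  \<open>U\<close> and a point of \<open>U'\<close>: both polynomials become nonzero in one
  variable, and an infinite field contains a point where neither vanishes.\<close>

lemma zariski_open_inter_nonempty:
  assumes U: "zariski_open V U" "U \<noteq> {}" and U': "zariski_open V U'" "U' \<noteq> ({} :: ('v \<Rightarrow> 'k::field_char_0) set)"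
  shows "U \<inter> U' \<noteq> {}"
proof -
  obtain E E' where E: "U = {a \<in> V \<rightarrow>\<^sub>E UNIV. \<exists>p\<in>E. eval_poly a p \<noteq> 0}"
    and E': "U' = {a \<in> V \<rightarrow>\<^sub>E UNIV. \<exists>p\<in>E'. eval_poly a p \<noteq> 0}"
    using U(1) U'(1) unfolding zariski_open_def by blast
  obtain a p where a: "a \<in> V \<rightarrow>\<^sub>E UNIV" "p \<in> E" "eval_poly a p \<noteq> 0" using U(2) E by blast
  obtain b q where b: "b \<in> V \<rightarrow>\<^sub>E UNIV" "q \<in> E'" "eval_poly b q \<noteq> 0" using U'(2) E' by blast
  define c where "c t = (\<lambda>v. a v + t * (b v - a v))" for t
  define R where "R r = (\<Sum>m\<in>Poly_Mapping.keys r. [:Poly_Mapping.lookup r m:] *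
      (\<Prod>v\<in>Poly_Mapping.keys m. [:a v, b v - a v:] ^ Poly_Mapping.lookup m v))" for r
  have R: "poly (R r) t = eval_poly (c t) r" for r t
    by (simp add: R_def eval_poly_def poly_sum poly_prod poly_power c_def)
  have c01: "c 0 = a" "c 1 = b" by (auto simp: c_def)
  have "R p * R q \<noteq> 0" using R[of p 0] R[of q 1] a(3) b(3) by (auto simp: c01)
  then have "finite {t. poly (R p * R q) t = 0}" by (rule poly_roots_finite)
  then obtain t where "poly (R p * R q) t \<noteq> 0"
    using ex_new_if_finite[OF infinite_UNIV_char_0[where 'a = 'k]] by (metis (mono_tags) mem_Collect_eq)
  then have "eval_poly (c t) p \<noteq> 0" "eval_poly (c t) q \<noteq> 0" by (auto simp: R)
  \<comment> \<open>Off \<open>V\<close> both points take the value \<open>undefined\<close>, so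
    their difference is 0 and the whole line stays extensional.\<close>
  moreover have "c t \<in> V \<rightarrow>\<^sub>E UNIV" using a(1) b(1) by (auto simp: c_def PiE_def extensional_def)
  ultimately have "c t \<in> U \<inter> U'" using a(2) b(2) by (auto simp: E E')
  then show ?thesis by blast
qed

section \<open>Configurations imposing independent conditions\<close>

text \<open>For \<open>card L = d\<close> this is the nonvanishing of the determinant of the
  evaluation matrix, hence an open condition on the configuration.\<close>

definition independent_conditions :: "var3 monom set \<Rightarrow> nat \<Rightarrow> (nat \<times> var3 \<Rightarrow> 'k::field) \<Rightarrow> bool" where
  "independent_conditions L d a \<longleftrightarrow>
     (\<forall>c. (\<forall>i<d. (\<Sum>m\<in>L. eval_monom (config_point a i) m * c m) = 0) \<longrightarrow> (\<forall>m\<in>L. c m = 0))"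

text \<open>Two equal points would leave d - 1 linear conditions on d unknowns.\<close>

lemma independent_conditions_inj:
  assumes L: "finite L" "card L = d" and a: "independent_conditions L d a"
  shows "inj_on (config_point a) {..<d}"
proof (rule inj_onI, rule ccontr)
  fix i j assume ij: "i \<in> {..<d}" "j \<in> {..<d}" "config_point a i = config_point a j" "i \<noteq> j"
  have "card ({..<d} - {j}) < card L" using ij L by simp
  then obtain c where c: "\<exists>m\<in>L. c m \<noteq> 0" "\<forall>k\<in>{..<d} - {j}. (\<Sum>m\<in>L. eval_monom (config_point a k) m * c m) = 0"
    using homogeneous_system_nontrivial[of "{..<d} - {j}" L "\<lambda>k. eval_monom (config_point a k)"] L(1) by auto
  have "(\<Sum>m\<in>L. eval_monom (config_point a k) m * c m) = 0" if "k < d" for k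
    using c(2)[rule_format, of k] c(2)[rule_format, of i] that ij by (cases "k = j") auto
  with a c(1) show False unfolding independent_conditions_def by blast
qed

text \<open>The target values form an extra column \<open>None\<close>, so there are d + 1 unknowns
  for d equations. By independence the coefficient of this column in a nontrivial solution cannot be
  0, and dividing by it solves the system.\<close>

lemma independent_conditions_interpolate:
  assumes L: "finite L" "card L = d" and a: "independent_conditions L d (a :: _ \<Rightarrow> 'k::field)"
  shows "\<exists>c. \<forall>i<d. (\<Sum>m\<in>L. eval_monom (config_point a i) m * c m) = t i"
proof -
  define G where "G i x = (case x of None \<Rightarrow> t i | Some m \<Rightarrow> eval_monom (config_point a i) m)" for i x
  have "card {..<d} < card (insert None (Some ` L))" using L by (simp add: card_image)
  then obtain v where v: "\<exists>x\<in>insert None (Some ` L). v x \<noteq> 0" "\<forall>i\<in>{..<d}. (\<Sum>x\<in>insert None (Some ` L). G i x * v x) = 0"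
    using homogeneous_system_nontrivial[of "{..<d}" "insert None (Some ` L)" G] L(1) by auto
  have sum: "t i * v None + (\<Sum>m\<in>L. eval_monom (config_point a i) m * v (Some m)) = 0" if "i < d" for i
    using v(2) that L(1) by (simp add: G_def sum.reindex)
  have None: "v None \<noteq> 0"
  proof
    assume 0: "v None = 0"
    have "\<forall>i<d. (\<Sum>m\<in>L. eval_monom (config_point a i) m * v (Some m)) = 0"
    proof (intro allI impI)
      fix i assume "i < d"
      from sum[OF this] 0 show "(\<Sum>m\<in>L. eval_monom (config_point a i) m * v (Some m)) = 0" by simp
    qed
    then have "\<forall>m\<in>L. v (Some m) = 0"
      by (rule a[unfolded independent_conditions_def, THEN spec, THEN mp])
    with 0 v(1) show False by auto
  qed
  have "(\<Sum>m\<in>L. eval_monom (config_point a i) m * (- v (Some m) / v None)) = t i" if "i < d" for i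
  proof -
    define s where "s = (\<Sum>m\<in>L. eval_monom (config_point a i) m * v (Some m))"
    have "(\<Sum>m\<in>L. eval_monom (config_point a i) m * (- v (Some m) / v None)) = - s / v None"
      unfolding s_def by (simp add: sum_divide_distrib sum_negf)
    moreover have "s = - (t i * v None)" using sum[OF that] unfolding s_def[symmetric] by (simp add: add_eq_0_iff)
    ultimately show ?thesis using None by simp
  qed
  then show ?thesis by (intro exI[of _ "\<lambda>m. - v (Some m) / v None"] allI impI)
qed

lemma power_products_inject:
  fixes a b c :: nat
  assumes eq: "2 ^ a * 3 ^ b * 5 ^ c = (2 ^ a' * 3 ^ b' * 5 ^ c' :: nat)"
  shows "(a, b, c) = (a', b', c')"
proof -
  have p: "prime_elem (2 :: nat)" "prime_elem (3 :: nat)" "prime_elem (5 :: nat)" by (simp_all add: prime_elem_nat_iff)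
  have m0: "multiplicity 2 (3 :: nat) = 0" "multiplicity 2 (5 :: nat) = 0" "multiplicity 3 (2 :: nat) = 0"
    "multiplicity 3 (5 :: nat) = 0" "multiplicity 5 (2 :: nat) = 0" "multiplicity 5 (3 :: nat) = 0"
    by (auto intro!: not_dvd_imp_multiplicity_0)
  have "multiplicity 2 (2 ^ a * 3 ^ b * 5 ^ c :: nat) = a" for a b c
    using p m0 by (simp add: prime_elem_multiplicity_mult_distrib prime_elem_multiplicity_power_distrib)
  moreover have "multiplicity 3 (2 ^ a * 3 ^ b * 5 ^ c :: nat) = b" for a b c
    using p m0 by (simp add: prime_elem_multiplicity_mult_distrib prime_elem_multiplicity_power_distrib)
  moreover have "multiplicity 5 (2 ^ a * 3 ^ b * 5 ^ c :: nat) = c" for a b c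
    using p m0 by (simp add: prime_elem_multiplicity_mult_distrib prime_elem_multiplicity_power_distrib)
  ultimately show ?thesis using eq by (metis (no_types))
qed

text \<open>The configuration of the points \<open>(2\<^sup>i, 3\<^sup>i, 5\<^sup>i)\<close>: its evaluation matrices are of Vandermonde
  type, with pairwise distinct nodes \<open>2\<^sup>a 3\<^sup>b 5\<^sup>c\<close>.\<close>

definition power_config :: "nat \<Rightarrow> nat \<times> var3 \<Rightarrow> 'k::field_char_0" where
  "power_config d = (\<lambda>(i, v). if i < d then of_nat (case v of Var_x \<Rightarrow> 2 | Var_y \<Rightarrow> 3 | Var_z \<Rightarrow> 5) ^ i else undefined)"

definition node :: "var3 monom \<Rightarrow> nat" where
  "node m = (case expo_of id m of (a, b, c) \<Rightarrow> 2 ^ a * 3 ^ b * 5 ^ c)"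

lemma node_inject: "node m = node n \<longleftrightarrow> m = n"
proof
  assume "node m = node n"
  moreover obtain a b c where m: "expo_of id m = (a, b, c)" by (cases "expo_of id m")
  moreover obtain a' b' c' where n: "expo_of id n = (a', b', c')" by (cases "expo_of id n")
  ultimately have "(a, b, c) = (a', b', c')" by (intro power_products_inject) (simp add: node_def)
  then have "expo_of id m = expo_of id n" by (simp only: m n)
  then show "m = n" using monom_of_expo_of[OF bij_id] by metis
qed simp

lemma eval_power_config:
  assumes "i < d"
  shows "eval_monom (config_point (power_config d) i) m = (of_nat (node m) ^ i :: 'k::field_char_0)"
proof -
  have "eval_monom (config_point (power_config d) i) m =
      (\<Prod>v\<in>{Var_x, Var_y, Var_z}. config_point (power_config d) i v ^ Poly_Mapping.lookup m v :: 'k)"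
    by (rule eval_monom_superset) (use UNIV_var3 in blast)+
  then show ?thesis
    using assms by (simp add: config_point_def power_config_def node_def expo_of_def power_mult_distrib power_mult[symmetric] mult_ac)
qed

lemma polys_in_det_closed:
  fixes V :: "'v set"
  defines "R \<equiv> {p :: ('v, 'k::comm_ring_1) mpoly. \<forall>m\<in>Poly_Mapping.keys p. Poly_Mapping.keys m \<subseteq> V}"
  assumes A: "A \<in> carrier_mat n n" "\<And>i j. i < n \<Longrightarrow> j < n \<Longrightarrow> A $$ (i, j) \<in> R"
  shows "det A \<in> R"
proof -
  have add: "p + q \<in> R" if "p \<in> R" "q \<in> R" for p q
    using that keys_add[of p q] by (auto simp: R_def)
  have mult: "p * q \<in> R" if "p \<in> R" "q \<in> R" for p q
  proof -
    have "Poly_Mapping.keys m \<subseteq> V" if m: "m \<in> Poly_Mapping.keys (p * q)" for m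
    proof -
      obtain a b where "m = a + b" "a \<in> Poly_Mapping.keys p" "b \<in> Poly_Mapping.keys q"
        using keys_mult[of p q] m by blast
      moreover from this have "Poly_Mapping.keys a \<subseteq> V" "Poly_Mapping.keys b \<subseteq> V"
        using \<open>p \<in> R\<close> \<open>q \<in> R\<close> by (auto simp: R_def)
      ultimately show ?thesis using keys_add[of a b] by blast
    qed
    then show ?thesis by (simp add: R_def)
  qed
  have const: "0 \<in> R" "1 \<in> R" by (auto simp: R_def)
  have uminus: "- p \<in> R" if "p \<in> R" for p
    using that by (simp add: R_def Ball_def in_keys_iff)
  have sum: "(\<Sum>i\<in>B. f i) \<in> R" if "\<And>i. i \<in> B \<Longrightarrow> f i \<in> R" for B and f :: "'b \<Rightarrow> ('v, 'k) mpoly"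
    using that by (induction B rule: infinite_finite_induct) (auto intro: const add)
  have prod: "(\<Prod>i\<in>B. f i) \<in> R" if "\<And>i. i \<in> B \<Longrightarrow> f i \<in> R" for B and f :: "'b \<Rightarrow> ('v, 'k) mpoly"
    using that by (induction B rule: infinite_finite_induct) (auto intro: const mult)
  have dim: "dim_row A = n" "dim_col A = n" using A(1) by auto
  have "signof \<pi> * (\<Prod>i = 0..<n. A $$ (i, \<pi> i)) \<in> R" if "\<pi> permutes {0..<n}" for \<pi>
  proof (rule mult)
    show "signof \<pi> \<in> R" using const uminus by (simp add: sign_def)
    show "(\<Prod>i = 0..<n. A $$ (i, \<pi> i)) \<in> R"
    proof (rule prod)
      fix i assume "i \<in> {0..<n}"
      then show "A $$ (i, \<pi> i) \<in> R" using A(2) permutes_in_image[OF that, of i] by simp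
    qed
  qed
  then show ?thesis unfolding det_def dim by (auto intro: sum)
qed

lemma independent_conditions_open:
  assumes L: "finite L" "card L = d"
  shows "\<exists>U. zariski_open ({..<d} \<times> UNIV) U \<and> U \<noteq> {} \<and>
    (\<forall>a\<in>U. independent_conditions L d (a :: _ \<Rightarrow> 'k::field_char_0))"
proof -
  obtain f where f: "bij_betw f {..<d} L" using ex_bij_betw_nat_finite[OF L(1)] L(2) by (auto simp: atLeast0LessThan)
  let ?V = "{..<d} \<times> (UNIV :: var3 set)"
  define X where "X i m = Poly_Mapping.single (\<Sum>v\<in>UNIV. Poly_Mapping.single (i, v) (Poly_Mapping.lookup m v)) (1 :: 'k)"
    for i :: nat and m :: "var3 monom"
  define M where "M = mat d d (\<lambda>(i, j). X i (f j))"
  define E where "E a = mat d d (\<lambda>(i, j). eval_monom (config_point a i) (f j))" for a :: "nat \<times> var3 \<Rightarrow> 'k"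
  have eval_X: "eval_poly a (X i m) = eval_monom (config_point a i) m" for a i m
  proof -
    have single: "eval_monom a (Poly_Mapping.single w n) = a w ^ n" for w :: "nat \<times> var3" and n
      by (cases "n = 0") (simp_all add: eval_monom_def)
    have "eval_monom (config_point a i) m = (\<Prod>v\<in>UNIV. a (i, v) ^ Poly_Mapping.lookup m v)"
      by (subst eval_monom_superset[of UNIV]) (simp_all add: finite_subset[OF _ finite.intros(2)] UNIV_var3[THEN eq_refl, THEN finite_subset] config_point_def)
    also have "\<dots> = (\<Prod>v\<in>UNIV. eval_monom a (Poly_Mapping.single (i, v) (Poly_Mapping.lookup m v)))"
      by (simp add: single)
    also have "\<dots> = eval_monom a (\<Sum>v\<in>UNIV. Poly_Mapping.single (i, v) (Poly_Mapping.lookup m v))"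
      by (simp add: UNIV_var3 eval_monom_add)
    finally show ?thesis by (simp add: X_def eval_poly_lin_ext lin_ext_single)
  qed
  have det: "eval_poly a (det M) = det (E a)" for a
  proof -
    interpret comm_ring_hom "eval_poly a" by (rule comm_ring_hom_eval_poly)
    have "map_mat (eval_poly a) M = E a" by (rule eq_matI) (auto simp: M_def E_def eval_X)
    then show ?thesis using hom_det[of M] by simp
  qed
  have E: "E a \<in> carrier_mat d d" for a by (simp add: E_def)
  define U where "U = {a \<in> ?V \<rightarrow>\<^sub>E UNIV. \<exists>p\<in>{det M}. eval_poly a p \<noteq> 0}"
  have "det M \<in> {p. \<forall>m\<in>Poly_Mapping.keys p. Poly_Mapping.keys m \<subseteq> ?V}"
  proof (rule polys_in_det_closed)
    show "M \<in> carrier_mat d d" by (simp add: M_def)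
    fix i j assume ij: "i < d" "j < d"
    have "Poly_Mapping.keys (\<Sum>v\<in>UNIV. Poly_Mapping.single (i, v) (Poly_Mapping.lookup m v)) \<subseteq> ?V" for m :: "var3 monom"
      by (rule order_trans[OF keys_sum]) (use ij in \<open>auto split: if_splits\<close>)
    then show "M $$ (i, j) \<in> {p. \<forall>m\<in>Poly_Mapping.keys p. Poly_Mapping.keys m \<subseteq> ?V}"
      using ij by (auto simp: M_def X_def)
  qed
  then have "zariski_open ?V U"
    unfolding zariski_open_def U_def by (intro exI[of _ "{det M}"]) auto
  moreover have "independent_conditions L d a" if "a \<in> U" for a
    unfolding independent_conditions_def
  proof (intro allI impI)
    fix c assume c: "\<forall>i<d. (\<Sum>m\<in>L. eval_monom (config_point a i) m * c m) = 0"
    have "det (E a) \<noteq> 0" using that det by (simp add: U_def)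
    have "vec d (\<lambda>j. c (f j)) = 0\<^sub>v d"
    proof (rule ccontr)
      assume nz: "vec d (\<lambda>j. c (f j)) \<noteq> 0\<^sub>v d"
      have "E a *\<^sub>v vec d (\<lambda>j. c (f j)) = 0\<^sub>v d"
      proof (rule eq_vecI)
        fix i assume "i < dim_vec (0\<^sub>v d :: 'k vec)"
        then have i: "i < d" by simp
        have "(E a *\<^sub>v vec d (\<lambda>j. c (f j))) $ i = (\<Sum>j\<in>{0..<d}. eval_monom (config_point a i) (f j) * c (f j))"
          using i by (simp add: E_def scalar_prod_def)
        also have "\<dots> = (\<Sum>m\<in>L. eval_monom (config_point a i) m * c m)"
          unfolding atLeast0LessThan by (rule sum.reindex_bij_betw[OF f])
        finally show "(E a *\<^sub>v vec d (\<lambda>j. c (f j))) $ i = 0\<^sub>v d $ i" using c i by simp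
      qed (simp add: E_def)
      then show False using det_0_iff_vec_prod_zero_field[OF E[of a]] nz \<open>det (E a) \<noteq> 0\<close> by (metis vec_carrier)
    qed
    then have "c (f j) = 0" if "j < d" for j using that by (metis index_vec index_zero_vec(1))
    then show "\<forall>m\<in>L. c m = 0" using f by (auto simp: bij_betw_def)
  qed
  moreover have "power_config d \<in> U"
  proof -
    let ?a = "power_config d :: _ \<Rightarrow> 'k"
    \<comment> \<open>A kernel vector of the transpose is the coefficient sequence of a polynomial
      of degree below d that vanishes at d distinct nodes. The nodes stay distinct in k because the
      characteristic is 0.\<close>
    have "det (transpose_mat (E ?a)) \<noteq> 0"
    proof
      assume "det (transpose_mat (E ?a)) = 0"
      then obtain v where v: "v \<in> carrier_vec d" "v \<noteq> 0\<^sub>v d" "transpose_mat (E ?a) *\<^sub>v v = 0\<^sub>v d"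
        using det_0_iff_vec_prod_zero_field[of "transpose_mat (E ?a)" d] E by auto
      define p where "p = (\<Sum>i<d. monom (v $ i) i)"
      have coeff: "coeff p i = (if i < d then v $ i else 0)" for i
        by (simp add: p_def coeff_sum if_distrib cong: if_cong)
      have "poly p (of_nat (node (f j))) = 0" if j: "j < d" for j
      proof -
        have "poly p (of_nat (node (f j))) = (\<Sum>i\<in>{0..<d}. eval_monom (config_point ?a i) (f j) * v $ i)"
          by (simp add: p_def poly_sum poly_monom atLeast0LessThan eval_power_config mult.commute)
        also have "\<dots> = (transpose_mat (E ?a) *\<^sub>v v) $ j"
          using j v(1) by (simp add: E_def scalar_prod_def)
        finally show ?thesis using v(3) j by simp
      qed
      then have roots: "(\<lambda>m. of_nat (node m)) ` L \<subseteq> {x. poly p x = 0}" using f by (auto simp: bij_betw_def)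
      have "p = 0"
      proof (rule ccontr)
        assume p: "p \<noteq> 0"
        have "card ((\<lambda>m. of_nat (node m) :: 'k) ` L) = d"
          using L(2) by (subst card_image) (auto simp: inj_on_def node_inject)
        then have "d \<le> card {x. poly p x = 0}" using card_mono[OF poly_roots_finite[OF p] roots] by simp
        also have "\<dots> \<le> degree p" by (rule card_poly_roots_bound[OF p])
        finally have "d \<le> degree p" .
        moreover have "coeff p (degree p) \<noteq> 0" using p by simp
        ultimately show False using coeff[of "degree p"] by simp
      qed
      then have "v = 0\<^sub>v d" using v(1) coeff by (intro eq_vecI) (auto, metis coeff_0)
      then show False using v(2) by simp
    qed
    then have "det (E ?a) \<noteq> 0" using det_transpose[OF E] by metis
    moreover have "?a \<in> ?V \<rightarrow>\<^sub>E UNIV" by (auto simp: power_config_def PiE_def extensional_def split: if_splits)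
    ultimately show ?thesis using det by (simp add: U_def)
  qed
  ultimately show ?thesis by blast
qed

section \<open>The generic initial ideal\<close>

definition order_ideal :: "('v monom \<Rightarrow> 'v monom \<Rightarrow> bool) \<Rightarrow> 'v monom set \<Rightarrow> bool" where
  "order_ideal leq L \<longleftrightarrow> finite L \<and> (\<forall>m n. leq m n \<longrightarrow> n \<in> L \<longrightarrow> m \<in> L)"

context
  fixes leq :: "var3 monom \<Rightarrow> var3 monom \<Rightarrow> bool"
  assumes leq: "term_order leq"
begin

lemma term_order_refl: "leq m m"
  and term_order_trans: "leq l m \<Longrightarrow> leq m n \<Longrightarrow> leq l n"
  and term_order_antisym: "leq m n \<Longrightarrow> leq n m \<Longrightarrow> m = n"
  and term_order_total: "leq m n \<or> leq n m"
  and term_order_least: "leq 0 m"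
  and term_order_add: "leq m n \<Longrightarrow> leq (m + l) (n + l)"
proof -
  have lin: "class.linorder leq (\<lambda>s t. leq s t \<and> s \<noteq> t)" using leq by (simp add: term_order_def)
  interpret l: linorder leq "\<lambda>s t. leq s t \<and> s \<noteq> t" by (rule lin)
  show "leq m m" by (rule l.order.refl)
  show "leq l m \<Longrightarrow> leq m n \<Longrightarrow> leq l n" by (rule l.order.trans)
  show "leq m n \<Longrightarrow> leq n m \<Longrightarrow> m = n" by (rule l.order.antisym)
  show "leq m n \<or> leq n m" by (rule l.linear)
  show "leq 0 m" "leq m n \<Longrightarrow> leq (m + l) (n + l)" using leq by (auto simp: term_order_def)
qed

lemma term_order_min: "finite C \<Longrightarrow> C \<noteq> {} \<Longrightarrow> \<exists>c\<in>C. \<forall>m\<in>C. leq c m"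
proof (induction C rule: finite_ne_induct)
  case (singleton c)
  then show ?case using term_order_refl by simp
next
  case (insert c C)
  then obtain b where b: "b \<in> C" "\<forall>m\<in>C. leq b m" by blast
  show ?case
  proof (cases "leq b c")
    case True
    then show ?thesis using b by auto
  next
    case False
    then have "leq c b" using term_order_total by blast
    then have "\<forall>m\<in>insert c C. leq c m" using b(2) term_order_trans term_order_refl by blast
    then show ?thesis by blast
  qed
qed

text \<open>The minimum of the complement of a finite order ideal exists without Dickson's lemma, since it
  is attained on the finitely many monomials bordering the order ideal.\<close>

lemma order_ideal_exists: "\<exists>L. order_ideal leq L \<and> card L = n"
proof (induction n)
  case 0
  then show ?case by (intro exI[of _ "{}"]) (simp add: order_ideal_def)
next
  case (Suc n)
  then obtain L where L: "finite L" "\<And>m n. leq m n \<Longrightarrow> n \<in> L \<Longrightarrow> m \<in> L" "card L = n"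
    unfolding order_ideal_def by blast
  define C where "C = insert 0 (\<Union>v. (+) (Poly_Mapping.single v 1) ` L) - L"
  have C: "finite C" using L(1) by (auto simp: C_def UNIV_var3)
  have below: "\<exists>c\<in>C. leq c (monom_of id u)" if "monom_of id u \<notin> L" for u
    using that
  proof (induction u rule: expo_induct)
    case 1
    then show ?case using term_order_refl by (auto simp: C_def monom_of_0)
  next
    case (2 e u)
    show ?case
    proof (cases "monom_of id u \<in> L")
      case True
      have "monom_of id (up e u) = Poly_Mapping.single e 1 + monom_of id u" unfolding monom_of_up id_apply ..
      then have "monom_of id (up e u) \<in> C" using True 2(2) unfolding C_def by blast
      then show ?thesis using term_order_refl by blast
    next
      case False
      have "leq (monom_of id u) (monom_of id (up e u))"
        using term_order_add[OF term_order_least[of "Poly_Mapping.single e 1"], of "monom_of id u"] by (simp add: monom_of_up)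
      then show ?thesis using 2(1)[OF False] term_order_trans by blast
    qed
  qed
  then have below: "\<exists>c\<in>C. leq c m" if "m \<notin> L" for m
    using that monom_of_expo_of[OF bij_id, of m] by metis
  have "infinite (UNIV :: var3 monom set)"
  proof -
    have "inj (\<lambda>n. Poly_Mapping.single Var_x n :: var3 monom)" by (rule inj_single)
    then show ?thesis using finite_subset[OF subset_UNIV] infinite_UNIV_nat finite_imageD by blast
  qed
  then obtain m where "m \<notin> L" using L(1) ex_new_if_finite by blast
  then have "C \<noteq> {}" using below by blast
  then obtain c where c: "c \<in> C" "\<forall>m\<in>C. leq c m" using term_order_min[OF C] by blast
  have "m \<in> insert c L" if "leq m n" "n \<in> insert c L" for m n
  proof (rule ccontr)
    assume m: "m \<notin> insert c L"
    then have "n = c" using that L(2) by blast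
    obtain c' where "c' \<in> C" "leq c' m" using below m by blast
    then have "leq c m" using c(2) term_order_trans by blast
    then show False using term_order_antisym[of m c] that m \<open>n = c\<close> by blast
  qed
  moreover have "c \<notin> L" using c(1) by (simp add: C_def)
  ultimately show ?case using L by (intro exI[of _ "insert c L"]) (auto simp: order_ideal_def)
qed

lemma sorted_variables:
  "\<exists>\<sigma>. bij \<sigma> \<and> leq (Poly_Mapping.single (\<sigma> Var_x) 1) (Poly_Mapping.single (\<sigma> Var_y) 1) \<and>
    leq (Poly_Mapping.single (\<sigma> Var_y) 1) (Poly_Mapping.single (\<sigma> Var_z) 1)"
proof -
  let ?le = "\<lambda>v w. leq (Poly_Mapping.single v 1) (Poly_Mapping.single w 1)"
  have "\<exists>a b c. distinct [a, b, c] \<and> ?le a b \<and> ?le b c"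
  proof -
    have total: "?le v w \<or> ?le w v" for v w by (rule term_order_total)
    have "distinct [Var_x, Var_y, Var_z]" "distinct [Var_x, Var_z, Var_y]" "distinct [Var_y, Var_x, Var_z]"
      "distinct [Var_y, Var_z, Var_x]" "distinct [Var_z, Var_x, Var_y]" "distinct [Var_z, Var_y, Var_x]" by simp_all
    then show ?thesis using total[of Var_x Var_y] total[of Var_y Var_z] total[of Var_x Var_z] by blast
  qed
  then obtain a b c where abc: "distinct [a, b, c]" "?le a b" "?le b c" by blast
  define \<sigma> where "\<sigma> = (\<lambda>v. case v of Var_x \<Rightarrow> a | Var_y \<Rightarrow> b | Var_z \<Rightarrow> c)"
  have "inj \<sigma>" using abc(1) by (auto simp: \<sigma>_def inj_def split: var3.splits)
  moreover have "finite (UNIV :: var3 set)" by (simp add: UNIV_var3)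
  ultimately have "bij \<sigma>" using finite_UNIV_inj_surj by (intro bijI)
  then show ?thesis using abc by (intro exI[of _ \<sigma>]) (simp add: \<sigma>_def)
qed

lemma expo_order_of_term_order:
  assumes "bij \<sigma>" "leq (Poly_Mapping.single (\<sigma> Var_x) 1) (Poly_Mapping.single (\<sigma> Var_y) 1)"
    "leq (Poly_Mapping.single (\<sigma> Var_y) 1) (Poly_Mapping.single (\<sigma> Var_z) 1)"
  shows "expo_order (\<lambda>u v. leq (monom_of \<sigma> u) (monom_of \<sigma> v))"
  unfolding expo_order_def
proof (intro conjI allI impI)
  fix u v w
  show "leq (monom_of \<sigma> u) (monom_of \<sigma> v) \<Longrightarrow> leq (monom_of \<sigma> v) (monom_of \<sigma> w) \<Longrightarrow> leq (monom_of \<sigma> u) (monom_of \<sigma> w)"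
    by (rule term_order_trans)
  show "leq (monom_of \<sigma> u) (monom_of \<sigma> v) \<Longrightarrow> leq (monom_of \<sigma> v) (monom_of \<sigma> u) \<Longrightarrow> u = v"
    using term_order_antisym[of "monom_of \<sigma> u" "monom_of \<sigma> v"] expo_of_monom_of[OF assms(1)] by metis
  show "leq (monom_of \<sigma> u) (monom_of \<sigma> v) \<or> leq (monom_of \<sigma> v) (monom_of \<sigma> u)" by (rule term_order_total)
  show "leq (monom_of \<sigma> (0, 0, 0)) (monom_of \<sigma> u)" by (simp add: monom_of_0 term_order_least)
next
  fix a b c a' b' c' i j k
  assume "leq (monom_of \<sigma> (a, b, c)) (monom_of \<sigma> (a', b', c'))"
  moreover have "monom_of \<sigma> (a + i, b + j, c + k) = monom_of \<sigma> (a, b, c) + monom_of \<sigma> (i, j, k)" for a b c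
    by (simp add: monom_of_def single_add ac_simps)
  ultimately show "leq (monom_of \<sigma> (a + i, b + j, c + k)) (monom_of \<sigma> (a' + i, b' + j, c' + k))"
    using term_order_add by simp
qed (use assms in \<open>simp_all add: monom_of_def\<close>)

text \<open>A polynomial with leading monomial in \<open>L\<close> is supported in \<open>L\<close>,
  so independence forbids it to vanish at all points. For u outside \<open>L\<close>, interpolating
  u by \<open>L\<close> gives a polynomial of the vanishing ideal whose other monomials all precede
  u.\<close>

lemma initial_ideal_independent:
  assumes L: "order_ideal leq L" "card L = d" and a: "independent_conditions L d (a :: _ \<Rightarrow> 'k::field)"
  shows "{m. \<exists>p\<in>vanishing_ideal (config_point a ` {..<d}). is_leading_monom leq p m} = - L"
proof (intro equalityI subsetI)
  have finL: "finite L" and low: "\<And>m n. leq m n \<Longrightarrow> n \<in> L \<Longrightarrow> m \<in> L" using L(1) unfolding order_ideal_def by blast+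
  {
    fix m assume "m \<in> {m. \<exists>p\<in>vanishing_ideal (config_point a ` {..<d}). is_leading_monom leq p m}"
    then obtain p where p: "\<forall>i<d. eval_poly (config_point a i) p = 0" and m: "m \<in> Poly_Mapping.keys p"
      "\<And>n. n \<in> Poly_Mapping.keys p \<Longrightarrow> leq n m"
      by (auto simp: vanishing_ideal_def is_leading_monom_def)
    show "m \<in> - L"
    proof
      assume "m \<in> L"
      then have keys: "Poly_Mapping.keys p \<subseteq> L" using m(2) low by blast
      have "eval_poly (config_point a i) p = (\<Sum>m\<in>L. eval_monom (config_point a i) m * Poly_Mapping.lookup p m)" for i
        unfolding eval_poly_lin_ext lin_ext_superset[OF finL keys] by (simp add: mult.commute)
      then have "\<forall>i<d. (\<Sum>m\<in>L. eval_monom (config_point a i) m * Poly_Mapping.lookup p m) = 0" using p by simp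
      then have "\<forall>m\<in>L. Poly_Mapping.lookup p m = 0"
        by (rule a[unfolded independent_conditions_def, THEN spec, THEN mp])
      with \<open>m \<in> L\<close> m(1) show False by (simp add: in_keys_iff)
    qed
  }
  fix u assume u: "u \<in> - L"
  obtain c where c: "\<forall>i<d. (\<Sum>m\<in>L. eval_monom (config_point a i) m * c m) = eval_monom (config_point a i) u"
    using independent_conditions_interpolate[OF finL L(2) a, of "\<lambda>i. eval_monom (config_point a i) u"] by blast
  define p where "p = Poly_Mapping.single u 1 + (\<Sum>m\<in>L. Poly_Mapping.single m (- c m))"
  have "eval_poly (config_point a i) p = 0" if "i < d" for i
  proof -
    have "eval_poly (config_point a i) p = eval_monom (config_point a i) u + (\<Sum>m\<in>L. - c m * eval_monom (config_point a i) m)"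
      by (simp add: p_def eval_poly_lin_ext lin_ext_add lin_ext_sum lin_ext_single)
    also have "\<dots> = eval_monom (config_point a i) u - (\<Sum>m\<in>L. eval_monom (config_point a i) m * c m)"
      by (simp add: sum_negf mult.commute)
    finally show ?thesis using c that by simp
  qed
  then have "p \<in> vanishing_ideal (config_point a ` {..<d})" by (auto simp: vanishing_ideal_def)
  moreover have "is_leading_monom leq p u"
    unfolding is_leading_monom_def
  proof (intro conjI ballI)
    have "(\<Sum>m\<in>L. Poly_Mapping.lookup (Poly_Mapping.single m (- c m)) u) = 0"
      using u by (intro sum.neutral) (auto simp: lookup_single when_def)
    then show "u \<in> Poly_Mapping.keys p" by (simp add: p_def in_keys_iff lookup_add lookup_sum)
    fix m assume m: "m \<in> Poly_Mapping.keys p"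
    have "m \<in> L" if "m \<noteq> u"
    proof (rule ccontr)
      assume "m \<notin> L"
      then have "(\<Sum>n\<in>L. Poly_Mapping.lookup (Poly_Mapping.single n (- c n)) m) = 0"
        by (intro sum.neutral) (auto simp: lookup_single when_def)
      then have "Poly_Mapping.lookup p m = 0" using that by (simp add: p_def lookup_add lookup_sum lookup_single when_def)
      with m show False by (simp add: in_keys_iff)
    qed
    then show "leq m u" using u low[of u m] term_order_total[of m u] term_order_refl by blast
  qed
  ultimately show "u \<in> {m. \<exists>p\<in>vanishing_ideal (config_point a ` {..<d}). is_leading_monom leq p m}" by blast
qed

lemma genideal_monomials:
  assumes \<sigma>: "bij \<sigma>" and L: "staircase L"
  shows "genideal poly3_ring {Poly_Mapping.single (monom_of \<sigma> u) (1 :: 'k::field) | u. u \<notin> L} = monomial_ideal \<sigma> L"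
    (is "genideal _ ?S = _")
proof
  have ring: "ring (poly3_ring :: 'k poly3 ring)" by (rule cring.axioms(1)[OF class_cring.is_cring])
  have "?S \<subseteq> monomial_ideal \<sigma> L" by (auto simp: monomial_ideal_def expo_of_monom_of[OF \<sigma>])
  then show "genideal poly3_ring ?S \<subseteq> monomial_ideal \<sigma> L"
    by (rule ring.genideal_minimal[OF ring ideal_monomial_ideal[OF L]])
  define D where "D = genideal poly3_ring ?S"
  have G: "ideal D poly3_ring" unfolding D_def by (rule ring.genideal_ideal[OF ring]) simp
  have SG: "?S \<subseteq> D" unfolding D_def by (rule ring.genideal_self[OF ring]) simp
  have "monomial_ideal \<sigma> L \<subseteq> D"
  proof
    fix p :: "'k poly3" assume p: "p \<in> monomial_ideal \<sigma> L"
    have "Poly_Mapping.single m (Poly_Mapping.lookup p m) \<in> D" if "m \<in> Poly_Mapping.keys p" for m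
    proof -
      have "expo_of \<sigma> m \<notin> L" using p that by (auto simp: monomial_ideal_def)
      then have "Poly_Mapping.single (monom_of \<sigma> (expo_of \<sigma> m)) 1 \<in> D" using SG by blast
      then have "const_poly (Poly_Mapping.lookup p m) * Poly_Mapping.single m 1 \<in> D"
        unfolding monom_of_expo_of[OF \<sigma>] by (rule ideal_mult[OF G])
      then show ?thesis by (simp add: const_poly_mult_monom)
    qed
    moreover have "sum f A \<in> D" if "finite A" "\<And>m. m \<in> A \<Longrightarrow> f m \<in> D" for A and f :: "var3 monom \<Rightarrow> 'k poly3"
      using that by (induction A rule: finite_induct) (auto intro: ideal_zero[OF G] ideal_add[OF G])
    ultimately have "(\<Sum>m\<in>Poly_Mapping.keys p. Poly_Mapping.single m (Poly_Mapping.lookup p m)) \<in> D"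
      by (metis (no_types, lifting) finite_keys)
    then show "p \<in> D" by (simp only: poly_eq_sum[symmetric])
  qed
  then show "monomial_ideal \<sigma> L \<subseteq> genideal poly3_ring ?S" by (simp only: D_def)
qed

text \<open>Any competing value comes with its own nonempty open set, which meets the one where the
  conditions of \<open>L\<close> are independent. So the value is unique and the definite
  description denotes it.\<close>

theorem generic_initial_ideal_eq:
  assumes L: "order_ideal leq L" "card L = d" and \<sigma>: "bij \<sigma>" and st: "staircase (expo_of \<sigma> ` L)"
  shows "generic_initial_ideal leq d = (monomial_ideal \<sigma> (expo_of \<sigma> ` L) :: 'k::field_char_0 poly3 set)"
proof -
  have finL: "finite L" using L(1) by (simp add: order_ideal_def)
  let ?J = "monomial_ideal \<sigma> (expo_of \<sigma> ` L) :: 'k poly3 set"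
  have inj: "expo_of \<sigma> m = expo_of \<sigma> n \<longleftrightarrow> m = n" for m n using monom_of_expo_of[OF \<sigma>] by metis
  have init: "initial_ideal leq (vanishing_ideal (config_point a ` {..<d})) = ?J"
    if "independent_conditions L d a" for a :: "nat \<times> var3 \<Rightarrow> 'k"
  proof -
    have "{Poly_Mapping.single m 1 | m p. p \<in> vanishing_ideal (config_point a ` {..<d}) \<and> is_leading_monom leq p m} =
        (\<lambda>m. Poly_Mapping.single m (1 :: 'k)) ` {m. \<exists>p\<in>vanishing_ideal (config_point a ` {..<d}). is_leading_monom leq p m}"
      by blast
    also have "\<dots> = (\<lambda>m. Poly_Mapping.single m 1) ` (- L)"
      unfolding initial_ideal_independent[OF L that] ..
    also have "\<dots> = {Poly_Mapping.single (monom_of \<sigma> u) 1 | u. u \<notin> expo_of \<sigma> ` L}"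
    proof (intro equalityI subsetI)
      fix x :: "'k poly3" assume "x \<in> (\<lambda>m. Poly_Mapping.single m 1) ` (- L)"
      then obtain m where m: "x = Poly_Mapping.single m 1" "m \<notin> L" by blast
      then have "x = Poly_Mapping.single (monom_of \<sigma> (expo_of \<sigma> m)) 1" "expo_of \<sigma> m \<notin> expo_of \<sigma> ` L"
        by (auto simp: monom_of_expo_of[OF \<sigma>] inj)
      then show "x \<in> {Poly_Mapping.single (monom_of \<sigma> u) 1 | u. u \<notin> expo_of \<sigma> ` L}" by blast
    next
      fix x :: "'k poly3" assume "x \<in> {Poly_Mapping.single (monom_of \<sigma> u) 1 | u. u \<notin> expo_of \<sigma> ` L}"
      then obtain u where u: "x = Poly_Mapping.single (monom_of \<sigma> u) 1" "u \<notin> expo_of \<sigma> ` L" by blast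
      then have "monom_of \<sigma> u \<notin> L" using expo_of_monom_of[OF \<sigma>, of u] by (metis image_eqI)
      with u show "x \<in> (\<lambda>m. Poly_Mapping.single m 1) ` (- L)" by blast
    qed
    finally show ?thesis unfolding initial_ideal_def by (simp only: genideal_monomials[OF \<sigma> st])
  qed
  obtain U :: "(nat \<times> var3 \<Rightarrow> 'k) set" where U: "zariski_open ({..<d} \<times> UNIV) U" "U \<noteq> {}" "\<forall>a\<in>U. independent_conditions L d a"
    using independent_conditions_open[OF finL L(2)] by blast
  show ?thesis
    unfolding generic_initial_ideal_def
  proof (rule the_equality)
    show "\<exists>U :: (nat \<times> var3 \<Rightarrow> 'k) set. zariski_open ({..<d} \<times> UNIV) U \<and> U \<noteq> {} \<and>
        (\<forall>a\<in>U. inj_on (config_point a) {..<d} \<and> initial_ideal leq (vanishing_ideal (config_point a ` {..<d})) = ?J)"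
      using U by (intro exI[of _ U] conjI ballI init independent_conditions_inj[OF finL L(2)]) auto
    fix J :: "'k poly3 set"
    assume "\<exists>U. zariski_open ({..<d} \<times> UNIV) U \<and> U \<noteq> {} \<and>
        (\<forall>a\<in>U. inj_on (config_point a) {..<d} \<and> initial_ideal leq (vanishing_ideal (config_point a ` {..<d})) = J)"
    then obtain U' where U': "zariski_open ({..<d} \<times> UNIV) U'" "U' \<noteq> {}"
      "\<forall>a\<in>U'. initial_ideal leq (vanishing_ideal (config_point a ` {..<d})) = J" by blast
    obtain a where "a \<in> U" "a \<in> U'" using zariski_open_inter_nonempty[OF U(1,2) U'(1,2)] by blast
    then show "J = ?J" using U(3) U'(3) init by blast
  qed
qed

text \<open>Sorting the variables by \<sigma> turns the term order into an
  \<open>expo_order\<close>, for which the exponents of the 39 smallest monomials form a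
  \<open>lower_set\<close>.\<close>

theorem tangent_dim_generic_initial_ideal_39:
  "tangent_dim (generic_initial_ideal leq 39 :: 'k::field_char_0 poly3 set) \<le> 332"
proof -
  obtain \<sigma> where \<sigma>: "bij \<sigma>" and sorted: "leq (Poly_Mapping.single (\<sigma> Var_x) 1) (Poly_Mapping.single (\<sigma> Var_y) 1)"
      "leq (Poly_Mapping.single (\<sigma> Var_y) 1) (Poly_Mapping.single (\<sigma> Var_z) 1)"
    using sorted_variables by blast
  note ord = expo_order_of_term_order[OF \<sigma> sorted]
  obtain L where L: "order_ideal leq L" "card L = 39" using order_ideal_exists by blast
  let ?L = "expo_of \<sigma> ` L"
  have "u \<in> ?L" if "leq (monom_of \<sigma> u) (monom_of \<sigma> v)" "v \<in> ?L" for u v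
  proof -
    have "monom_of \<sigma> v \<in> L" using that(2) by (auto simp: monom_of_expo_of[OF \<sigma>])
    then have "monom_of \<sigma> u \<in> L" using L(1) that(1) unfolding order_ideal_def by blast
    then show ?thesis by (metis expo_of_monom_of[OF \<sigma>] image_eqI)
  qed
  then have low: "lower_set (\<lambda>u v. leq (monom_of \<sigma> u) (monom_of \<sigma> v)) ?L"
    using L(1) unfolding lower_set_def order_ideal_def by blast
  have "inj_on (expo_of \<sigma>) L" by (metis inj_onI monom_of_expo_of[OF \<sigma>])
  then have card: "card ?L = 39" using L(2) by (simp add: card_image)
  have st: "staircase ?L" by (rule borel_fixed_staircase[OF lower_set_borel_fixed[OF ord low]])
  obtain Q c where "finite Q" "dual_family Q (tangents ?L :: (_ \<Rightarrow> 'k) set) c"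
      "tangent_dim (monomial_ideal \<sigma> ?L :: 'k poly3 set) = card Q"
    using tangent_dim_monomial_ideal[OF \<sigma> st] by metis
  then show ?thesis
    using tangents_lower_set_le[OF ord low card] generic_initial_ideal_eq[OF L \<sigma> st] by metis
qed

end

theorem proposition5p6:
  fixes leq :: "var3 monom \<Rightarrow> var3 monom \<Rightarrow> bool"
  assumes "term_order leq"
  shows "tangent_dim (generic_initial_ideal leq 39 :: 'k::field_char_0 poly3 set)
       < Max {tangent_dim I' | I' :: 'k poly3 set. I' \<in> hilb3 39}"
  using tangent_dim_generic_initial_ideal_39[OF assms, where 'k = 'k] max_tangent_dim_hilb3_39[where 'k = 'k]
  by simp

end
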